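(* For the generalized Frobenius manifold $\mathcal M_D=\mathcal M(R,\omega)$, its monodromy group $\mathrm{Mono}(\mathcal M_D)$ is isomorphic to a subgroup of $W_a(R)\cong W(R)\ltimes\mathbb Z^\ell$. More precisely, $$\mathrm{Mono}(\mathcal M_D)\cong\mathrm{Stab}_W(\omega)\ltimes\mathbb Z^\ell,$$ where $\mathrm{Stab}_W(\omega)=\{\sigma\in W(R):\sigma(\omega)=\omega\}$ is the stabilizer of $\omega$ in $W(R)$ and $\mathbb Z^\ell$ is the group of translations by the coroot lattice $\bigoplus_j\mathbb Z\alpha_j^\vee$.
   Context: Root data. $R$ is an irreducible reduced root system in an $\ell$-dimensional Euclidean space $V$ with inner product $(\cdot,\cdot)$, normalized so that $(\alpha,\alpha)\in\mathbb Q$ for $\alpha\in R$; $\alpha_1,\dots,\alpha_\ell$ are simple roots, $\alpha_j^\vee=2\alpha_j/(\alpha_j,\alpha_j)$, and the fundamental weights $\omega_i$ satisfy $(\omega_i,\alpha_j^\vee)=\delta_{ij}$. $W=W(R)$ is the Weyl group and $W_a(R)$ the affine Weyl group, generated by $W$ and translations by the coroot lattice. Fix a nonzero weight $\omega=\sum_j m_j\omega_j$, $m_j\in\mathbb Z_{\ge0}$. Put $\theta_j=(\omega_j,\omega)$ and $\kappa=\gcd\{(\omega,\alpha_r): r=1,\dots,\ell\}$ (the positive generator of the subgroup of $\mathbb Q$ generated by these numbers). Rings. Write $\mathbf x=c\omega+\hat{\mathbf x}$, $\hat{\mathbf x}=\sum_r x^r\alpha_r^\vee$, with $c$ a parameter,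 and $\lambda=e^{-2\pi i\kappa c}$. $\mathscr A=\mathbb C[\lambda]\otimes\mathbb C[e^{\pm2\pi i x^j}: 1\le j\le\ell]$, graded by $\deg e^{2\pi i x^j}=\theta_j$, $\deg\lambda=\kappa$; elements are polynomial in $\lambda$, so can be evaluated at $\lambda=0$. $W_a(R)$ acts on functions by $(\phi^*f)(\mathbf x;c)=f(\phi(\mathbf x);c)$, and $\mathscr A^W$ is the subring of $W_a(R)$-invariant elements of $\mathscr A$. The basic generators are $y^j=e^{-2\pi i\theta_jc}\frac1{N_j}\sum_{\sigma\in W}e^{2\pi i(\omega_j,\sigma(\mathbf x))}\in\mathscr A^W$, $N_j=\#\{\sigma\in W:\sigma(\omega_j)=\omega_j\}$. Elements $z^1,\dots,z^\ell\in\mathscr A^W$ form a set of proper generators if $z^j$ is quasi-homogeneous of degree $\theta_j$ and $z^j|_{\lambda=0}=y^j|_{\lambda=0}$ for all $j$; then $\mathscr A^W=\mathbb C[z^1,\dots,z^\ell;\lambda]$. Metrics. $\mathcal M=\mathbb C^\ell$ with coordinates $z^1,\dots,z^\ell$. Let $(a^{ij})=((\alpha_i^\vee,\alpha_j^\vee))^{-1}$, $g_\lambda^{ij}=\frac1{4\pi^2}\frac{\partial z^i}{\partial x^r}a^{rs}\frac{\partial z^j}{\partial x^s}$ and $\Gamma^{ij}_{g_\lambda,k}=-g_\lambda^{ir}\Gamma^j_{g_\lambda,rk}$ (contravariant Christoffel symbols); all these lie in $\mathbb C[z^1,\dots,z^\ell;\lambda]$. A set of proper generators is a set of pencil generators if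 $g_\lambda^{ij}$ and $\Gamma^{ij}_{g_\lambda,k}$ are at most linear in $\lambda$ and $(\partial_\lambda g_\lambda^{ij})$ is non-degenerate at generic points; then $g_\lambda^{ij}=g^{ij}+\lambda\eta^{ij}$. Fix a set of pencil generators. Let $D_\eta=\{\det\eta=0\}\subset\mathcal M$, $S=\{r:m_r>0\}$, $D_0=\{z\in\mathcal M:\exists\,i\in S,\ z^i=0\}$, $D=D_\eta\cup D_0$, $\mathcal M_D=\mathcal M\setminus D$. Standing assumption. With $E=\sum_r\theta_rz^r\partial_{z^r}$, the operator $\mathcal L_E$ is diagonalizable on the $\ell$-dimensional space of solutions, modulo constants, of $\frac{\partial^2t}{\partial z^i\partial z^j}=\Gamma^k_{\eta,ij}\frac{\partial t}{\partial z^k}$ on the universal cover of $\mathcal M\setminus D_\eta$. Under this assumption $\mathcal M_D$ carries a generalized Frobenius manifold structure (the axioms of a Frobenius manifold except flatness of the unit) with flat metric $\eta$ and intersection form $g$; it is denoted $\mathcal M(R,\omega)$. Monodromy group. Let $\Sigma=\{z\in\mathcal M_D:\det(g^{ij}(z))=0\}$. Local flat coordinates $v^1,\dots,v^\ell$ of $g$ (solutions of $\nabla_g dv=0$) extend to the universal cover of $\mathcal M_D\setminus\Sigma$, and each loop $\gamma\in\pi_1(\mathcal M_D\setminus\Sigma)$ acts by analytic continuation $\gamma^*v^\alpha=A^\alpha_\beta(\gamma)v^\beta+B^\alpha(\gamma)$, giving an affine isometry of the $\ell$-dimensional complex Euclidean space with coordinates $v^1,\dots,v^\ell$. $\mathrm{Mono}(\mathcal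 M_D)$ is the group of all these affine isometries. Here one can take $v^j=x^j|_{\lambda=0}$, the multivalued inverse of the map $\varphi_0:V\otimes\mathbb C\to\mathcal M$, $(x^1,\dots,x^\ell)\mapsto(z^1|_{\lambda=0},\dots,z^\ell|_{\lambda=0})$, so the isometries are isometries of $V\otimes\mathbb C$. *)

theory Defs
  imports
    "HOL-Analysis.Analysis"
    "HOL-Algebra.Bij"
    "HOL-Algebra.Generated_Groups"
    "HOL-Library.Poly_Mapping"
begin

section \<open>Root systems and (affine) Weyl groups\<close>

definition reflection :: "'v::euclidean_space \<Rightarrow> 'v \<Rightarrow> 'v" where
  "reflection a x = x - (2 * (x \<bullet> a) / (a \<bullet> a)) *\<^sub>R a"

definition coroot :: "'v::euclidean_space \<Rightarrow> 'v" where
  "coroot a = (2 / (a \<bullet> a)) *\<^sub>R a"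

definition root_system :: "'v::euclidean_space set \<Rightarrow> bool" where
  "root_system R \<longleftrightarrow>
     finite R \<and> 0 \<notin> R \<and> span R = UNIV \<and>
     (\<forall>a\<in>R. reflection a ` R = R) \<and>
     (\<forall>a\<in>R. \<forall>b\<in>R. b \<bullet> coroot a \<in> \<int>)"

definition reduced_root_system :: "'v::euclidean_space set \<Rightarrow> bool" where
  "reduced_root_system R \<longleftrightarrow>
     root_system R \<and> (\<forall>a\<in>R. \<forall>c::real. c *\<^sub>R a \<in> R \<longrightarrow> c = 1 \<or> c = -1)"

definition irreducible_root_system :: "'v::euclidean_space set \<Rightarrow> bool" where
  "irreducible_root_system R \<longleftrightarrow>
     root_system R \<and> R \<noteq> {} \<and>
     \<not> (\<exists>R1 R2. R1 \<noteq> {} \<and> R2 \<noteq> {} \<and> R = R1 \<union> R2 \<and> (\<forall>a\<in>R1. \<forall>b\<in>R2. a \<bullet> b = 0))"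

definition simple_roots :: "'v::euclidean_space set \<Rightarrow> ('n::finite \<Rightarrow> 'v) \<Rightarrow> bool" where
  "simple_roots R \<alpha> \<longleftrightarrow>
     inj \<alpha> \<and> range \<alpha> \<subseteq> R \<and> independent (range \<alpha>) \<and>
     (\<forall>b\<in>R. \<exists>k :: 'n \<Rightarrow> nat.
        b = (\<Sum>i\<in>UNIV. of_nat (k i) *\<^sub>R \<alpha> i) \<or> b = - (\<Sum>i\<in>UNIV. of_nat (k i) *\<^sub>R \<alpha> i))"

definition weyl :: "'v::euclidean_space set \<Rightarrow> ('v \<Rightarrow> 'v) set" where
  "weyl R = generate (BijGroup UNIV) (reflection ` R)"

definition coroot_lattice :: "('n::finite \<Rightarrow> 'v::euclidean_space) \<Rightarrow> 'v set" where
  "coroot_lattice \<alpha> = {\<Sum>j\<in>UNIV. of_int (k j) *\<^sub>R coroot (\<alpha> j) | k :: 'n \<Rightarrow> int. True}"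

definition affine_weyl :: "'v::euclidean_space set \<Rightarrow> ('n::finite \<Rightarrow> 'v) \<Rightarrow> ('v \<Rightarrow> 'v) set" where
  "affine_weyl R \<alpha> =
     generate (BijGroup UNIV) (weyl R \<union> {\<lambda>x. x + t | t. t \<in> coroot_lattice \<alpha>})"

definition stab_weyl :: "'v::euclidean_space set \<Rightarrow> 'v \<Rightarrow> ('v \<Rightarrow> 'v) set" where
  "stab_weyl R w = {\<sigma> \<in> weyl R. \<sigma> w = w}"

text \<open>The group of bijections of a type (under composition) restricted to a given set of
  bijections.\<close>

abbreviation transformation_group :: "('a \<Rightarrow> 'a) set \<Rightarrow> ('a \<Rightarrow> 'a) monoid" where
  "transformation_group H \<equiv> (BijGroup UNIV)\<lparr>carrier := H\<rparr>"

definition affine_weyl_group ::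
  "'v::euclidean_space set \<Rightarrow> ('n::finite \<Rightarrow> 'v) \<Rightarrow> ('v \<Rightarrow> 'v) monoid" where
  "affine_weyl_group R \<alpha> = transformation_group (affine_weyl R \<alpha>)"

text \<open>Semidirect product of a set \<open>H\<close> of additive maps with a lattice \<open>L\<close>, for the natural action
  of \<open>H\<close> on \<open>L\<close>; the pair \<open>(\<sigma>, t)\<close> stands for \<open>x \<mapsto> \<sigma> x + t\<close>.\<close>

definition semidirect :: "('v::euclidean_space \<Rightarrow> 'v) set \<Rightarrow> 'v set \<Rightarrow> (('v \<Rightarrow> 'v) \<times> 'v) monoid" where
  "semidirect H L =
     \<lparr>carrier = H \<times> L,
      mult = (\<lambda>(\<sigma>, t) (\<tau>, u). (\<sigma> \<circ> \<tau>, t + \<sigma> u)),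
      one = (id, 0)\<rparr>"

section \<open>Calculus in several complex variables\<close>

definition pd :: "'n::finite \<Rightarrow> (complex^'n \<Rightarrow> complex) \<Rightarrow> complex^'n \<Rightarrow> complex" where
  "pd i f z = deriv (\<lambda>t. f (z + axis i t)) 0"

definition holomorphic_mv :: "(complex^'n::finite \<Rightarrow> complex) \<Rightarrow> (complex^'n) set \<Rightarrow> bool" where
  "holomorphic_mv f S \<longleftrightarrow>
     (\<forall>z\<in>S. \<exists>f'. (f has_derivative f') (at z) \<and> (\<forall>c u. f' (c *s u) = c * f' u))"

definition polynomial_mv :: "(complex^'n::finite \<Rightarrow> complex) \<Rightarrow> bool" where
  "polynomial_mv f \<longleftrightarrow>
     (\<exists>p :: (nat^'n) \<Rightarrow>\<^sub>0 complex.
        \<forall>z. f z = (\<Sum>e\<in>Poly_Mapping.keys p. Poly_Mapping.lookup p e * (\<Prod>i\<in>UNIV. (z $ i) ^ (e $ i))))"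

text \<open>The argument \<open>H\<close> is always a metric on cotangent vectors (upper indices); the metric itself is
  its inverse matrix. \<open>christoffel H k i j\<close> is the Levi-Civita symbol with upper index \<open>k\<close> and lower
  indices \<open>i\<close>, \<open>j\<close>; \<open>contra_christoffel H i j k\<close> has upper indices \<open>i\<close>, \<open>j\<close> and lower index \<open>k\<close>.
  They are meaningful only where \<open>det (H z) \<noteq> 0\<close>.\<close>

definition christoffel ::
  "(complex^'n::finite \<Rightarrow> complex^'n^'n) \<Rightarrow> 'n \<Rightarrow> 'n \<Rightarrow> 'n \<Rightarrow> complex^'n \<Rightarrow> complex" where
  "christoffel H k i j z =
     (let h = (\<lambda>a b w. matrix_inv (H w) $ a $ b)
      in 1/2 * (\<Sum>l\<in>UNIV. H z $ k $ l * (pd i (h l j) z + pd j (h l i) z - pd l (h i j) z)))"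

definition contra_christoffel ::
  "(complex^'n::finite \<Rightarrow> complex^'n^'n) \<Rightarrow> 'n \<Rightarrow> 'n \<Rightarrow> 'n \<Rightarrow> complex^'n \<Rightarrow> complex" where
  "contra_christoffel H i j k z = - (\<Sum>r\<in>UNIV. H z $ i $ r * christoffel H j r k z)"

section \<open>Functions on the universal cover\<close>

text \<open>The universal cover of \<open>X\<close> with base point \<open>b\<close> consists of the homotopy classes (with fixed
  end points) of paths in \<open>X\<close> starting at \<open>b\<close>, the covering map being \<open>pathfinish\<close>. A function on it
  is a function of such paths which is constant on homotopy classes. Near a path \<open>\<gamma>\<close> the cover is
  parametrised by the end point \<open>q\<close> of \<open>\<gamma> +++ linepath (pathfinish \<gamma>) q\<close>, which turns a function
  \<open>F\<close> on the cover into the local function \<open>branch F \<gamma>\<close> on \<open>X\<close>.\<close>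

definition ucover_paths :: "(complex^'n::finite) set \<Rightarrow> complex^'n \<Rightarrow> (real \<Rightarrow> complex^'n) set" where
  "ucover_paths X b = {\<gamma>. path \<gamma> \<and> path_image \<gamma> \<subseteq> X \<and> pathstart \<gamma> = b}"

definition branch ::
  "((real \<Rightarrow> complex^'n::finite) \<Rightarrow> complex) \<Rightarrow> (real \<Rightarrow> complex^'n) \<Rightarrow> complex^'n \<Rightarrow> complex" where
  "branch F \<gamma> q = F (\<gamma> +++ linepath (pathfinish \<gamma>) q)"

definition ucover_holomorphic ::
  "(complex^'n::finite) set \<Rightarrow> complex^'n \<Rightarrow> ((real \<Rightarrow> complex^'n) \<Rightarrow> complex) \<Rightarrow> bool" where
  "ucover_holomorphic X b F \<longleftrightarrow>
     (\<forall>\<gamma>\<in>ucover_paths X b. \<forall>\<delta>. homotopic_paths X \<gamma> \<delta> \<longrightarrow> F \<gamma> = F \<delta>) \<and>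
     (\<forall>\<gamma>\<in>ucover_paths X b. \<exists>\<epsilon>>0.
        ball (pathfinish \<gamma>) \<epsilon> \<subseteq> X \<and> holomorphic_mv (branch F \<gamma>) (ball (pathfinish \<gamma>) \<epsilon>))"

text \<open>Solutions on the universal cover of \<open>X\<close> of the equations for flat functions of the metric
  \<open>H\<close>, i.e. \<open>\<nabla> dF = 0\<close>.\<close>

definition flat_function ::
  "(complex^'n::finite) set \<Rightarrow> complex^'n \<Rightarrow> (complex^'n \<Rightarrow> complex^'n^'n)
     \<Rightarrow> ((real \<Rightarrow> complex^'n) \<Rightarrow> complex) \<Rightarrow> bool" where
  "flat_function X b H F \<longleftrightarrow>
     ucover_holomorphic X b F \<and>
     (\<forall>\<gamma>\<in>ucover_paths X b. \<forall>i j.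
        pd i (pd j (branch F \<gamma>)) (pathfinish \<gamma>) =
        (\<Sum>k\<in>UNIV. christoffel H k i j (pathfinish \<gamma>) * pd k (branch F \<gamma>) (pathfinish \<gamma>)))"

definition flat_coordinates ::
  "(complex^'n::finite) set \<Rightarrow> complex^'n \<Rightarrow> (complex^'n \<Rightarrow> complex^'n^'n)
     \<Rightarrow> ((real \<Rightarrow> complex^'n) \<Rightarrow> complex^'n) \<Rightarrow> bool" where
  "flat_coordinates X b H v \<longleftrightarrow>
     (\<forall>a. flat_function X b H (\<lambda>\<gamma>. v \<gamma> $ a)) \<and>
     (\<forall>\<gamma>\<in>ucover_paths X b.
        det (\<chi> a k. pd k (branch (\<lambda>\<delta>. v \<delta> $ a) \<gamma>) (pathfinish \<gamma>)) \<noteq> 0)"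

text \<open>The affine maps \<open>w \<mapsto> A w + B\<close> obtained by continuing the coordinates \<open>v\<close> along loops: the
  loop \<open>\<gamma>\<close> acts on the universal cover by \<open>\<delta> \<mapsto> \<gamma> +++ \<delta>\<close>.\<close>

definition monodromy ::
  "(complex^'n::finite) set \<Rightarrow> complex^'n \<Rightarrow> ((real \<Rightarrow> complex^'n) \<Rightarrow> complex^'n)
     \<Rightarrow> (complex^'n \<Rightarrow> complex^'n) set" where
  "monodromy X b v =
     {\<lambda>w. A *v w + B | A B. \<exists>\<gamma>\<in>ucover_paths X b. pathfinish \<gamma> = b \<and>
        (\<forall>\<delta>\<in>ucover_paths X b. v (\<gamma> +++ \<delta>) = A *v v \<delta> + B)}"

definition monodromy_group ::
  "(complex^'n::finite) set \<Rightarrow> complex^'n \<Rightarrow> ((real \<Rightarrow> complex^'n) \<Rightarrow> complex^'n)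
     \<Rightarrow> (complex^'n \<Rightarrow> complex^'n) monoid" where
  "monodromy_group X b v = transformation_group (monodromy X b v)"

section \<open>The invariant ring and its pencil generators\<close>

context
  fixes R :: "'v::euclidean_space set"
    and \<alpha> :: "'n::finite \<Rightarrow> 'v"
    and m :: "'n \<Rightarrow> nat"
begin

definition fund_weight :: "'n \<Rightarrow> 'v" where
  "fund_weight j = (THE w. \<forall>i. w \<bullet> coroot (\<alpha> i) = (if i = j then 1 else 0))"

definition omega :: 'v where
  "omega = (\<Sum>j\<in>UNIV. of_nat (m j) *\<^sub>R fund_weight j)"

definition theta :: "'n \<Rightarrow> real" where
  "theta j = fund_weight j \<bullet> omega"

definition kappa :: real where
  "kappa = (THE q. q > 0 \<and>
     {\<Sum>r\<in>UNIV. of_int (k r) * (omega \<bullet> \<alpha> r) | k :: 'n \<Rightarrow> int. True} = {of_int n * q | n :: int. True})"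

text \<open>The complexification of \<open>V\<close> is \<open>complex^'n\<close>, with coordinates relative to the simple coroots:
  the coordinates of a vector are its pairings with the fundamental weights. \<open>affine_ext \<phi>\<close> is the
  complex affine extension of an affine map \<open>\<phi>\<close> of \<open>V\<close>.\<close>

definition coords :: "'v \<Rightarrow> complex^'n" where
  "coords v = (\<chi> s. complex_of_real (fund_weight s \<bullet> v))"

definition affine_ext :: "('v \<Rightarrow> 'v) \<Rightarrow> complex^'n \<Rightarrow> complex^'n" where
  "affine_ext \<phi> x = coords (\<phi> 0) + (\<Sum>r\<in>UNIV. (x $ r) *s coords (\<phi> (coroot (\<alpha> r)) - \<phi> 0))"

definition cpairing :: "'v \<Rightarrow> complex^'n \<Rightarrow> complex" where
  "cpairing p x = (\<Sum>r\<in>UNIV. (x $ r) * complex_of_real (p \<bullet> coroot (\<alpha> r)))"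

text \<open>Elements of the ring \<open>\<A>\<close> are represented by the functions \<open>f \<lambda> x\<close> on \<open>\<complex> \<times> \<complex>^n\<close> that they
  define, where \<open>x\<close> are the coordinates of \<open>x - c \<omega>\<close>. The key \<open>(k, e)\<close> of the coefficient family
  belongs to the monomial \<open>\<lambda>^k exp(2 \<pi> i (e_1 x^1 + ... + e_l x^l))\<close>.\<close>

definition laurent_eval :: "(nat \<times> (int^'n) \<Rightarrow>\<^sub>0 complex) \<Rightarrow> complex \<Rightarrow> complex^'n \<Rightarrow> complex" where
  "laurent_eval p l x =
     (\<Sum>(k, e)\<in>Poly_Mapping.keys p. Poly_Mapping.lookup p (k, e) * l ^ k *
        exp (2 * of_real pi * \<i> * (\<Sum>j\<in>UNIV. of_int (e $ j) * x $ j)))"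

definition ringA :: "(complex \<Rightarrow> complex^'n \<Rightarrow> complex) set" where
  "ringA = range laurent_eval"

definition quasi_homogeneous :: "real \<Rightarrow> (complex \<Rightarrow> complex^'n \<Rightarrow> complex) \<Rightarrow> bool" where
  "quasi_homogeneous d f \<longleftrightarrow>
     (\<exists>p. f = laurent_eval p \<and>
        (\<forall>(k, e)\<in>Poly_Mapping.keys p.
           of_nat k * kappa + (\<Sum>j\<in>UNIV. of_int (e $ j) * theta j) = d))"

definition lam :: "complex \<Rightarrow> complex" where
  "lam c = exp (- 2 * of_real pi * \<i> * of_real kappa * c)"

definition ringAW :: "(complex \<Rightarrow> complex^'n \<Rightarrow> complex) set" where
  "ringAW = {f \<in> ringA. \<forall>\<phi>\<in>affine_weyl R \<alpha>. \<forall>c x.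
     f (lam c) (affine_ext \<phi> (c *s coords omega + x) - c *s coords omega) = f (lam c) x}"

text \<open>\<open>basic_gen j\<close> is the element of \<open>\<A>\<close> whose value at \<open>\<lambda> = lam c\<close> is given by the orbit sum; being
  polynomial in \<open>\<lambda>\<close>, it is determined by these values also at \<open>\<lambda> = 0\<close>, which is not of the form
  \<open>lam c\<close>.\<close>

definition basic_gen :: "'n \<Rightarrow> complex \<Rightarrow> complex^'n \<Rightarrow> complex" where
  "basic_gen j = (THE f. f \<in> ringA \<and> (\<forall>c x.
     f (lam c) x =
       exp (- 2 * of_real pi * \<i> * of_real (theta j) * c) *
       (1 / of_nat (card (stab_weyl R (fund_weight j)))) *
       (\<Sum>\<sigma>\<in>weyl R. exp (2 * of_real pi * \<i> *
          cpairing (fund_weight j) (affine_ext \<sigma> (c *s coords omega + x))))))"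

definition proper_generators :: "('n \<Rightarrow> complex \<Rightarrow> complex^'n \<Rightarrow> complex) \<Rightarrow> bool" where
  "proper_generators z \<longleftrightarrow>
     (\<forall>j. z j \<in> ringAW \<and> quasi_homogeneous (theta j) (z j) \<and> z j 0 = basic_gen j 0)"

definition inv_coroot_gram :: "real^'n^'n" where
  "inv_coroot_gram = matrix_inv (\<chi> i j. coroot (\<alpha> i) \<bullet> coroot (\<alpha> j))"

definition pencil_metric ::
  "('n \<Rightarrow> complex \<Rightarrow> complex^'n \<Rightarrow> complex) \<Rightarrow> 'n \<Rightarrow> 'n \<Rightarrow> complex \<Rightarrow> complex^'n \<Rightarrow> complex" where
  "pencil_metric z i j l x =
     1 / (4 * (of_real pi)\<^sup>2) *
     (\<Sum>r\<in>UNIV. \<Sum>s\<in>UNIV.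
        pd r (z i l) x * of_real (inv_coroot_gram $ r $ s) * pd s (z j l) x)"

text \<open>\<open>z\<close> is a set of pencil generators, and \<open>g\<close>, \<open>\<eta>\<close> are the matrices of polynomials in
  \<open>z^1, ..., z^l\<close> for which \<open>g + \<lambda> \<eta>\<close> is the metric; they are determined by \<open>z\<close>, since
  \<open>z^1, ..., z^l, \<lambda>\<close> are algebraically independent.\<close>

definition pencil_generators ::
  "('n \<Rightarrow> complex \<Rightarrow> complex^'n \<Rightarrow> complex) \<Rightarrow> (complex^'n \<Rightarrow> complex^'n^'n)
     \<Rightarrow> (complex^'n \<Rightarrow> complex^'n^'n) \<Rightarrow> bool" where
  "pencil_generators z g \<eta> \<longleftrightarrow>
     proper_generators z \<and>
     (\<forall>i j. polynomial_mv (\<lambda>w. g w $ i $ j) \<and> polynomial_mv (\<lambda>w. \<eta> w $ i $ j)) \<and>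
     (\<forall>i j l x. pencil_metric z i j l x =
        g (\<chi> k. z k l x) $ i $ j + l * \<eta> (\<chi> k. z k l x) $ i $ j) \<and>
     (\<forall>i j k. \<exists>P Q. polynomial_mv P \<and> polynomial_mv Q \<and>
        (\<forall>l w. det (g w + (\<chi> a b. l * \<eta> w $ a $ b)) \<noteq> 0 \<longrightarrow>
           contra_christoffel (\<lambda>u. g u + (\<chi> a b. l * \<eta> u $ a $ b)) i j k w = P w + l * Q w)) \<and>
     closure {w. det (\<eta> w) \<noteq> 0} = UNIV"

definition D_eta :: "(complex^'n \<Rightarrow> complex^'n^'n) \<Rightarrow> (complex^'n) set" where
  "D_eta \<eta> = {w. det (\<eta> w) = 0}"

definition D_zero :: "(complex^'n) set" where
  "D_zero = {w. \<exists>i. m i > 0 \<and> w $ i = 0}"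

definition M_D :: "(complex^'n \<Rightarrow> complex^'n^'n) \<Rightarrow> (complex^'n) set" where
  "M_D \<eta> = - (D_eta \<eta> \<union> D_zero)"

definition Sigma_D ::
  "(complex^'n \<Rightarrow> complex^'n^'n) \<Rightarrow> (complex^'n \<Rightarrow> complex^'n^'n) \<Rightarrow> (complex^'n) set" where
  "Sigma_D g \<eta> = {w \<in> M_D \<eta>. det (g w) = 0}"

text \<open>The Euler vector field acting on functions on the universal cover.\<close>

definition lie_E :: "((real \<Rightarrow> complex^'n) \<Rightarrow> complex) \<Rightarrow> (real \<Rightarrow> complex^'n) \<Rightarrow> complex" where
  "lie_E F \<gamma> =
     (\<Sum>r\<in>UNIV. of_real (theta r) * pathfinish \<gamma> $ r * pd r (branch F \<gamma>) (pathfinish \<gamma>))"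

text \<open>Existence of a basis, modulo constants, of the space of flat functions of \<open>\<eta>\<close> consisting of
  eigenvectors, modulo constants, of the Euler vector field.\<close>

definition E_diagonalizable :: "(complex^'n \<Rightarrow> complex^'n^'n) \<Rightarrow> complex^'n \<Rightarrow> bool" where
  "E_diagonalizable \<eta> b \<longleftrightarrow>
     (let X = - D_eta \<eta> in
      \<exists>(t :: 'n \<Rightarrow> (real \<Rightarrow> complex^'n) \<Rightarrow> complex) (d :: 'n \<Rightarrow> complex) (s :: 'n \<Rightarrow> complex).
        (\<forall>i. flat_function X b \<eta> (t i)) \<and>
        (\<forall>i. \<forall>\<gamma>\<in>ucover_paths X b. lie_E (t i) \<gamma> = d i * t i \<gamma> + s i) \<and>
        (\<forall>F. flat_function X b \<eta> F \<longrightarrow>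
           (\<exists>!a :: complex^'n. \<exists>c. \<forall>\<gamma>\<in>ucover_paths X b. F \<gamma> = (\<Sum>i\<in>UNIV. a $ i * t i \<gamma>) + c)))"

end

end

theory Submission
  imports Defs "HOL-Complex_Analysis.Conformal_Mappings"
begin

text \<open>
  The flat coordinates \<open>x\<close> of the intersection form invert the map \<open>phi\<close> given by the generators at
  \<open>\<lambda> = 0\<close>. There only the part of each Weyl orbit sum lying over the highest value of \<open>(_, \<omega>)\<close>
  survives, so \<open>phi\<close> is invariant under the group \<open>G\<close> of affine maps with linear part in the
  stabilizer of \<open>\<omega>\<close> and translation part in the coroot lattice. Conversely the coordinates of
  \<open>phi\<close>, together with the inverses of those that are single exponentials, generate all
  \<open>G\<close>-invariant exponential polynomials, and these separate the orbits: the fibres of \<open>phi\<close> are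
  exactly the \<open>G\<close>-orbits.

  The metric pulls back along \<open>phi\<close> to a constant one, so a flat function composed with \<open>phi\<close> is locally
  affine. Hence an affine change of the given flat coordinates \<open>v\<close> inverts \<open>phi\<close> near one point and,
  by analytic continuation, everywhere on the universal cover. It lifts paths through \<open>phi\<close>, without
  any appeal to properness. A loop then moves the lift of the base point inside its fibre by some
  \<open>\<sigma> \<in> G\<close>, and by continuation it acts as \<open>\<sigma>\<close> throughout; every \<open>\<sigma>\<close> occurs because the preimage
  of the regular set, the complement of the zero set of an entire function, is path connected.
\<close>

section \<open>Root systems\<close>

text \<open>Two obstacles decide the shape of the argument. A weight that is dominant only for the
  stabilizer of \<omega> may have negative coefficients, but only at fundamental weights with
  \<open>m s > 0\<close>. Precisely there all surviving terms of the orbit sum coincide: they differ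
  from the fundamental weight by simple roots orthogonal to it, and equal length forces equality. So
  inverses are available where they are needed, and the image of \<open>phi\<close> avoids
  \<open>D_zero\<close> of its own accord. The elimination of lower weights is ordered by length,
  because the stabilizer acts by isometries and a weight is as long as its dominant conjugate.

  On the analytic side neither surjectivity of \<open>phi\<close> onto the regular set nor evenly
  covered neighbourhoods are known in advance. Local injectivity over the regular set is free, since
  an injective affine map factors through \<open>phi\<close> there, and uniqueness of lifts asks for
  no more. Existence of lifts and surjectivity are both contained in the single identity
  \<open>phi (lift \<delta>) = pathfinish \<delta>\<close>.\<close>

text \<open>The notation \<open>inv\<close> is taken by \<open>HOL-Algebra\<close>.\<close>

abbreviation fun_inv :: "('a \<Rightarrow> 'b) \<Rightarrow> 'b \<Rightarrow> 'a" where
  "fun_inv \<equiv> inv_into UNIV"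

lemma reflection_coroot: "reflection a x = x - (x \<bullet> coroot a) *\<^sub>R a"
  by (simp add: reflection_def coroot_def mult.commute)

lemma linear_reflection: "linear (reflection a)"
  by (rule linearI) (simp_all add: reflection_coroot inner_add_left algebra_simps)

lemma inner_reflection: "reflection a x \<bullet> y = x \<bullet> reflection a y"
  by (simp add: reflection_def inner_diff_left inner_diff_right inner_commute)

lemma reflection_reflection [simp]: "reflection a (reflection a x) = x"
  by (cases "a = 0") (simp_all add: reflection_def inner_diff_left algebra_simps)

lemma reflection_self: "reflection a a = - a"
  by (cases "a = 0") (simp_all add: reflection_def scaleR_2)

lemma reflection_comp_self [simp]: "reflection a \<circ> reflection a = id"
  by (simp add: fun_eq_iff)

lemma bij_reflection: "bij (reflection a)"
  by (rule o_bij[of "reflection a"]) auto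

text \<open>Allows the reflection in a root to be moved past simple reflections, as in
  \<open>exchange\<close> and \<open>positive_root_word\<close>.\<close>

lemma reflection_conjugate:
  "reflection (reflection a b) = reflection a \<circ> reflection b \<circ> reflection a"
proof
  fix x
  have "reflection (reflection a b) x = x - (reflection a x \<bullet> coroot b) *\<^sub>R reflection a b"
  proof -
    have "reflection a b \<bullet> reflection a b = b \<bullet> b" by (simp add: inner_reflection)
    then show ?thesis
      by (simp add: reflection_coroot[of "reflection a b"] coroot_def inner_reflection)
  qed
  also have "\<dots> = reflection a (reflection a x - (reflection a x \<bullet> coroot b) *\<^sub>R b)"
    by (simp add: linear_diff[OF linear_reflection] linear_scale[OF linear_reflection])
  also have "\<dots> = (reflection a \<circ> reflection b \<circ> reflection a) x"
    by (simp add: reflection_coroot[of b])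
  finally show "reflection (reflection a b) x = (reflection a \<circ> reflection b \<circ> reflection a) x" .
qed

section \<open>Groups of bijections under composition\<close>

lemma BijGroup_UNIV_carrier: "f \<in> carrier (BijGroup UNIV) \<longleftrightarrow> bij f"
  by (simp add: BijGroup_def Bij_def)

lemma BijGroup_UNIV_mult: "bij f \<Longrightarrow> bij g \<Longrightarrow> f \<otimes>\<^bsub>BijGroup UNIV\<^esub> g = f \<circ> g"
  by (simp add: BijGroup_def Bij_def compose_def fun_eq_iff)

lemma BijGroup_UNIV_one: "\<one>\<^bsub>BijGroup UNIV\<^esub> = id"
  by (simp add: BijGroup_def fun_eq_iff)

lemma BijGroup_UNIV_inv: "bij f \<Longrightarrow> inv\<^bsub>BijGroup UNIV\<^esub> f = fun_inv f"
  using inv_BijGroup[of f UNIV] by (simp add: Bij_def fun_eq_iff)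

lemma subgroup_BijGroup_UNIV_D:
  assumes "subgroup H (BijGroup UNIV)"
  shows "id \<in> H" "f \<in> H \<Longrightarrow> bij f" "f \<in> H \<Longrightarrow> g \<in> H \<Longrightarrow> f \<circ> g \<in> H" "f \<in> H \<Longrightarrow> fun_inv f \<in> H"
proof -
  interpret subgroup H "BijGroup UNIV" by fact
  show b: "f \<in> H \<Longrightarrow> bij f" for f
    using mem_carrier BijGroup_UNIV_carrier by blast
  show "id \<in> H" using one_closed by (simp add: BijGroup_UNIV_one)
  show "f \<in> H \<Longrightarrow> g \<in> H \<Longrightarrow> f \<circ> g \<in> H" using m_closed[of f g] BijGroup_UNIV_mult[OF b b, of f g] by simp
  show "f \<in> H \<Longrightarrow> fun_inv f \<in> H" using m_inv_closed[of f] BijGroup_UNIV_inv[OF b, of f] by simp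
qed

lemma subgroup_BijGroup_UNIV_I:
  assumes "id \<in> H" "\<And>f. f \<in> H \<Longrightarrow> bij f" "\<And>f g. f \<in> H \<Longrightarrow> g \<in> H \<Longrightarrow> f \<circ> g \<in> H" "\<And>f. f \<in> H \<Longrightarrow> fun_inv f \<in> H"
  shows "subgroup H (BijGroup UNIV)"
proof (unfold_locales)
  show "H \<subseteq> carrier (BijGroup UNIV)" using assms(2) BijGroup_UNIV_carrier by blast
  show "\<one>\<^bsub>BijGroup UNIV\<^esub> \<in> H" unfolding BijGroup_UNIV_one by fact
  show "f \<otimes>\<^bsub>BijGroup UNIV\<^esub> g \<in> H" if "f \<in> H" "g \<in> H" for f g
    unfolding BijGroup_UNIV_mult[OF assms(2)[OF that(1)] assms(2)[OF that(2)]] using assms(3) that .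
  show "inv\<^bsub>BijGroup UNIV\<^esub> f \<in> H" if "f \<in> H" for f
    unfolding BijGroup_UNIV_inv[OF assms(2)[OF that]] using assms(4) that .
qed

lemma mult_transformation_group: "x \<otimes>\<^bsub>transformation_group H\<^esub> y = x \<otimes>\<^bsub>BijGroup UNIV\<^esub> y"
  by simp

lemma group_transformation_group: "subgroup H (BijGroup UNIV) \<Longrightarrow> group (transformation_group H)"
  by (simp add: group.subgroup_imp_group group_BijGroup)

lemma weyl_subgroup: "subgroup (weyl R) (BijGroup UNIV)"
  unfolding weyl_def
  by (rule group.generate_is_subgroup[OF group_BijGroup])
    (auto simp: BijGroup_UNIV_carrier bij_reflection)

lemmas weyl_group_facts = subgroup_BijGroup_UNIV_D[OF weyl_subgroup]

lemma reflection_in_weyl: "a \<in> R \<Longrightarrow> reflection a \<in> weyl R"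
  unfolding weyl_def by (rule generate.incl) blast

text \<open>Reflections are involutions, so the inverses of generators fall under the reflection
  case.\<close>

lemma weyl_induct [consumes 1, case_names id reflection comp]:
  assumes "\<sigma> \<in> weyl R" and "P id" and "\<And>a. a \<in> R \<Longrightarrow> P (reflection a)"
    and "\<And>\<sigma> \<tau>. \<sigma> \<in> weyl R \<Longrightarrow> \<tau> \<in> weyl R \<Longrightarrow> P \<sigma> \<Longrightarrow> P \<tau> \<Longrightarrow> P (\<sigma> \<circ> \<tau>)"
  shows "P \<sigma>"
  using assms(1) unfolding weyl_def
proof (induction rule: generate.induct)
  case one
  then show ?case using assms(2) by (metis BijGroup_UNIV_one)
next
  case (incl h)
  then show ?case using assms(3) by auto
next
  case (inv h)
  then obtain a where a: "a \<in> R" "h = reflection a" by auto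
  have "fun_inv h = h"
    unfolding a(2) by (rule inv_unique_comp) auto
  then show ?case using assms(3) a by (simp add: BijGroup_UNIV_inv bij_reflection)
next
  case (eng \<sigma> \<tau>)
  then have w: "\<sigma> \<in> weyl R" "\<tau> \<in> weyl R" by (simp_all add: weyl_def)
  show ?case
    unfolding BijGroup_UNIV_mult[OF weyl_group_facts(2)[OF w(1)] weyl_group_facts(2)[OF w(2)]]
    by (rule assms(4)[OF w eng.IH])
qed

lemma linear_weyl: "\<sigma> \<in> weyl R \<Longrightarrow> linear \<sigma>"
  by (induction rule: weyl_induct) (rule linear_id linear_reflection linear_compose; assumption)+

lemma inner_weyl_weyl: "\<sigma> \<in> weyl R \<Longrightarrow> \<sigma> x \<bullet> \<sigma> y = x \<bullet> y"
  by (induction arbitrary: x y rule: weyl_induct) (auto simp: inner_reflection)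

lemma inv_weyl: "\<sigma> \<in> weyl R \<Longrightarrow> fun_inv \<sigma> (\<sigma> x) = x" "\<sigma> \<in> weyl R \<Longrightarrow> \<sigma> (fun_inv \<sigma> x) = x"
  using weyl_group_facts(2) by (metis bij_inv_eq_iff)+

lemma inner_weyl: "\<sigma> \<in> weyl R \<Longrightarrow> x \<bullet> \<sigma> y = fun_inv \<sigma> x \<bullet> y"
  by (metis inner_weyl_weyl inv_weyl(2))

lemma subgroup_stab_weyl: "subgroup (stab_weyl R w) (BijGroup UNIV)"
proof (rule subgroup_BijGroup_UNIV_I)
  show "fun_inv f \<in> stab_weyl R w" if "f \<in> stab_weyl R w" for f
    using that inv_weyl(1)[of f R w] by (auto simp: stab_weyl_def weyl_group_facts)
qed (auto simp: stab_weyl_def weyl_group_facts)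

lemma stab_weyl_subset: "stab_weyl R w \<subseteq> weyl R"
  by (auto simp: stab_weyl_def)

section \<open>Simple roots, dominance and the exchange condition\<close>

locale based_root_system =
  fixes R :: "'v::euclidean_space set" and \<alpha> :: "'n::finite \<Rightarrow> 'v"
  assumes reduced: "reduced_root_system R" and simple: "simple_roots R \<alpha>"
begin

lemma root_system: "root_system R"
  using reduced by (simp add: reduced_root_system_def)

lemma simple_root: "\<alpha> i \<in> R" and inj_simple: "inj \<alpha>" and independent_simple: "independent (range \<alpha>)"
  using simple by (auto simp: simple_roots_def)

lemma zero_not_root: "0 \<notin> R" and finite_roots: "finite R" and span_roots: "span R = UNIV"
  using root_system by (auto simp: root_system_def)

lemma simple_nonzero [simp]: "\<alpha> i \<noteq> 0"
  using simple_root zero_not_root by metis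

lemma coroot_simple_integer: "b \<in> R \<Longrightarrow> b \<bullet> coroot (\<alpha> i) \<in> \<int>"
  using root_system simple_root by (auto simp: root_system_def)

lemma reflection_root: "a \<in> R \<Longrightarrow> b \<in> R \<Longrightarrow> reflection a b \<in> R"
  using root_system by (auto simp: root_system_def)

lemma neg_root: "a \<in> R \<Longrightarrow> - a \<in> R"
  using reflection_root[of a a] by (simp add: reflection_self)

lemma weyl_root: "\<sigma> \<in> weyl R \<Longrightarrow> b \<in> R \<Longrightarrow> \<sigma> b \<in> R"
  by (induction arbitrary: b rule: weyl_induct) (auto simp: reflection_root)

text \<open>Membership of \<open>p - q\<close> is the dominance order. The coefficients are integral
  because they later produce the exponents of \<lambda>.\<close>

definition root_cone :: "'v set" where
  "root_cone = {\<Sum>i\<in>UNIV. of_nat (k i) *\<^sub>R \<alpha> i | k :: 'n \<Rightarrow> nat. True}"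

lemma root_cone_sum: "(\<Sum>i\<in>UNIV. of_nat (k i) *\<^sub>R \<alpha> i) \<in> root_cone"
  unfolding root_cone_def by blast

lemma root_cone_zero [simp]: "0 \<in> root_cone"
  using root_cone_sum[of "\<lambda>_. 0"] by simp

lemma root_cone_add: assumes "x \<in> root_cone" "y \<in> root_cone" shows "x + y \<in> root_cone"
proof -
  from assms obtain k l where "x = (\<Sum>i\<in>UNIV. of_nat (k i) *\<^sub>R \<alpha> i)" "y = (\<Sum>i\<in>UNIV. of_nat (l i) *\<^sub>R \<alpha> i)"
    unfolding root_cone_def by blast
  then have "x + y = (\<Sum>i\<in>UNIV. of_nat (k i + l i) *\<^sub>R \<alpha> i)"
    by (simp add: sum.distrib scaleR_left_distrib)
  then show ?thesis using root_cone_sum by metis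
qed

lemma root_cone_scale: "x \<in> root_cone \<Longrightarrow> of_nat n *\<^sub>R x \<in> root_cone"
  by (induction n) (auto simp: scaleR_left_distrib root_cone_add)

lemma simple_in_root_cone: "\<alpha> i \<in> root_cone"
proof -
  have "\<alpha> i = (\<Sum>j\<in>UNIV. of_nat (if j = i then 1 else 0) *\<^sub>R \<alpha> j)"
    by (simp add: if_distrib if_distribR cong: if_cong)
  then show ?thesis using root_cone_sum by metis
qed

lemma root_cases: "b \<in> R \<Longrightarrow> b \<in> root_cone \<or> - b \<in> root_cone"
proof -
  assume "b \<in> R"
  then obtain k :: "'n \<Rightarrow> nat"
    where "b = (\<Sum>i\<in>UNIV. of_nat (k i) *\<^sub>R \<alpha> i) \<or> b = - (\<Sum>i\<in>UNIV. of_nat (k i) *\<^sub>R \<alpha> i)"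
    using simple unfolding simple_roots_def by blast
  then show ?thesis using root_cone_sum[of k] by auto
qed

lemma span_simple: "span (range \<alpha>) = UNIV"
proof -
  have "R \<subseteq> span (range \<alpha>)"
  proof
    fix b assume "b \<in> R"
    have "root_cone \<subseteq> span (range \<alpha>)"
      unfolding root_cone_def by (auto intro!: span_sum span_scale intro: span_base)
    then show "b \<in> span (range \<alpha>)"
      using root_cases[OF \<open>b \<in> R\<close>] span_neg[of "-b" "range \<alpha>"] by auto
  qed
  then show ?thesis using span_roots span_mono[of R "span (range \<alpha>)"] by (auto simp: span_span)
qed

lemma vector_eqI:
  assumes "\<And>i. x \<bullet> \<alpha> i = y \<bullet> \<alpha> i" shows "x = y"
proof -
  have "orthogonal (x - y) u" if "u \<in> span (range \<alpha>)" for u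
    by (rule orthogonal_to_span[OF that]) (use assms in \<open>auto simp: orthogonal_def inner_diff_left\<close>)
  then have "orthogonal (x - y) (x - y)" by (simp add: span_simple)
  then show ?thesis by (simp add: orthogonal_def)
qed

lemma vector_eqI_coroot:
  assumes "\<And>i. x \<bullet> coroot (\<alpha> i) = y \<bullet> coroot (\<alpha> i)" shows "x = y"
  using assms by (intro vector_eqI) (auto simp: coroot_def)

lemma fund_weight_coroot: "fund_weight \<alpha> j \<bullet> coroot (\<alpha> i) = (if i = j then 1 else 0)"
proof -
  have "\<exists>w. \<forall>i. w \<bullet> coroot (\<alpha> i) = (if i = j then 1 else 0)"
  proof -
    obtain f :: "'v \<Rightarrow> real" where f: "linear f"
        "\<forall>x\<in>range \<alpha>. f x = (if x = \<alpha> j then (\<alpha> j \<bullet> \<alpha> j) / 2 else 0)"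
      using linear_independent_extend[OF independent_simple, of "\<lambda>x. if x = \<alpha> j then (\<alpha> j \<bullet> \<alpha> j) / 2 else 0"]
      by auto
    \<comment> \<open>The adjoint at 1 is the Riesz vector of the functional that is prescribed on
      the basis of simple roots.\<close>
    have "x \<bullet> adjoint f 1 = f x" for x
      using adjoint_works[OF f(1), of x 1] by simp
    then have "adjoint f 1 \<bullet> coroot (\<alpha> i) = f (\<alpha> i) * (2 / (\<alpha> i \<bullet> \<alpha> i))" for i
      by (simp add: coroot_def inner_commute)
    moreover have "f (\<alpha> i) * (2 / (\<alpha> i \<bullet> \<alpha> i)) = (if i = j then 1 else 0)" for i
      using f(2) injD[OF inj_simple, of i j] by (auto simp: divide_simps)
    ultimately show ?thesis by metis
  qed
  then have "\<exists>!w. \<forall>i. w \<bullet> coroot (\<alpha> i) = (if i = j then 1 else 0)"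
    using vector_eqI_coroot by (metis (no_types, lifting))
  from theI'[OF this] show ?thesis by (simp add: fund_weight_def)
qed

lemma fund_weight_simple: "fund_weight \<alpha> j \<bullet> \<alpha> i = (if i = j then (\<alpha> j \<bullet> \<alpha> j) / 2 else 0)"
  using fund_weight_coroot[of j i] by (auto simp: coroot_def divide_simps split: if_splits)

lemma weight_expansion: "p = (\<Sum>j\<in>UNIV. (p \<bullet> coroot (\<alpha> j)) *\<^sub>R fund_weight \<alpha> j)"
  by (rule vector_eqI_coroot) (simp add: inner_sum_left fund_weight_coroot if_distrib cong: if_cong)

lemma coroot_expansion: "x = (\<Sum>j\<in>UNIV. (fund_weight \<alpha> j \<bullet> x) *\<^sub>R coroot (\<alpha> j))"
proof -
  have "x \<bullet> p = (\<Sum>j\<in>UNIV. (fund_weight \<alpha> j \<bullet> x) *\<^sub>R coroot (\<alpha> j)) \<bullet> p" for p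
  proof -
    have "x \<bullet> p = x \<bullet> (\<Sum>j\<in>UNIV. (p \<bullet> coroot (\<alpha> j)) *\<^sub>R fund_weight \<alpha> j)"
      using weight_expansion[of p] by simp
    then show ?thesis by (simp add: inner_sum_left inner_sum_right inner_commute mult.commute)
  qed
  then show ?thesis by (metis vector_eqI)
qed

text \<open>The sum of the fundamental coweights. Pairing with it gives the height of an element of
  the root cone.\<close>

definition rho_check :: 'v where
  "rho_check = (\<Sum>j\<in>UNIV. (2 / (\<alpha> j \<bullet> \<alpha> j)) *\<^sub>R fund_weight \<alpha> j)"

lemma simple_rho_check [simp]: "\<alpha> i \<bullet> rho_check = 1"
  by (simp add: rho_check_def inner_sum_right inner_commute[of "\<alpha> i"] fund_weight_simple if_distrib cong: if_cong)

lemma root_cone_rho_check: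
  assumes "x \<in> root_cone" "x \<noteq> 0" shows "x \<bullet> rho_check > 0"
proof -
  from assms obtain k where k: "x = (\<Sum>i\<in>UNIV. of_nat (k i) *\<^sub>R \<alpha> i)" unfolding root_cone_def by blast
  then have "x \<bullet> rho_check = real (\<Sum>i\<in>UNIV. k i)" by (simp add: inner_sum_left)
  moreover have "(\<Sum>i\<in>UNIV. k i) \<noteq> 0"
  proof
    assume "(\<Sum>i\<in>UNIV. k i) = 0"
    then have "k i = 0" for i by (simp add: sum_eq_0_iff)
    then show False using k \<open>x \<noteq> 0\<close> by simp
  qed
  ultimately show ?thesis by (metis of_nat_0_less_iff bot_nat_0.not_eq_extremum)
qed

lemma root_cone_antisym: "x \<in> root_cone \<Longrightarrow> - x \<in> root_cone \<Longrightarrow> x = 0"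
  using root_cone_rho_check[of x] root_cone_rho_check[of "-x"] by fastforce

definition dominant_integral :: "'v \<Rightarrow> bool" where
  "dominant_integral \<mu> \<longleftrightarrow> (\<forall>i. \<mu> \<bullet> coroot (\<alpha> i) \<in> \<nat>)"

lemma fund_weight_dominant: "dominant_integral (fund_weight \<alpha> j)"
  by (simp add: dominant_integral_def fund_weight_coroot)

lemma root_cone_inner_fund_weight: "x \<in> root_cone \<Longrightarrow> fund_weight \<alpha> j \<bullet> x \<ge> 0"
  unfolding root_cone_def
  by (auto simp: inner_sum_right fund_weight_simple if_distrib cong: if_cong)

text \<open>Since the root system is reduced, \<open>b\<close> contains another simple root with
  positive coefficient. The reflection leaves that coefficient alone, and the coefficients of a root
  all have one sign.\<close>

lemma simple_reflection_positive:
  assumes "b \<in> R" "b \<in> root_cone" "b \<noteq> \<alpha> i" shows "reflection (\<alpha> i) b \<in> root_cone"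
proof -
  from assms obtain k where k: "b = (\<Sum>i\<in>UNIV. of_nat (k i) *\<^sub>R \<alpha> i)" unfolding root_cone_def by blast
  have "\<exists>j. j \<noteq> i \<and> k j \<noteq> 0"
  proof (rule ccontr)
    assume "\<not> ?thesis"
    then have "(\<Sum>j\<in>UNIV. of_nat (k j) *\<^sub>R \<alpha> j) = (\<Sum>j\<in>UNIV. if j = i then of_nat (k i) *\<^sub>R \<alpha> i else 0)"
      by (intro sum.cong) auto
    then have "b = real (k i) *\<^sub>R \<alpha> i" using k by simp
    moreover then have "real (k i) = 1 \<or> real (k i) = -1"
      using reduced simple_root[of i] \<open>b \<in> R\<close> unfolding reduced_root_system_def by metis
    ultimately show False using \<open>b \<noteq> \<alpha> i\<close> by auto
  qed
  then obtain j where j: "j \<noteq> i" "k j \<noteq> 0" by blast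
  have "fund_weight \<alpha> j \<bullet> reflection (\<alpha> i) b = fund_weight \<alpha> j \<bullet> b"
    using j by (simp add: reflection_coroot inner_diff_right fund_weight_simple)
  also have "\<dots> = real (k j) * ((\<alpha> j \<bullet> \<alpha> j) / 2)"
    by (simp add: k inner_sum_right fund_weight_simple if_distrib cong: if_cong)
  also have "\<dots> > 0" using j by simp
  finally have "\<not> - reflection (\<alpha> i) b \<in> root_cone"
    using root_cone_inner_fund_weight[of "- reflection (\<alpha> i) b" j] by auto
  then show ?thesis using root_cases reflection_root[OF simple_root \<open>b \<in> R\<close>] by blast
qed

text \<open>The head of the list acts first. Peeling it off replaces a root \<open>b\<close> by
  \<open>reflection (\<alpha> i) b\<close>, which is the recursion that \<open>exchange\<close>
  follows.\<close>

fun simple_word :: "'n list \<Rightarrow> 'v \<Rightarrow> 'v" where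
  "simple_word [] = id"
| "simple_word (i # is) = simple_word is \<circ> reflection (\<alpha> i)"

lemma simple_word_append: "simple_word (is @ js) = simple_word js \<circ> simple_word is"
  by (induction "is") (auto simp: comp_assoc)

lemma simple_word_in_weyl: "simple_word is \<in> weyl R"
proof (induction "is")
  case (Cons i "is")
  then show ?case using weyl_group_facts(3) reflection_in_weyl simple_root by (metis simple_word.simps(2))
qed (metis weyl_group_facts(1) simple_word.simps(1))

text \<open>The exchange condition. A simple reflection makes no positive root negative except its
  own, so a word that turns \<open>b\<close> negative must reach a letter whose simple root is the
  current image of \<open>b\<close>. The reflection in \<open>b\<close>, conjugated past the earlier
  letters, cancels that letter.\<close>

lemma exchange:
  assumes "b \<in> R" "b \<in> root_cone" "- simple_word is b \<in> root_cone"
  shows "\<exists>js. length js < length is \<and> simple_word is \<circ> reflection b = simple_word js"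
  using assms
proof (induction "is" arbitrary: b)
  case Nil
  then show ?case using root_cone_antisym zero_not_root by fastforce
next
  case (Cons i "is")
  show ?case
  proof (cases "b = \<alpha> i")
    case True
    then show ?thesis by (intro exI[of _ "is"]) (simp add: comp_assoc)
  next
    case False
    let ?b = "reflection (\<alpha> i) b"
    have "?b \<in> R" "?b \<in> root_cone"
      using Cons.prems False simple_reflection_positive reflection_root simple_root by auto
    then obtain js where js: "length js < length is" "simple_word is \<circ> reflection ?b = simple_word js"
      using Cons.IH[of ?b] Cons.prems by fastforce
    have "simple_word (i # is) \<circ> reflection b = (simple_word is \<circ> reflection ?b) \<circ> reflection (\<alpha> i)"
      unfolding reflection_conjugate by (simp add: comp_assoc)
    then have "simple_word (i # is) \<circ> reflection b = simple_word (i # js)" using js by simp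
    moreover have "length (i # js) < length (i # is)" using js by simp
    ultimately show ?thesis by blast
  qed
qed

text \<open>Induction on the height. Some simple root has positive inner product with
  \<open>b\<close>, as otherwise \<open>b \<bullet> b \<le> 0\<close>; integrality makes the pairing
  with its coroot at least 1, so reflecting lowers the height by at least 1.\<close>

lemma positive_root_word:
  assumes "b \<in> R" "b \<in> root_cone"
  shows "\<exists>is. reflection b = simple_word is"
proof -
  obtain n where "n = nat \<lfloor>b \<bullet> rho_check\<rfloor>" by blast
  then show ?thesis using assms
  proof (induction n arbitrary: b rule: less_induct)
    case (less n)
    from less.prems obtain k where k: "b = (\<Sum>i\<in>UNIV. of_nat (k i) *\<^sub>R \<alpha> i)" unfolding root_cone_def by blast
    have "\<exists>i. b \<bullet> \<alpha> i > 0"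
    proof (rule ccontr)
      assume "\<not> ?thesis"
      then have "(\<Sum>i\<in>UNIV. real (k i) * (b \<bullet> \<alpha> i)) \<le> 0"
        by (intro sum_nonpos) (auto intro: mult_nonneg_nonpos simp: not_less)
      then have "b \<bullet> b \<le> 0" using arg_cong[OF k, of "\<lambda>x. b \<bullet> x"] by (simp add: inner_sum_right)
      then show False using less.prems zero_not_root by (metis inner_gt_zero_iff not_le)
    qed
    then obtain i where i: "b \<bullet> \<alpha> i > 0" by blast
    show ?case
    proof (cases "b = \<alpha> i")
      case True
      then show ?thesis by (intro exI[of _ "[i]"]) simp
    next
      case False
      let ?b = "reflection (\<alpha> i) b"
      have b: "?b \<in> R" "?b \<in> root_cone"
        using less.prems False simple_reflection_positive reflection_root simple_root by auto
      have c: "b \<bullet> coroot (\<alpha> i) > 0" using i by (simp add: coroot_def)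
      then have "b \<bullet> coroot (\<alpha> i) \<ge> 1" using coroot_simple_integer[OF less.prems(2), of i]
        by (auto elim!: Ints_cases)
      then have "?b \<bullet> rho_check \<le> b \<bullet> rho_check - 1"
        by (simp add: reflection_coroot inner_diff_left)
      moreover have "?b \<bullet> rho_check > 0" using b zero_not_root root_cone_rho_check by metis
      ultimately have "nat \<lfloor>?b \<bullet> rho_check\<rfloor> < n" unfolding less.prems(1) by linarith
      then obtain "is" where "reflection ?b = simple_word is" using less.IH b by blast
      moreover have "reflection b = reflection (\<alpha> i) \<circ> reflection ?b \<circ> reflection (\<alpha> i)"
        using reflection_conjugate[of "\<alpha> i" ?b] by simp
      ultimately have "reflection b = simple_word (i # is @ [i])"
        by (simp add: simple_word_append comp_assoc)
      then show ?thesis by blast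
    qed
  qed
qed

lemma reflection_neg: "reflection (- b) = reflection b"
  by (simp add: fun_eq_iff reflection_def)

lemma weyl_word: assumes "\<sigma> \<in> weyl R" shows "\<exists>is. \<sigma> = simple_word is"
  using assms
proof (induction rule: weyl_induct)
  case id
  then show ?case by (metis simple_word.simps(1))
next
  case (reflection b)
  then show ?case using positive_root_word[of b] positive_root_word[of "-b"] neg_root root_cases
    by (auto simp: reflection_neg)
next
  case (comp \<sigma> \<tau>)
  then show ?case using simple_word_append by metis
qed

text \<open>The letter acting first subtracts a nonnegative multiple of its simple root. If the
  remaining letters keep that root positive, the difference grows by an element of the cone; if not,
  \<open>exchange\<close> supplies a shorter word for the same element.\<close>

theorem dominant_minus_weyl:
  assumes "dominant_integral \<mu>" "\<sigma> \<in> weyl R" shows "\<mu> - \<sigma> \<mu> \<in> root_cone"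
proof -
  have "\<mu> - simple_word is \<mu> \<in> root_cone" for "is"
  proof (induction "length is" arbitrary: "is" rule: less_induct)
    case less
    show ?case
    proof (cases "is")
      case (Cons i js)
      have r: "simple_word js (\<alpha> i) \<in> R" using simple_word_in_weyl simple_root weyl_root by blast
      show ?thesis
      proof (cases "simple_word js (\<alpha> i) \<in> root_cone")
        case True
        obtain n where n: "\<mu> \<bullet> coroot (\<alpha> i) = of_nat n"
          using assms by (auto simp: dominant_integral_def elim: Nats_cases)
        have lin: "linear (simple_word js)" using simple_word_in_weyl linear_weyl by blast
        have "\<mu> - simple_word is \<mu> = (\<mu> - simple_word js \<mu>) + of_nat n *\<^sub>R simple_word js (\<alpha> i)"
          by (simp add: Cons reflection_coroot n linear_diff[OF lin] linear_scale[OF lin])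
        moreover have "(\<mu> - simple_word js \<mu>) + of_nat n *\<^sub>R simple_word js (\<alpha> i) \<in> root_cone"
          using True less[of js] root_cone_add root_cone_scale Cons by simp
        ultimately show ?thesis by metis
      next
        case False
        then have "- simple_word js (\<alpha> i) \<in> root_cone" using r root_cases by blast
        then obtain ks where "length ks < length js" "simple_word js \<circ> reflection (\<alpha> i) = simple_word ks"
          using exchange simple_root simple_in_root_cone by blast
        then show ?thesis using less[of ks] Cons by simp
      qed
    qed simp
  qed
  then show ?thesis using weyl_word[OF assms(2)] by blast
qed

text \<open>The group acts faithfully on the finite spanning set of roots.\<close>

lemma finite_weyl: "finite (weyl R)"
proof -
  have "inj_on (\<lambda>\<sigma>. restrict \<sigma> R) (weyl R)"
  proof (rule inj_onI)
    fix \<sigma> \<tau> assume st: "\<sigma> \<in> weyl R" "\<tau> \<in> weyl R" and eq: "restrict \<sigma> R = restrict \<tau> R"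
    have "\<sigma> x = \<tau> x" for x
      by (rule linear_eq_on_span[OF linear_weyl[OF st(1)] linear_weyl[OF st(2)], of R])
        (use eq span_roots in \<open>auto simp: restrict_def fun_eq_iff split: if_splits\<close>)
    then show "\<sigma> = \<tau>" by auto
  qed
  moreover have "(\<lambda>\<sigma>. restrict \<sigma> R) ` weyl R \<subseteq> R \<rightarrow>\<^sub>E R"
    using weyl_root by auto
  ultimately show ?thesis
    by (meson finite_PiE finite_imageD finite_roots finite_subset)
qed

section \<open>Weight lattice and coroot lattice\<close>

definition weight_lattice :: "'v set" where
  "weight_lattice = {p. \<forall>i. p \<bullet> coroot (\<alpha> i) \<in> \<int>}"

lemma weight_lattice_add: "p \<in> weight_lattice \<Longrightarrow> q \<in> weight_lattice \<Longrightarrow> p + q \<in> weight_lattice"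
  by (auto simp: weight_lattice_def inner_add_left)

text \<open>Decomposing into simple reflections keeps to pairings with simple coroots, the ones that
  membership controls.\<close>

lemma weight_lattice_weyl: "\<sigma> \<in> weyl R \<Longrightarrow> p \<in> weight_lattice \<Longrightarrow> \<sigma> p \<in> weight_lattice"
proof -
  have "simple_word is p \<in> weight_lattice" if "p \<in> weight_lattice" for "is"
    using that
  proof (induction "is" arbitrary: p)
    case (Cons i "is")
    have "reflection (\<alpha> i) p \<in> weight_lattice"
      using Cons.prems coroot_simple_integer[OF simple_root]
      by (auto simp: weight_lattice_def reflection_coroot inner_diff_left)
    then show ?case using Cons.IH by simp
  qed simp
  then show "\<sigma> \<in> weyl R \<Longrightarrow> p \<in> weight_lattice \<Longrightarrow> \<sigma> p \<in> weight_lattice"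
    using weyl_word by blast
qed

lemma fund_weight_in_lattice: "fund_weight \<alpha> j \<in> weight_lattice"
  by (simp add: weight_lattice_def fund_weight_coroot)

lemma coroot_lattice_iff: "x \<in> coroot_lattice \<alpha> \<longleftrightarrow> (\<forall>j. fund_weight \<alpha> j \<bullet> x \<in> \<int>)"
proof
  assume "x \<in> coroot_lattice \<alpha>"
  then show "\<forall>j. fund_weight \<alpha> j \<bullet> x \<in> \<int>"
    unfolding coroot_lattice_def
    by (auto simp: inner_sum_right fund_weight_coroot if_distrib cong: if_cong)
next
  assume "\<forall>j. fund_weight \<alpha> j \<bullet> x \<in> \<int>"
  then have "fund_weight \<alpha> j \<bullet> x = of_int \<lfloor>fund_weight \<alpha> j \<bullet> x\<rfloor>" for j
    by (metis Ints_cases of_int_floor_cancel)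
  then have "x = (\<Sum>j\<in>UNIV. of_int \<lfloor>fund_weight \<alpha> j \<bullet> x\<rfloor> *\<^sub>R coroot (\<alpha> j))"
    using coroot_expansion[of x] by simp
  then show "x \<in> coroot_lattice \<alpha>" unfolding coroot_lattice_def by (intro CollectI exI conjI TrueI)
qed

lemma lattice_pairing: "p \<in> weight_lattice \<Longrightarrow> x \<in> coroot_lattice \<alpha> \<Longrightarrow> p \<bullet> x \<in> \<int>"
  unfolding coroot_lattice_def weight_lattice_def
  by (auto simp: inner_sum_right intro!: Ints_sum Ints_mult)

text \<open>Dual to the invariance of the weight lattice, since \<sigma> is an isometry.\<close>

lemma coroot_lattice_weyl:
  assumes "\<sigma> \<in> weyl R" "x \<in> coroot_lattice \<alpha>" shows "\<sigma> x \<in> coroot_lattice \<alpha>"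
  unfolding coroot_lattice_iff[of "\<sigma> x"] inner_weyl[OF assms(1)]
proof
  fix j show "fun_inv \<sigma> (fund_weight \<alpha> j) \<bullet> x \<in> \<int>"
    using weight_lattice_weyl[OF weyl_group_facts(4)[OF assms(1)] fund_weight_in_lattice] assms(2)
    by (rule lattice_pairing)
qed

lemma coroot_lattice_closed:
  "0 \<in> coroot_lattice \<alpha>" "x \<in> coroot_lattice \<alpha> \<Longrightarrow> y \<in> coroot_lattice \<alpha> \<Longrightarrow> x + y \<in> coroot_lattice \<alpha>"
  "x \<in> coroot_lattice \<alpha> \<Longrightarrow> - x \<in> coroot_lattice \<alpha>"
  by (auto simp: coroot_lattice_iff inner_add_right)

subsection \<open>Affine groups\<close>

text \<open>The set of linear parts is a parameter: \<open>weyl R\<close> gives the affine Weyl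
  group, the stabilizer of \<omega> the group of the fibres of \<open>phi\<close>.\<close>

definition affine_maps :: "('v \<Rightarrow> 'v) set \<Rightarrow> ('v \<Rightarrow> 'v) set" where
  "affine_maps K = {\<lambda>x. \<sigma> x + t | \<sigma> t. \<sigma> \<in> K \<and> t \<in> coroot_lattice \<alpha>}"

lemma affine_mapsE:
  assumes "\<phi> \<in> affine_maps K" obtains \<sigma> t where "\<phi> = (\<lambda>x. \<sigma> x + t)" "\<sigma> \<in> K" "t \<in> coroot_lattice \<alpha>"
  using assms unfolding affine_maps_def by blast

lemma affine_mapsI: "\<sigma> \<in> K \<Longrightarrow> t \<in> coroot_lattice \<alpha> \<Longrightarrow> (\<lambda>x. \<sigma> x + t) \<in> affine_maps K"
  unfolding affine_maps_def by blast

context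
  fixes K assumes K: "subgroup K (BijGroup UNIV)" and K_weyl: "K \<subseteq> weyl R"
begin

private lemmas K_facts = subgroup_BijGroup_UNIV_D[OF K]

lemma subgroup_affine_maps: "subgroup (affine_maps K) (BijGroup UNIV)"
proof (rule subgroup_BijGroup_UNIV_I)
  have "(\<lambda>x. id x + 0) \<in> affine_maps K" by (intro affine_mapsI K_facts coroot_lattice_closed)
  then show "id \<in> affine_maps K" by (simp add: id_def)
next
  fix f assume "f \<in> affine_maps K"
  then obtain \<sigma> t where f: "f = (\<lambda>x. \<sigma> x + t)" "\<sigma> \<in> K" "t \<in> coroot_lattice \<alpha>" by (rule affine_mapsE)
  let ?g = "\<lambda>x. fun_inv \<sigma> x + (- fun_inv \<sigma> t)"
  have s: "\<sigma> \<in> weyl R" "fun_inv \<sigma> \<in> weyl R" using f K_weyl weyl_group_facts(4) by blast+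
  have lin: "linear (fun_inv \<sigma>)" "linear \<sigma>" using s linear_weyl by auto
  have "f \<circ> ?g = id" "?g \<circ> f = id"
    using lin s by (auto simp: f fun_eq_iff linear_add[of "fun_inv \<sigma>"] linear_diff[of \<sigma>] inv_weyl)
  then show "bij f" "fun_inv f \<in> affine_maps K"
    using o_bij inv_unique_comp[of f ?g] affine_mapsI[of "fun_inv \<sigma>" K "- fun_inv \<sigma> t"]
      K_facts(4)[OF f(2)] coroot_lattice_weyl[OF s(2) f(3)] coroot_lattice_closed(3) by auto
next
  fix f g assume "f \<in> affine_maps K" "g \<in> affine_maps K"
  then obtain \<sigma> t \<tau> u where f: "f = (\<lambda>x. \<sigma> x + t)" "\<sigma> \<in> K" "t \<in> coroot_lattice \<alpha>"
    and g: "g = (\<lambda>x. \<tau> x + u)" "\<tau> \<in> K" "u \<in> coroot_lattice \<alpha>" by (metis affine_mapsE)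
  have lin: "linear \<sigma>" using f K_weyl linear_weyl by auto
  have "f \<circ> g = (\<lambda>x. (\<sigma> \<circ> \<tau>) x + (\<sigma> u + t))" using lin by (auto simp: f g fun_eq_iff linear_add)
  moreover have "\<sigma> u + t \<in> coroot_lattice \<alpha>"
    using f g K_weyl coroot_lattice_weyl coroot_lattice_closed by blast
  ultimately show "f \<circ> g \<in> affine_maps K" using affine_mapsI K_facts(3)[OF f(2) g(2)] by metis
qed

lemma affine_maps_iso_semidirect: "transformation_group (affine_maps K) \<cong> semidirect K (coroot_lattice \<alpha>)"
proof -
  let ?h = "\<lambda>\<phi>. ((\<lambda>x. \<phi> x - \<phi> 0 :: 'v), \<phi> 0)"
  have h: "?h (\<lambda>x. \<sigma> x + t) = (\<sigma>, t)" if "\<sigma> \<in> K" for \<sigma> t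
    using that K_weyl linear_weyl linear_0 by (auto simp: fun_eq_iff)
  have "?h \<in> iso (transformation_group (affine_maps K)) (semidirect K (coroot_lattice \<alpha>))"
  proof (rule isoI)
    show hom: "?h \<in> hom (transformation_group (affine_maps K)) (semidirect K (coroot_lattice \<alpha>))"
    proof (rule homI)
      fix f assume "f \<in> carrier (transformation_group (affine_maps K))"
      then obtain \<sigma> t where f: "f = (\<lambda>x. \<sigma> x + t)" "\<sigma> \<in> K" "t \<in> coroot_lattice \<alpha>" by (auto elim: affine_mapsE)
      then have "?h f = (\<sigma>, t)" using h by metis
      then show "?h f \<in> carrier (semidirect K (coroot_lattice \<alpha>))"
        using f by (simp add: semidirect_def)
    next
      fix f g assume "f \<in> carrier (transformation_group (affine_maps K))"
        "g \<in> carrier (transformation_group (affine_maps K))"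
      then have fg: "f \<in> affine_maps K" "g \<in> affine_maps K" by auto
      then have m: "f \<otimes>\<^bsub>transformation_group (affine_maps K)\<^esub> g = f \<circ> g"
        using BijGroup_UNIV_mult[OF subgroup_BijGroup_UNIV_D(2)[OF subgroup_affine_maps fg(1)]
            subgroup_BijGroup_UNIV_D(2)[OF subgroup_affine_maps fg(2)]]
        by (metis mult_transformation_group)
      obtain \<sigma> t \<tau> u where f: "f = (\<lambda>x. \<sigma> x + t)" "\<sigma> \<in> K" "t \<in> coroot_lattice \<alpha>"
        and g: "g = (\<lambda>x. \<tau> x + u)" "\<tau> \<in> K" "u \<in> coroot_lattice \<alpha>" using fg by (metis affine_mapsE)
      have lin: "linear \<sigma>" using f K_weyl linear_weyl by auto
      have "f \<circ> g = (\<lambda>x. (\<sigma> \<circ> \<tau>) x + (t + \<sigma> u))" using lin by (auto simp: f g fun_eq_iff linear_add)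
      then have "?h (f \<circ> g) = (\<sigma> \<circ> \<tau>, t + \<sigma> u)" using h[OF K_facts(3)[OF f(2) g(2)]] by metis
      then show "?h (f \<otimes>\<^bsub>transformation_group (affine_maps K)\<^esub> g)
          = ?h f \<otimes>\<^bsub>semidirect K (coroot_lattice \<alpha>)\<^esub> ?h g"
        unfolding m using h[OF f(2), of t] h[OF g(2), of u] by (simp add: f(1) g(1) semidirect_def)
    qed
    show "bij_betw ?h (carrier (transformation_group (affine_maps K))) (carrier (semidirect K (coroot_lattice \<alpha>)))"
    proof (rule bij_betw_byWitness[where f' = "\<lambda>(\<sigma>, t) x. \<sigma> x + t"])
      show "\<forall>f\<in>carrier (transformation_group (affine_maps K)). (\<lambda>(\<sigma>, t) x. \<sigma> x + t) (?h f) = f" by auto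
      show "\<forall>a'\<in>carrier (semidirect K (coroot_lattice \<alpha>)). ?h ((\<lambda>(\<sigma>, t) x. \<sigma> x + t) a') = a'"
        using h by (auto simp: semidirect_def)
      show "?h ` carrier (transformation_group (affine_maps K)) \<subseteq> carrier (semidirect K (coroot_lattice \<alpha>))"
        by (rule image_subsetI) (rule hom_in_carrier[OF hom])
      show "(\<lambda>(\<sigma>, t) x. \<sigma> x + t) ` carrier (semidirect K (coroot_lattice \<alpha>)) \<subseteq> carrier (transformation_group (affine_maps K))"
        using affine_mapsI by (auto simp: semidirect_def)
    qed
  qed
  then show ?thesis by (auto simp: is_iso_def)
qed

end

lemma affine_weyl_eq: "affine_weyl R \<alpha> = affine_maps (weyl R)"
proof
  let ?S = "weyl R \<union> {\<lambda>x. x + t | t. t \<in> coroot_lattice \<alpha>}"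
  have "subgroup (affine_maps (weyl R)) (BijGroup UNIV)"
    by (rule subgroup_affine_maps[OF weyl_subgroup]) simp
  moreover have "?S \<subseteq> affine_maps (weyl R)"
  proof -
    have "(\<lambda>x. \<sigma> x + 0) \<in> affine_maps (weyl R)" if "\<sigma> \<in> weyl R" for \<sigma>
      using that by (intro affine_mapsI coroot_lattice_closed)
    moreover have "(\<lambda>x. id x + t) \<in> affine_maps (weyl R)" if "t \<in> coroot_lattice \<alpha>" for t
      using that by (intro affine_mapsI weyl_group_facts)
    ultimately show ?thesis by auto
  qed
  ultimately show "affine_weyl R \<alpha> \<subseteq> affine_maps (weyl R)"
    unfolding affine_weyl_def by (simp add: group.generate_subgroup_incl group_BijGroup)
  have "?S \<subseteq> carrier (BijGroup UNIV)"
    using \<open>?S \<subseteq> _\<close> \<open>subgroup _ _\<close> subgroup.subset by blast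
  then have sub: "subgroup (affine_weyl R \<alpha>) (BijGroup UNIV)"
    unfolding affine_weyl_def by (rule group.generate_is_subgroup[OF group_BijGroup])
  show "affine_maps (weyl R) \<subseteq> affine_weyl R \<alpha>"
  proof
    fix f assume "f \<in> affine_maps (weyl R)"
    then obtain \<sigma> t where f: "f = (\<lambda>x. \<sigma> x + t)" "\<sigma> \<in> weyl R" "t \<in> coroot_lattice \<alpha>" by (rule affine_mapsE)
    have "\<sigma> \<in> affine_weyl R \<alpha>" "(\<lambda>x. x + t) \<in> affine_weyl R \<alpha>"
      unfolding affine_weyl_def using f by (auto intro!: generate.incl)
    then have "(\<lambda>x. x + t) \<circ> \<sigma> \<in> affine_weyl R \<alpha>" using subgroup_BijGroup_UNIV_D(3)[OF sub] by blast
    then show "f \<in> affine_weyl R \<alpha>" by (simp add: f comp_def)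
  qed
qed

lemma affine_weyl_group_iso: "affine_weyl_group R \<alpha> \<cong> semidirect (weyl R) (coroot_lattice \<alpha>)"
  unfolding affine_weyl_group_def affine_weyl_eq
  by (rule affine_maps_iso_semidirect[OF weyl_subgroup]) simp

lemma subgroup_affine_weyl_group:
  assumes "subgroup K (BijGroup UNIV)" "K \<subseteq> weyl R"
  shows "subgroup (affine_maps K) (affine_weyl_group R \<alpha>)"
proof -
  have "affine_maps K \<subseteq> affine_weyl R \<alpha>"
    using assms(2) unfolding affine_weyl_eq affine_maps_def by blast
  then show ?thesis
    unfolding affine_weyl_group_def
    using subgroup_affine_maps[OF assms] subgroup_affine_maps[OF weyl_subgroup]
    by (simp add: affine_weyl_eq group.subgroup_incl group_BijGroup)
qed

subsection \<open>The complexification\<close>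

lemma cpairing_coords: "cpairing \<alpha> p (coords \<alpha> x) = of_real (p \<bullet> x)"
proof -
  have "p \<bullet> x = (\<Sum>r\<in>UNIV. (fund_weight \<alpha> r \<bullet> x) * (p \<bullet> coroot (\<alpha> r)))"
    using arg_cong[OF coroot_expansion[of x], of "\<lambda>x. p \<bullet> x"] by (simp add: inner_sum_right)
  then show ?thesis by (simp add: cpairing_def coords_def)
qed

lemma cpairing_add_right: "cpairing \<alpha> p (x + y) = cpairing \<alpha> p x + cpairing \<alpha> p y"
  and cpairing_scale_right: "cpairing \<alpha> p (c *s x) = c * cpairing \<alpha> p x"
  and cpairing_add_left: "cpairing \<alpha> (p + q) x = cpairing \<alpha> p x + cpairing \<alpha> q x"
  and cpairing_zero [simp]: "cpairing \<alpha> 0 x = 0"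
  by (simp_all add: cpairing_def algebra_simps inner_add_left sum.distrib sum_subtractf sum_distrib_left)

lemma cpairing_sum_right: "cpairing \<alpha> p (\<Sum>r\<in>A. f r) = (\<Sum>r\<in>A. cpairing \<alpha> p (f r))"
proof (induction A rule: infinite_finite_induct)
  case empty
  then show ?case by (simp add: cpairing_def)
next
  case (infinite A)
  then show ?case by (simp add: cpairing_def)
qed (simp add: cpairing_add_right)

lemma cpairing_fund_weight: "cpairing \<alpha> (fund_weight \<alpha> k) x = x $ k"
  by (simp add: cpairing_def fund_weight_coroot if_distrib cong: if_cong)

text \<open>The linear part is an isometry and moves to the other argument as its inverse. Pairings
  with fundamental weights are the coordinates, so identities between extensions can be checked
  through this formula.\<close>

lemma cpairing_affine_ext:
  assumes "\<sigma> \<in> weyl R"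
  shows "cpairing \<alpha> p (affine_ext \<alpha> (\<lambda>x. \<sigma> x + t) x) = cpairing \<alpha> (fun_inv \<sigma> p) x + of_real (p \<bullet> t)"
  using linear_0[OF linear_weyl[OF assms]]
  by (simp add: affine_ext_def cpairing_add_right cpairing_sum_right cpairing_scale_right cpairing_coords
      cpairing_def[of _ "fun_inv \<sigma> p"] inner_weyl[OF assms])

lemma affine_ext_comp:
  assumes "f \<in> affine_maps (weyl R)" "g \<in> affine_maps (weyl R)"
  shows "affine_ext \<alpha> (f \<circ> g) x = affine_ext \<alpha> f (affine_ext \<alpha> g x)"
proof -
  from assms obtain \<sigma> t \<tau> u where f: "f = (\<lambda>x. \<sigma> x + t)" "\<sigma> \<in> weyl R" "t \<in> coroot_lattice \<alpha>"
    and g: "g = (\<lambda>x. \<tau> x + u)" "\<tau> \<in> weyl R" "u \<in> coroot_lattice \<alpha>" by (metis affine_mapsE)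
  have st: "\<sigma> \<circ> \<tau> \<in> weyl R" using f g weyl_group_facts by blast
  have eq: "f \<circ> g = (\<lambda>x. (\<sigma> \<circ> \<tau>) x + (\<sigma> u + t))"
    using linear_weyl[OF f(2)] by (auto simp: f g fun_eq_iff linear_add)
  have i: "fun_inv (\<sigma> \<circ> \<tau>) p = fun_inv \<tau> (fun_inv \<sigma> p)" for p
    using o_inv_distrib[OF weyl_group_facts(2)[OF f(2)] weyl_group_facts(2)[OF g(2)]] by simp
  have "cpairing \<alpha> p (affine_ext \<alpha> (f \<circ> g) x) = cpairing \<alpha> p (affine_ext \<alpha> f (affine_ext \<alpha> g x))" for p
    unfolding eq cpairing_affine_ext[OF st] unfolding f(1) g(1)
      cpairing_affine_ext[OF f(2)] cpairing_affine_ext[OF g(2)]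
    by (simp add: i inner_add_right inner_weyl[OF f(2)])
  then show ?thesis by (metis cpairing_fund_weight vec_eq_iff)
qed

lemma affine_ext_id: "affine_ext \<alpha> id x = x"
proof -
  have "cpairing \<alpha> p (affine_ext \<alpha> (\<lambda>x. id x + 0) x) = cpairing \<alpha> p x" for p
    unfolding cpairing_affine_ext[OF weyl_group_facts(1)] by simp
  then have "affine_ext \<alpha> (\<lambda>x. id x + 0) x = x" by (metis cpairing_fund_weight vec_eq_iff)
  then show ?thesis by (simp add: id_def)
qed

text \<open>On the real points \<open>coords \<alpha> y\<close> the extension is the original
  map.\<close>

lemma affine_ext_inj:
  assumes "f \<in> affine_maps (weyl R)" "g \<in> affine_maps (weyl R)" "affine_ext \<alpha> f = affine_ext \<alpha> g"
  shows "f = g"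
proof -
  have *: "affine_ext \<alpha> f (coords \<alpha> y) = coords \<alpha> (f y)" if "f \<in> affine_maps (weyl R)" for f y
  proof -
    from that obtain \<sigma> t where f: "f = (\<lambda>x. \<sigma> x + t)" "\<sigma> \<in> weyl R" "t \<in> coroot_lattice \<alpha>" by (rule affine_mapsE)
    have "cpairing \<alpha> p (affine_ext \<alpha> f (coords \<alpha> y)) = cpairing \<alpha> p (coords \<alpha> (f y))" for p
      unfolding f(1) cpairing_affine_ext[OF f(2)] cpairing_coords
      by (simp add: inner_add_right inner_weyl[OF f(2)])
    then show ?thesis by (metis cpairing_fund_weight vec_eq_iff)
  qed
  have "f y = g y" for y
  proof -
    have "coords \<alpha> (f y) = coords \<alpha> (g y)" using assms *[of f y] *[of g y] by simp
    then have "of_real (p \<bullet> f y) = (of_real (p \<bullet> g y) :: complex)" for p by (metis cpairing_coords)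
    then have "f y \<bullet> \<alpha> i = g y \<bullet> \<alpha> i" for i by (simp add: inner_commute)
    then show ?thesis by (rule vector_eqI)
  qed
  then show ?thesis by auto
qed

end

section \<open>The basic generators at \<open>\<lambda> = 0\<close>\<close>

text \<open>The gcd behind \<open>kappa\<close>: the least positive element of a nonzero subgroup of
  the integers generates it, by division with remainder.\<close>

lemma int_combinations_cyclic:
  fixes a :: "'n::finite \<Rightarrow> int"
  assumes "a r0 \<noteq> 0"
  shows "\<exists>d>0. {\<Sum>r\<in>UNIV. k r * a r | k. True} = {n * d | n. True}"
proof -
  let ?S = "{\<Sum>r\<in>UNIV. k r * a r | k. True}"
  have comb: "(\<Sum>r\<in>UNIV. k r * a r) \<in> ?S" for k by blast
  have closed: "x - n * y \<in> ?S" if xy: "x \<in> ?S" "y \<in> ?S" for x y n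
  proof -
    from xy obtain k l where "x = (\<Sum>r\<in>UNIV. k r * a r)" "y = (\<Sum>r\<in>UNIV. l r * a r)" by blast
    then have "x - n * y = (\<Sum>r\<in>UNIV. (k r - n * l r) * a r)"
      by (simp add: left_diff_distrib sum_subtractf sum_distrib_left mult.assoc)
    then show ?thesis using comb[of "\<lambda>r. k r - n * l r"] by metis
  qed
  have zero: "0 \<in> ?S" using comb[of "\<lambda>_. 0"] by simp
  have "(\<Sum>r\<in>UNIV. (if r = r0 then 1 else 0) * a r) = (\<Sum>r\<in>UNIV. if r = r0 then a r else 0)"
    by (intro sum.cong) auto
  then have "a r0 \<in> ?S" using comb[of "\<lambda>r. if r = r0 then 1 else 0"] by (simp only: sum.delta finite UNIV_I if_True)
  have "- a r0 \<in> ?S" using closed[OF zero \<open>a r0 \<in> ?S\<close>, of 1] by simp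
  have ex: "\<exists>n. n > 0 \<and> int n \<in> ?S"
  proof (cases "a r0 > 0")
    case True
    then have "nat (a r0) > 0 \<and> int (nat (a r0)) \<in> ?S" using \<open>a r0 \<in> ?S\<close> by simp
    then show ?thesis by blast
  next
    case False
    then have "nat (- a r0) > 0 \<and> int (nat (- a r0)) \<in> ?S" using \<open>- a r0 \<in> ?S\<close> assms by simp
    then show ?thesis by blast
  qed
  define d where "d = (LEAST n. n > 0 \<and> int n \<in> ?S)"
  have d: "d > 0" "int d \<in> ?S" using LeastI_ex[OF ex] by (simp_all add: d_def)
  have least: "d \<le> n" if "n > 0" "int n \<in> ?S" for n unfolding d_def using that by (intro Least_le) simp
  have "?S = {n * int d | n. True}"
  proof (intro equalityI subsetI)
    fix x assume "x \<in> ?S"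
    have "x mod int d = x - (x div int d) * int d" by (simp add: minus_div_mult_eq_mod)
    then have S: "x mod int d \<in> ?S" using closed[OF \<open>x \<in> ?S\<close> d(2), of "x div int d"] by (simp only:)
    have m: "0 \<le> x mod int d" "x mod int d < int d" using d by auto
    have "x mod int d = 0"
    proof (rule ccontr)
      assume "x mod int d \<noteq> 0"
      then have "nat (x mod int d) > 0" "int (nat (x mod int d)) \<in> ?S" using m S by simp_all
      then have "d \<le> nat (x mod int d)" by (rule least)
      then show False using m by simp
    qed
    then have "x = (x div int d) * int d" by (metis add.right_neutral div_mult_mod_eq)
    then show "x \<in> {n * int d | n. True}" by blast
  next
    fix x assume "x \<in> {n * int d | n. True}"
    then obtain n where "x = n * int d" by blast
    then show "x \<in> ?S" using closed[OF zero d(2), of "-n"] by simp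
  qed
  then show ?thesis using d by (intro exI[of _ "int d"]) simp
qed

lemma Rats_common_denominator:
  fixes c :: "'n::finite \<Rightarrow> real"
  assumes "\<And>r. c r \<in> \<rat>"
  shows "\<exists>D a. (D::nat) > 0 \<and> (\<forall>r. c r * of_nat D = of_int (a r))"
proof -
  have "\<exists>D. D > 0 \<and> c r * of_nat D \<in> \<int>" for r
    using assms[of r] by (elim Rats_cases') (auto intro!: exI[of _ "nat b" for b])
  then obtain D where D: "\<And>r. D r > 0" "\<And>r. c r * of_nat (D r) \<in> \<int>" by metis
  let ?D = "\<Prod>r\<in>UNIV. D r"
  have "c r * of_nat ?D \<in> \<int>" for r
  proof -
    have "?D = D r * (\<Prod>s\<in>UNIV - {r}. D s)" by (simp add: prod.remove)
    then have "c r * of_nat ?D = (c r * of_nat (D r)) * of_nat (\<Prod>s\<in>UNIV - {r}. D s)" by simp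
    then show ?thesis using D(2)[of r] by (metis Ints_mult Ints_of_nat)
  qed
  then have "\<forall>r. \<exists>n. c r * of_nat ?D = of_int n" by (metis Ints_cases)
  then obtain a where "\<forall>r. c r * of_nat ?D = of_int (a r)" by metis
  moreover have "?D > 0" using D(1) by (simp add: prod_pos)
  ultimately show ?thesis by blast
qed

section \<open>The ring and evaluation at \<lambda> = 0\<close>

lemma laurent_eval_superset:
  assumes "finite A" "Poly_Mapping.keys p \<subseteq> A"
  shows "laurent_eval p l x = (\<Sum>(k, e)\<in>A. Poly_Mapping.lookup p (k, e) * l ^ k *
        exp (2 * of_real pi * \<i> * (\<Sum>j\<in>UNIV. of_int (e $ j) * x $ j)))"
  unfolding laurent_eval_def
  using assms by (intro sum.mono_neutral_left) (auto simp: in_keys_iff)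

lemma laurent_eval_add: "laurent_eval (p + q) l x = laurent_eval p l x + laurent_eval q l x"
proof -
  let ?A = "Poly_Mapping.keys p \<union> Poly_Mapping.keys q"
  have "Poly_Mapping.keys (p + q) \<subseteq> ?A" by (rule Poly_Mapping.keys_add)
  then show ?thesis
    by (simp add: laurent_eval_superset[of ?A] lookup_add sum.distrib[symmetric] case_prod_unfold
        algebra_simps)
qed

lemma laurent_eval_single:
  "laurent_eval (Poly_Mapping.single (k, e) a) l x =
     a * l ^ k * exp (2 * of_real pi * \<i> * (\<Sum>j\<in>UNIV. of_int (e $ j) * x $ j))"
  by (subst laurent_eval_superset[of "{(k, e)}"]) auto

lemma ringA_add: "f \<in> ringA \<Longrightarrow> g \<in> ringA \<Longrightarrow> (\<lambda>l x. f l x + g l x) \<in> ringA"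
  unfolding ringA_def by (auto simp: fun_eq_iff intro!: image_eqI[of _ _ "p + q" for p q] laurent_eval_add[symmetric])

lemma ringA_sum: "finite A \<Longrightarrow> (\<And>s. s \<in> A \<Longrightarrow> f s \<in> ringA) \<Longrightarrow> (\<lambda>l x. \<Sum>s\<in>A. f s l x) \<in> ringA"
proof (induction A rule: finite_induct)
  case empty
  have "(\<lambda>l x. 0) = laurent_eval 0" by (auto simp: laurent_eval_def fun_eq_iff)
  then show ?case by (auto simp: ringA_def)
next
  case (insert s A)
  then show ?case using ringA_add[of "f s" "\<lambda>l x. \<Sum>s\<in>A. f s l x"] by simp
qed

lemma continuous_laurent_eval: "continuous (at 0) (\<lambda>l. laurent_eval p l x)"
  unfolding laurent_eval_def by (auto simp: case_prod_unfold intro!: continuous_intros)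

text \<open>Polynomials in \<lambda> are continuous at 0. This gives the value at \<lambda> = 0 a
  meaning although \<open>lam c\<close> never vanishes.\<close>

lemma ringA_eqI:
  assumes "f \<in> ringA" "g \<in> ringA" "\<And>l x. l \<noteq> 0 \<Longrightarrow> f l x = g l x" shows "f = g"
proof -
  have "f 0 x = g 0 x" for x
  proof -
    have "((\<lambda>l. f l x) \<longlongrightarrow> f 0 x) (at 0)" "((\<lambda>l. g l x) \<longlongrightarrow> g 0 x) (at 0)"
      using assms(1,2) continuous_laurent_eval by (auto simp: ringA_def continuous_at)
    moreover have "\<forall>\<^sub>F l in at 0. f l x = g l x"
      unfolding eventually_at_filter by (rule always_eventually) (use assms(3) in blast)
    ultimately have "((\<lambda>l. g l x) \<longlongrightarrow> f 0 x) (at 0)"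
      using tendsto_cong[of "\<lambda>l. f l x" "\<lambda>l. g l x" "at 0" "f 0 x"] by (simp only:)
    then show ?thesis using \<open>((\<lambda>l. g l x) \<longlongrightarrow> g 0 x) (at 0)\<close> by (rule LIM_unique)
  qed
  then have "f l x = g l x" for l x using assms(3) by (cases "l = 0") auto
  then show ?thesis by (intro ext)
qed

locale weighted_root_system = based_root_system +
  fixes m :: "'b \<Rightarrow> nat"
  assumes rational: "\<forall>a\<in>R. a \<bullet> a \<in> \<rat>" and omega_nonzero: "omega \<alpha> m \<noteq> 0"
begin

lemma omega_simple: "omega \<alpha> m \<bullet> \<alpha> r = of_nat (m r) * ((\<alpha> r \<bullet> \<alpha> r) / 2)"
  by (simp add: omega_def inner_sum_left fund_weight_simple if_distrib cong: if_cong)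

text \<open>The pairings of \<omega> with the simple roots are rational and not all zero, so a
  common denominator reduces the claim to a nonzero subgroup of the integers.\<close>

lemma kappa_property: "kappa \<alpha> m > 0 \<and>
  {\<Sum>r\<in>UNIV. of_int (k r) * (omega \<alpha> m \<bullet> \<alpha> r) | k :: 'b \<Rightarrow> int. True} = {of_int n * kappa \<alpha> m | n :: int. True}"
proof -
  let ?c = "\<lambda>r. omega \<alpha> m \<bullet> \<alpha> r"
  let ?T = "{\<Sum>r\<in>UNIV. of_int (k r) * ?c r | k :: 'b \<Rightarrow> int. True}"
  have "?c r \<in> \<rat>" for r using rational simple_root by (simp add: omega_simple)
  then obtain D a where D: "(D::nat) > 0" "\<And>r. ?c r * of_nat D = of_int (a r)"
    using Rats_common_denominator[of ?c] by blast
  have "\<exists>r. a r \<noteq> 0"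
  proof (rule ccontr)
    assume "\<not> ?thesis"
    then have "?c r = 0 \<bullet> \<alpha> r" for r using D by simp
    then show False using omega_nonzero vector_eqI by blast
  qed
  then obtain r0 where "a r0 \<noteq> 0" by blast
  from int_combinations_cyclic[of a, OF this]
  obtain d where d: "d > 0" "{\<Sum>r\<in>UNIV. k r * a r | k. True} = {n * d | n. True}" by (elim exE conjE)
  let ?q = "of_int d / of_nat D :: real"
  have c: "?c r = of_int (a r) / of_nat D" for r using D by (simp add: field_simps)
  have sum_c: "(\<Sum>r\<in>UNIV. of_int (k r) * ?c r) = of_int (\<Sum>r\<in>UNIV. k r * a r) / of_nat D" for k
    by (simp add: c sum_divide_distrib)
  have eq: "?T = {of_int n * ?q | n :: int. True}"
  proof (intro equalityI subsetI)
    fix x assume "x \<in> ?T"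
    then obtain k where k: "x = (\<Sum>r\<in>UNIV. of_int (k r) * ?c r)" by blast
    have "(\<Sum>r\<in>UNIV. k r * a r) \<in> {n * d | n. True}" unfolding d(2)[symmetric] by blast
    then obtain n where "(\<Sum>r\<in>UNIV. k r * a r) = n * d" by blast
    then have "x = of_int n * ?q" unfolding k sum_c by simp
    then show "x \<in> {of_int n * ?q | n :: int. True}" by blast
  next
    fix x assume "x \<in> {of_int n * ?q | n :: int. True}"
    then obtain n :: int where n: "x = of_int n * ?q" by blast
    have "n * d \<in> {\<Sum>r\<in>UNIV. k r * a r | k. True}" unfolding d(2) by blast
    then obtain k where "n * d = (\<Sum>r\<in>UNIV. k r * a r)" by blast
    then have "x = (\<Sum>r\<in>UNIV. of_int (k r) * ?c r)"
      unfolding sum_c n by (metis of_int_mult times_divide_eq_right)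
    then show "x \<in> ?T" by blast
  qed
  have pos: "?q > 0" using d D by simp
  \<comment> \<open>Two positive generators are integer multiples of each other; the definite
    description in \<open>kappa\<close> depends on this uniqueness.\<close>
  have uniq: "q = q'" if q: "q > 0" "q' > 0" "{of_int n * q | n :: int. True} = {of_int n * q' | n :: int. True}"
    for q q' :: real
  proof -
    have "of_int 1 * q \<in> {of_int n * q' | n :: int. True}" unfolding q(3)[symmetric] by blast
    then obtain n :: int where n: "q = of_int n * q'" by auto
    have "of_int 1 * q' \<in> {of_int n * q | n :: int. True}" unfolding q(3) by blast
    then obtain n' :: int where n': "q' = of_int n' * q" by auto
    have "of_int (n' * n) * q' = of_int 1 * q'" using n'[unfolded n] by simp
    then have "n' * n = 1" using q unfolding mult_cancel_right of_int_eq_iff by auto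
    moreover have "n > 0" using n q by (simp add: zero_less_mult_iff)
    ultimately have "n = 1" using pos_zmult_eq_1_iff[of n n'] by (simp add: mult.commute)
    then show ?thesis using n by simp
  qed
  show ?thesis
    unfolding kappa_def
  proof (rule theI[of "\<lambda>q. q > 0 \<and> ?T = {of_int n * q | n :: int. True}" ?q])
    show "?q > 0 \<and> ?T = {of_int n * ?q | n :: int. True}" using pos eq by (rule conjI)
    fix q assume q: "q > 0 \<and> ?T = {of_int n * q | n :: int. True}"
    show "q = ?q"
      by (rule uniq) (use q pos in \<open>simp_all only: eq[symmetric]\<close>)
  qed
qed

lemma kappa_pos: "kappa \<alpha> m > 0"
  using kappa_property by blast

lemma omega_nonneg: "x \<in> root_cone \<Longrightarrow> x \<bullet> omega \<alpha> m \<ge> 0"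
  unfolding root_cone_def
  by (auto simp: inner_commute[of _ "omega \<alpha> m"] inner_sum_right omega_simple intro!: sum_nonneg)

text \<open>These numbers become the exponents of \<lambda>: dominance makes them nonnegative, and
  \<open>kappa\<close> makes them integral.\<close>

lemma root_cone_omega:
  assumes "x \<in> root_cone" shows "\<exists>n::nat. x \<bullet> omega \<alpha> m = of_nat n * kappa \<alpha> m"
proof -
  from assms obtain k where k: "x = (\<Sum>i\<in>UNIV. of_nat (k i) *\<^sub>R \<alpha> i)" unfolding root_cone_def by blast
  have "x \<bullet> omega \<alpha> m = (\<Sum>r\<in>UNIV. of_int (int (k r)) * (omega \<alpha> m \<bullet> \<alpha> r))"
    by (simp add: k inner_commute[of _ "omega \<alpha> m"] inner_sum_right)
  then have "x \<bullet> omega \<alpha> m \<in> {\<Sum>r\<in>UNIV. of_int (k r) * (omega \<alpha> m \<bullet> \<alpha> r) | k :: 'b \<Rightarrow> int. True}"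
    by (intro CollectI exI[of _ "\<lambda>r. int (k r)"]) simp
  then obtain n :: int where n: "x \<bullet> omega \<alpha> m = of_int n * kappa \<alpha> m" using kappa_property by auto
  then have "n \<ge> 0" using omega_nonneg[OF assms] kappa_pos by (simp add: zero_le_mult_iff)
  then obtain k where "n = int k" by (metis zero_le_imp_eq_int)
  then show ?thesis using n by (intro exI[of _ k]) simp
qed

lemma lam_surj: "l \<noteq> 0 \<Longrightarrow> \<exists>c. lam \<alpha> m c = l"
proof -
  assume "l \<noteq> 0"
  then have "lam \<alpha> m (Ln l / (- 2 * of_real pi * \<i> * of_real (kappa \<alpha> m))) = l"
    using kappa_pos by (simp add: lam_def)
  then show ?thesis by blast
qed

definition character :: "'a \<Rightarrow> complex^'b \<Rightarrow> complex" where
  "character p x = exp (2 * of_real pi * \<i> * cpairing \<alpha> p x)"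

text \<open>By dominance \<open>theta j\<close> is the largest pairing with \<omega> on the orbit,
  so these elements carry the terms without a factor \<lambda>.\<close>

definition top_weyl :: "'b \<Rightarrow> ('a \<Rightarrow> 'a) set" where
  "top_weyl j = {\<sigma> \<in> weyl R. \<sigma> (fund_weight \<alpha> j) \<bullet> omega \<alpha> m = theta \<alpha> m j}"

text \<open>The basic generators evaluated at \<open>\<lambda> = 0\<close>: of the orbit sums only the terms of highest
  degree survive.\<close>

definition phi :: "complex^'b \<Rightarrow> complex^'b" where
  "phi x = (\<chi> j. 1 / of_nat (card (stab_weyl R (fund_weight \<alpha> j))) *
     (\<Sum>\<sigma>\<in>top_weyl j. character (\<sigma> (fund_weight \<alpha> j)) x))"

text \<open>Shifting the argument by \<open>c\<close> times \<omega> multiplies the term of \<sigma>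
  by an exponential in \<open>c\<close>, which combines with the prefactor to \<lambda> to the power
  \<open>k \<sigma>\<close>. Hence a polynomial in \<lambda> meets the description at all
  \<open>lam c\<close>, and \<open>ringA_eqI\<close> makes it the only one.\<close>

lemma basic_gen_zero: "basic_gen R \<alpha> m j 0 x = phi x $ j"
proof -
  let ?w = "fund_weight \<alpha> j" and ?N = "of_nat (card (stab_weyl R (fund_weight \<alpha> j))) :: complex"
  have "\<exists>k::nat. (?w - \<sigma> ?w) \<bullet> omega \<alpha> m = of_nat k * kappa \<alpha> m" if "\<sigma> \<in> weyl R" for \<sigma>
    using root_cone_omega dominant_minus_weyl fund_weight_dominant that by blast
  then obtain k :: "('a \<Rightarrow> 'a) \<Rightarrow> nat"
    where k: "\<And>\<sigma>. \<sigma> \<in> weyl R \<Longrightarrow> theta \<alpha> m j - \<sigma> ?w \<bullet> omega \<alpha> m = of_nat (k \<sigma>) * kappa \<alpha> m"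
    unfolding inner_diff_left theta_def by metis
  define F where "F l x = (\<Sum>\<sigma>\<in>weyl R. 1 / ?N * l ^ k \<sigma> * character (\<sigma> ?w) x)" for l x
  have "F \<in> ringA"
    unfolding F_def
  proof (rule ringA_sum[OF finite_weyl])
    fix \<sigma> assume "\<sigma> \<in> weyl R"
    then have "\<sigma> ?w \<in> weight_lattice" using weight_lattice_weyl fund_weight_in_lattice by blast
    then have "of_int \<lfloor>\<sigma> ?w \<bullet> coroot (\<alpha> r)\<rfloor> = \<sigma> ?w \<bullet> coroot (\<alpha> r)" for r
      unfolding weight_lattice_def by (auto elim: Ints_cases)
    then have "complex_of_real (\<sigma> ?w \<bullet> coroot (\<alpha> r)) = of_int \<lfloor>\<sigma> ?w \<bullet> coroot (\<alpha> r)\<rfloor>" for r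
      by (metis of_real_of_int_eq)
    then have "(\<lambda>l x. 1 / ?N * l ^ k \<sigma> * character (\<sigma> ?w) x) =
        laurent_eval (Poly_Mapping.single (k \<sigma>, \<chi> r. \<lfloor>\<sigma> ?w \<bullet> coroot (\<alpha> r)\<rfloor>) (1 / ?N))"
      by (simp add: fun_eq_iff laurent_eval_single character_def cpairing_def mult.commute)
    then show "(\<lambda>l x. 1 / ?N * l ^ k \<sigma> * character (\<sigma> ?w) x) \<in> ringA" unfolding ringA_def by blast
  qed
  have val: "F (lam \<alpha> m c) x =
       exp (- 2 * of_real pi * \<i> * of_real (theta \<alpha> m j) * c) * (1 / ?N) *
       (\<Sum>\<sigma>\<in>weyl R. exp (2 * of_real pi * \<i> *
          cpairing \<alpha> ?w (affine_ext \<alpha> \<sigma> (c *s coords \<alpha> (omega \<alpha> m) + x))))" for c x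
  proof -
    have summand: "lam \<alpha> m c ^ k \<sigma> * character (\<sigma> ?w) x =
        exp (- 2 * of_real pi * \<i> * of_real (theta \<alpha> m j) * c) *
        exp (2 * of_real pi * \<i> * cpairing \<alpha> (\<sigma> ?w) (c *s coords \<alpha> (omega \<alpha> m) + x))"
      if "\<sigma> \<in> weyl R" for \<sigma>
    proof -
      have "complex_of_real (theta \<alpha> m j) = of_nat (k \<sigma>) * of_real (kappa \<alpha> m) + of_real (\<sigma> ?w \<bullet> omega \<alpha> m)"
        using k[OF that] by (metis add_diff_cancel_right' diff_add_cancel of_real_add of_real_mult of_real_of_nat_eq)
      then show ?thesis
        unfolding lam_def character_def cpairing_add_right cpairing_scale_right cpairing_coords
          exp_of_nat_mult[symmetric] exp_add[symmetric]
        by (simp add: algebra_simps)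
    qed
    have "(\<Sum>\<sigma>\<in>weyl R. exp (2 * of_real pi * \<i> *
          cpairing \<alpha> ?w (affine_ext \<alpha> \<sigma> (c *s coords \<alpha> (omega \<alpha> m) + x)))) =
        (\<Sum>\<sigma>\<in>weyl R. exp (2 * of_real pi * \<i> *
          cpairing \<alpha> (fun_inv \<sigma> ?w) (c *s coords \<alpha> (omega \<alpha> m) + x)))"
      using cpairing_affine_ext[where t = 0] by (intro sum.cong) simp_all
    \<comment> \<open>Moving \<sigma> across the pairing has inverted it; the sum runs over a
      group.\<close>
    also have "\<dots> = (\<Sum>\<sigma>\<in>weyl R. exp (2 * of_real pi * \<i> *
          cpairing \<alpha> (\<sigma> ?w) (c *s coords \<alpha> (omega \<alpha> m) + x)))"
      by (rule sum.reindex_bij_witness[where i = fun_inv and j = fun_inv])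
        (auto simp: weyl_group_facts inv_inv_eq)
    finally show ?thesis
      by (simp add: F_def sum_distrib_left summand mult.assoc)
  qed
  have "basic_gen R \<alpha> m j = F"
    unfolding basic_gen_def
  proof (rule the_equality)
    fix f assume f: "f \<in> ringA \<and> (\<forall>c x. f (lam \<alpha> m c) x =
       exp (- 2 * of_real pi * \<i> * of_real (theta \<alpha> m j) * c) * (1 / ?N) *
       (\<Sum>\<sigma>\<in>weyl R. exp (2 * of_real pi * \<i> *
          cpairing \<alpha> ?w (affine_ext \<alpha> \<sigma> (c *s coords \<alpha> (omega \<alpha> m) + x)))))"
    show "f = F"
    proof (rule ringA_eqI)
      fix l x assume "(l::complex) \<noteq> 0"
      then obtain c where "l = lam \<alpha> m c" using lam_surj by metis
      then show "f l x = F l x" using f val by simp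
    qed (use f \<open>F \<in> ringA\<close> in auto)
  qed (use \<open>F \<in> ringA\<close> val in auto)
  moreover have "F 0 x = phi x $ j"
  proof -
    \<comment> \<open>At \<lambda> = 0 the factor \<open>0 ^ k \<sigma>\<close> is 1 for exponent 0
      and vanishes otherwise.\<close>
    have "(k \<sigma> = 0) = (\<sigma> ?w \<bullet> omega \<alpha> m = theta \<alpha> m j)" if "\<sigma> \<in> weyl R" for \<sigma>
      using k[OF that] kappa_pos by auto
    then have "F 0 x = (\<Sum>\<sigma>\<in>weyl R. if \<sigma> ?w \<bullet> omega \<alpha> m = theta \<alpha> m j then 1 / ?N * character (\<sigma> ?w) x else 0)"
      unfolding F_def by (intro sum.cong) (auto simp: power_0_left)
    also have "\<dots> = phi x $ j"
      unfolding phi_def top_weyl_def sum_distrib_left vec_lambda_beta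
      by (rule sum.inter_filter[OF finite_weyl, symmetric])
    finally show ?thesis .
  qed
  ultimately show ?thesis by simp
qed

lemma proper_generators_zero: "proper_generators R \<alpha> m z \<Longrightarrow> (\<chi> k. z k 0 x) = phi x"
  unfolding proper_generators_def by (simp add: vec_eq_iff basic_gen_zero)

end

section \<open>The fibres of the generators at \<open>\<lambda> = 0\<close>\<close>

context weighted_root_system
begin

section \<open>The stabilizer of \<omega>\<close>

abbreviation W0 :: "('a \<Rightarrow> 'a) set" where
  "W0 \<equiv> stab_weyl R (omega \<alpha> m)"

lemmas W0_facts = subgroup_BijGroup_UNIV_D[OF subgroup_stab_weyl[of R "omega \<alpha> m"]]

lemma W0_weyl: "\<sigma> \<in> W0 \<Longrightarrow> \<sigma> \<in> weyl R"
  by (simp add: stab_weyl_def)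

lemma finite_W0: "finite W0"
  using finite_weyl stab_weyl_subset by (rule rev_finite_subset)

lemma W0_omega: "\<sigma> \<in> W0 \<Longrightarrow> \<sigma> p \<bullet> omega \<alpha> m = p \<bullet> omega \<alpha> m"
  using inner_weyl_weyl[of \<sigma> R p "omega \<alpha> m"] by (simp add: stab_weyl_def)

lemma reflection_in_W0: "m i = 0 \<Longrightarrow> reflection (\<alpha> i) \<in> W0"
  using reflection_in_weyl[OF simple_root] omega_simple[of i]
  by (simp add: stab_weyl_def reflection_def)

lemma finite_top_weyl: "finite (top_weyl j)"
  using finite_weyl by (simp add: top_weyl_def)

lemma id_in_top_weyl: "id \<in> top_weyl j"
  using weyl_group_facts(1) by (simp add: top_weyl_def theta_def)

lemma W0_top_weyl: "\<sigma> \<in> W0 \<Longrightarrow> \<tau> \<in> top_weyl j \<Longrightarrow> \<sigma> \<circ> \<tau> \<in> top_weyl j"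
  using weyl_group_facts(3)[of \<sigma> R \<tau>] W0_omega by (simp add: top_weyl_def W0_weyl)

text \<open>Dominance of \<omega> makes the pairing a sum of nonnegative terms, each of which then
  vanishes.\<close>

lemma root_cone_orthogonal_omega:
  assumes "x \<in> root_cone" "x \<bullet> omega \<alpha> m = 0"
  shows "\<exists>k. x = (\<Sum>i\<in>UNIV. of_nat (k i) *\<^sub>R \<alpha> i) \<and> (\<forall>i. m i > 0 \<longrightarrow> k i = (0::nat))"
proof -
  from assms obtain k where k: "x = (\<Sum>i\<in>UNIV. of_nat (k i) *\<^sub>R \<alpha> i)" unfolding root_cone_def by blast
  have "x \<bullet> omega \<alpha> m = (\<Sum>r\<in>UNIV. of_nat (k r) * (omega \<alpha> m \<bullet> \<alpha> r))"
    unfolding k by (simp add: inner_sum_left inner_sum_right inner_commute[of _ "omega \<alpha> m"])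
  then have "(\<Sum>r\<in>UNIV. real (k r) * (omega \<alpha> m \<bullet> \<alpha> r)) = 0" using assms by simp
  then have "real (k r) * (omega \<alpha> m \<bullet> \<alpha> r) = 0" for r
    by (subst (asm) sum_nonneg_eq_0_iff) (auto simp: omega_simple)
  then have "k r = 0 \<or> m r = 0" for r by (simp add: omega_simple)
  then have "m r > 0 \<longrightarrow> k r = 0" for r by (metis less_irrefl)
  then show ?thesis using k by blast
qed

text \<open>A highest weight vector is the longest one: this is how a weight of the form \<open>p\<close> minus a
  combination of the simple roots fixing \<open>\<omega>\<close> is recognised as equal to \<open>p\<close>.\<close>

lemma shorter_weight:
  assumes q: "\<And>i. m i = 0 \<Longrightarrow> q \<bullet> coroot (\<alpha> i) \<ge> 0"
    and d: "p - q \<in> root_cone" "(p - q) \<bullet> omega \<alpha> m = 0"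
  shows "q = p \<or> q \<bullet> q < p \<bullet> p"
proof -
  obtain k where k: "p - q = (\<Sum>i\<in>UNIV. of_nat (k i) *\<^sub>R \<alpha> i)" "\<And>i. m i > 0 \<Longrightarrow> k i = (0::nat)"
    using root_cone_orthogonal_omega[OF d] by blast
  have "q \<bullet> \<alpha> i \<ge> 0" if "m i = 0" for i
    using q[OF that] inner_gt_zero_iff[of "\<alpha> i"] simple_nonzero[of i]
    by (auto simp: coroot_def zero_le_divide_iff simp del: inner_gt_zero_iff)
  then have "0 \<le> real (k i) * (q \<bullet> \<alpha> i)" for i using k(2)[of i] by (cases "m i = 0") auto
  then have "q \<bullet> (p - q) \<ge> 0" unfolding k(1) by (simp add: inner_sum_right sum_nonneg)
  moreover have "p \<bullet> p = q \<bullet> q + 2 * (q \<bullet> (p - q)) + (p - q) \<bullet> (p - q)"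
    by (simp add: inner_diff_left inner_diff_right inner_commute)
  moreover have "(p - q) \<bullet> (p - q) > 0" if "q \<noteq> p" using that by simp
  ultimately show ?thesis by (cases "q = p") (simp, linarith)
qed

text \<open>The difference of the two weights involves only simple roots with
  \<open>m i = 0\<close>, none of which is the one at \<open>s\<close>, so it is orthogonal to the
  fundamental weight. Since both weights have the same length, the difference is zero.\<close>

lemma top_weyl_fixes:
  assumes "m s > 0" "\<sigma> \<in> top_weyl s" shows "\<sigma> (fund_weight \<alpha> s) = fund_weight \<alpha> s"
proof -
  let ?p = "fund_weight \<alpha> s"
  have s: "\<sigma> \<in> weyl R" "\<sigma> ?p \<bullet> omega \<alpha> m = ?p \<bullet> omega \<alpha> m" using assms(2) by (auto simp: top_weyl_def theta_def)
  have d: "?p - \<sigma> ?p \<in> root_cone" "(?p - \<sigma> ?p) \<bullet> omega \<alpha> m = 0"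
    using dominant_minus_weyl[OF fund_weight_dominant s(1)] s(2) by (simp_all add: inner_diff_left)
  obtain k where k: "?p - \<sigma> ?p = (\<Sum>i\<in>UNIV. of_nat (k i) *\<^sub>R \<alpha> i)" "\<And>i. m i > 0 \<Longrightarrow> k i = (0::nat)"
    using root_cone_orthogonal_omega[OF d] by blast
  have "?p \<bullet> (?p - \<sigma> ?p) = 0"
    unfolding k(1) using k(2) assms(1) by (auto simp: inner_sum_right fund_weight_simple intro!: sum.neutral)
  moreover have "\<sigma> ?p \<bullet> \<sigma> ?p = ?p \<bullet> ?p" using inner_weyl_weyl s by blast
  ultimately have "(?p - \<sigma> ?p) \<bullet> (?p - \<sigma> ?p) = 0"
    by (simp add: inner_diff_left inner_diff_right inner_commute)
  then show ?thesis by simp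
qed

lemma W0_fixes: "m s > 0 \<Longrightarrow> \<sigma> \<in> W0 \<Longrightarrow> \<sigma> (fund_weight \<alpha> s) = fund_weight \<alpha> s"
  using W0_top_weyl[OF _ id_in_top_weyl] top_weyl_fixes by fastforce

section \<open>Characters and invariance of \<open>phi\<close>\<close>

lemma character_add: "character (p + q) x = character p x * character q x"
  by (simp add: character_def cpairing_add_left distrib_left exp_add)

lemma character_nonzero [simp]: "character p x \<noteq> 0"
  by (simp add: character_def)

lemma character_zero [simp]: "character 0 x = 1"
  by (simp add: character_def)

lemma character_minus: "character (- p) x = 1 / character p x"
  using character_add[of "-p" p x] by (simp add: field_simps)

lemma character_affine:
  assumes "\<sigma> \<in> weyl R" "t \<in> coroot_lattice \<alpha>" "p \<in> weight_lattice"
  shows "character p (affine_ext \<alpha> (\<lambda>x. \<sigma> x + t) x) = character (fun_inv \<sigma> p) x"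
proof -
  obtain n where "p \<bullet> t = of_int n" using lattice_pairing[OF assms(3,2)] by (auto elim: Ints_cases)
  then have "exp (2 * of_real pi * \<i> * complex_of_real (p \<bullet> t)) = 1"
    by (simp add: exp_eq_1)
  then show ?thesis
    unfolding character_def cpairing_affine_ext[OF assms(1)] by (simp add: distrib_left exp_add)
qed

lemma phi_nth: "phi x $ j = 1 / of_nat (card (stab_weyl R (fund_weight \<alpha> j))) *
     (\<Sum>\<sigma>\<in>top_weyl j. character (\<sigma> (fund_weight \<alpha> j)) x)"
  by (simp add: phi_def)

lemma card_stab_pos: "card (stab_weyl R p) > 0"
  using finite_subset[OF stab_weyl_subset finite_weyl] subgroup_BijGroup_UNIV_D(1)[OF subgroup_stab_weyl]
  by (metis card_gt_0_iff empty_iff)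

text \<open>By \<open>top_weyl_fixes\<close> all terms coincide. This coordinate of
  \<open>phi\<close> therefore never vanishes, so it can be inverted and the image of
  \<open>phi\<close> misses \<open>D_zero\<close>.\<close>

lemma phi_distinguished:
  assumes "m s > 0"
  shows "phi x $ s = of_nat (card (top_weyl s)) / of_nat (card (stab_weyl R (fund_weight \<alpha> s))) * character (fund_weight \<alpha> s) x"
proof -
  have "(\<Sum>\<sigma>\<in>top_weyl s. character (\<sigma> (fund_weight \<alpha> s)) x) = (\<Sum>\<sigma>\<in>top_weyl s. character (fund_weight \<alpha> s) x)"
    by (intro sum.cong refl arg_cong2[of _ _ _ _ character] top_weyl_fixes[OF assms])
  then show ?thesis by (simp add: phi_nth)
qed

text \<open>Lattice translations are invisible to characters of weights, and left composition with
  \<sigma> permutes \<open>top_weyl j\<close> because \<sigma> preserves the pairing with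
  \<omega>.\<close>

lemma phi_invariant:
  assumes "\<phi> \<in> affine_maps W0" shows "phi (affine_ext \<alpha> \<phi> x) = phi x"
proof -
  from assms obtain \<sigma> t where f: "\<phi> = (\<lambda>x. \<sigma> x + t)" "\<sigma> \<in> W0" "t \<in> coroot_lattice \<alpha>" by (rule affine_mapsE)
  note i = W0_facts(4)[OF f(2)]
  have c: "\<sigma> \<circ> (fun_inv \<sigma> \<circ> \<tau>) = \<tau>" "fun_inv \<sigma> \<circ> (\<sigma> \<circ> \<tau>) = \<tau>" for \<tau>
    using inv_weyl[OF W0_weyl[OF f(2)]] by (auto simp: fun_eq_iff)
  have "(\<Sum>\<tau>\<in>top_weyl j. character (\<tau> (fund_weight \<alpha> j)) (affine_ext \<alpha> \<phi> x)) =
      (\<Sum>\<tau>\<in>top_weyl j. character (\<tau> (fund_weight \<alpha> j)) x)" for j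
  proof (rule sum.reindex_bij_witness[where i = "\<lambda>\<tau>. \<sigma> \<circ> \<tau>" and j = "\<lambda>\<tau>. fun_inv \<sigma> \<circ> \<tau>"])
    fix \<tau> assume t: "\<tau> \<in> top_weyl j"
    then have "\<tau> (fund_weight \<alpha> j) \<in> weight_lattice"
      using weight_lattice_weyl fund_weight_in_lattice by (simp add: top_weyl_def)
    then show "character ((fun_inv \<sigma> \<circ> \<tau>) (fund_weight \<alpha> j)) x = character (\<tau> (fund_weight \<alpha> j)) (affine_ext \<alpha> \<phi> x)"
      unfolding f(1) using character_affine[OF W0_weyl[OF f(2)] f(3)] by simp
    show "fun_inv \<sigma> \<circ> \<tau> \<in> top_weyl j" "\<sigma> \<circ> \<tau> \<in> top_weyl j" using W0_top_weyl f(2) i t by blast+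
  qed (simp_all only: c)
  then show ?thesis by (simp add: vec_eq_iff phi_nth)
qed

text \<open>The analogue of a monic polynomial with leading monomial \<open>p\<close>, within the functions on the base
  of \<open>phi\<close>.\<close>

definition leading :: "'a \<Rightarrow> (complex^'b \<Rightarrow> complex) \<Rightarrow> bool" where
  "leading p f \<longleftrightarrow> (\<forall>x y. phi x = phi y \<longrightarrow> f x = f y) \<and>
     (\<exists>qs. p \<in> set qs \<and> (\<forall>x. f x = (\<Sum>q\<leftarrow>qs. character q x)) \<and>
       (\<forall>q\<in>set qs. q \<in> weight_lattice \<and> q \<bullet> omega \<alpha> m = p \<bullet> omega \<alpha> m \<and> (\<forall>\<sigma>\<in>W0. p - \<sigma> q \<in> root_cone)))"

lemma leading_zero: "leading 0 (\<lambda>x. 1)"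
  unfolding leading_def
proof (intro conjI exI[of _ "[0]"])
  show "\<forall>q\<in>set [0]. q \<in> weight_lattice \<and> q \<bullet> omega \<alpha> m = 0 \<bullet> omega \<alpha> m \<and> (\<forall>\<sigma>\<in>W0. 0 - \<sigma> q \<in> root_cone)"
  proof (intro ballI conjI)
    fix q \<sigma> assume "q \<in> set [0::'a]" "\<sigma> \<in> W0"
    then show "0 - \<sigma> q \<in> root_cone" using linear_0[OF linear_weyl[OF W0_weyl], of \<sigma>] by simp
  qed (auto simp: weight_lattice_def)
qed auto

lemma sum_list_product:
  "(\<Sum>q\<leftarrow>qs. f q) * (\<Sum>r\<leftarrow>rs. g r) = (\<Sum>u\<leftarrow>concat (map (\<lambda>q. map (Pair q) rs) qs). f (fst u) * (g (snd u) :: complex))"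
  by (induction qs) (simp_all add: distrib_right o_def sum_list_const_mult)

text \<open>Expansions are lists of weights, each with coefficient one. Multiplicities are thus
  positive, and the leading term of a product cannot cancel.\<close>

lemma leading_mult:
  assumes "leading p f" "leading p' f'" shows "leading (p + p') (\<lambda>x. f x * f' x)"
proof -
  obtain qs where q: "p \<in> set qs" "\<And>x. f x = (\<Sum>q\<leftarrow>qs. character q x)"
      "\<And>q. q \<in> set qs \<Longrightarrow> q \<in> weight_lattice \<and> q \<bullet> omega \<alpha> m = p \<bullet> omega \<alpha> m \<and> (\<forall>\<sigma>\<in>W0. p - \<sigma> q \<in> root_cone)"
    using assms(1) unfolding leading_def by blast
  obtain rs where r: "p' \<in> set rs" "\<And>x. f' x = (\<Sum>q\<leftarrow>rs. character q x)"
      "\<And>q. q \<in> set rs \<Longrightarrow> q \<in> weight_lattice \<and> q \<bullet> omega \<alpha> m = p' \<bullet> omega \<alpha> m \<and> (\<forall>\<sigma>\<in>W0. p' - \<sigma> q \<in> root_cone)"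
    using assms(2) unfolding leading_def by blast
  let ?us = "map (\<lambda>u. fst u + snd u) (concat (map (\<lambda>q. map (Pair q) rs) qs))"
  have us: "set ?us = {q + r | q r. q \<in> set qs \<and> r \<in> set rs}" by force
  have *: "(p + p') - \<sigma> (q + r) = (p - \<sigma> q) + (p' - \<sigma> r)" if "\<sigma> \<in> W0" for \<sigma> q r
    using linear_add[OF linear_weyl[OF W0_weyl[OF that]]] by simp
  show ?thesis
    unfolding leading_def
  proof (intro conjI exI[of _ ?us])
    show "\<forall>x y. phi x = phi y \<longrightarrow> f x * f' x = f y * f' y"
      using assms unfolding leading_def by metis
    show "p + p' \<in> set ?us" unfolding us using q r by blast
    show "\<forall>x. f x * f' x = (\<Sum>q\<leftarrow>?us. character q x)"
      unfolding q(2) r(2) sum_list_product by (simp add: o_def character_add)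
    show "\<forall>q\<in>set ?us. q \<in> weight_lattice \<and> q \<bullet> omega \<alpha> m = (p + p') \<bullet> omega \<alpha> m \<and> (\<forall>\<sigma>\<in>W0. p + p' - \<sigma> q \<in> root_cone)"
      unfolding us using q(3) r(3)
      by (auto simp: inner_add_left * intro!: weight_lattice_add root_cone_add)
  qed
qed

lemma leading_power: "leading p f \<Longrightarrow> leading (of_nat n *\<^sub>R p) (\<lambda>x. f x ^ n)"
proof (induction n)
  case 0
  then show ?case using leading_zero by simp
next
  case (Suc n)
  then show ?case using leading_mult[OF Suc.prems Suc.IH[OF Suc.prems]] by (simp add: scaleR_left_distrib)
qed

text \<open>The witness is the coordinate of \<open>phi\<close> without its normalizing factor.
  Dominance covers the whole Weyl orbit of a fundamental weight, hence also all images under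
  \<open>W0\<close> of the weights that occur.\<close>

lemma leading_fund_weight: "\<exists>f. leading (fund_weight \<alpha> k) f"
proof -
  let ?w = "fund_weight \<alpha> k"
  obtain ts where ts: "set ts = top_weyl k" "distinct ts" using finite_distinct_list[OF finite_top_weyl] by blast
  let ?qs = "map (\<lambda>\<sigma>. \<sigma> ?w) ts"
  let ?f = "\<lambda>x. of_nat (card (stab_weyl R ?w)) * phi x $ k"
  have 1: "?f x = (\<Sum>q\<leftarrow>?qs. character q x)" for x
    using card_stab_pos[of ?w] ts by (simp add: phi_nth o_def sum_list_distinct_conv_sum_set)
  have 2: "?w \<in> set ?qs"
    using id_in_top_weyl[of k] unfolding set_map ts(1) by (intro image_eqI[of _ _ id]) auto
  have 3: "q \<in> weight_lattice \<and> q \<bullet> omega \<alpha> m = ?w \<bullet> omega \<alpha> m \<and> (\<forall>\<sigma>\<in>W0. ?w - \<sigma> q \<in> root_cone)"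
    if "q \<in> set ?qs" for q
  proof -
    from that ts obtain \<tau> where t: "\<tau> \<in> top_weyl k" "q = \<tau> ?w" by auto
    then have "\<tau> \<in> weyl R" "\<tau> ?w \<bullet> omega \<alpha> m = ?w \<bullet> omega \<alpha> m" by (auto simp: top_weyl_def theta_def)
    moreover have "?w - \<sigma> (\<tau> ?w) \<in> root_cone" if "\<sigma> \<in> W0" for \<sigma>
      using dominant_minus_weyl[OF fund_weight_dominant, of "\<sigma> \<circ> \<tau>" k] W0_top_weyl[OF that t(1)]
      by (simp add: top_weyl_def)
    ultimately show ?thesis using t weight_lattice_weyl fund_weight_in_lattice by blast
  qed
  have "leading ?w ?f"
    unfolding leading_def
  proof (intro conjI exI[of _ ?qs])
    show "\<forall>x y. phi x = phi y \<longrightarrow> ?f x = ?f y" by simp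
    show "\<forall>x. ?f x = (\<Sum>q\<leftarrow>?qs. character q x)" using 1 by (rule allI)
    show "\<forall>q\<in>set ?qs. q \<in> weight_lattice \<and> q \<bullet> omega \<alpha> m = ?w \<bullet> omega \<alpha> m \<and> (\<forall>\<sigma>\<in>W0. ?w - \<sigma> q \<in> root_cone)"
      using 3 by (rule ballI)
  qed (rule 2)
  then show ?thesis by blast
qed

text \<open>The coordinate is a multiple of a single character, so its inverse is again a single
  character; \<open>W0\<close> fixes the weight, which makes the bound on its orbit trivial.\<close>

lemma leading_neg_fund_weight: assumes "m s > 0" shows "\<exists>f. leading (- fund_weight \<alpha> s) f"
proof -
  let ?w = "fund_weight \<alpha> s"
  let ?c = "of_nat (card (top_weyl s)) / of_nat (card (stab_weyl R ?w)) :: complex"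
  have "?c \<noteq> 0"
    using card_stab_pos[of ?w] finite_top_weyl[of s] id_in_top_weyl[of s] by auto
  then have f: "?c / phi x $ s = character (- ?w) x" for x
    unfolding phi_distinguished[OF assms] character_minus by simp
  have s: "\<forall>\<sigma>\<in>W0. - ?w - \<sigma> (- ?w) \<in> root_cone"
    using W0_fixes[OF assms] linear_neg[OF linear_weyl[OF W0_weyl], of _ ?w]
    by (metis diff_self root_cone_zero)
  have "- ?w \<in> weight_lattice" by (simp add: weight_lattice_def fund_weight_coroot)
  moreover have "?c / phi x $ s = ?c / phi y $ s" if "phi x = phi y" for x y using that by simp
  ultimately have "leading (- ?w) (\<lambda>x. ?c / phi x $ s)"
    unfolding leading_def using f
    by (intro conjI exI[of _ "[- ?w]"]) (simp_all add: s)
  then show ?thesis by blast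
qed

text \<open>A product of powers following the expansion in fundamental weights. A negative
  coefficient can occur only where \<open>m k > 0\<close>, which is where negative powers are
  available.\<close>

lemma leading_exists:
  assumes "p \<in> weight_lattice" "\<And>i. m i = 0 \<Longrightarrow> p \<bullet> coroot (\<alpha> i) \<ge> 0"
  shows "\<exists>f. leading p f"
proof -
  have one: "\<exists>f. leading ((p \<bullet> coroot (\<alpha> k)) *\<^sub>R fund_weight \<alpha> k) f" for k
  proof -
    obtain n where n: "p \<bullet> coroot (\<alpha> k) = of_int n" using assms(1) by (auto simp: weight_lattice_def elim: Ints_cases)
    show ?thesis
    proof (cases "n \<ge> 0")
      case True
      then have "p \<bullet> coroot (\<alpha> k) = of_nat (nat n)" using n by simp
      then show ?thesis using leading_fund_weight[of k] leading_power by metis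
    next
      case False
      then have "m k > 0" using assms(2)[of k] n by (cases "m k = 0") auto
      moreover have "(p \<bullet> coroot (\<alpha> k)) *\<^sub>R fund_weight \<alpha> k = of_nat (nat (- n)) *\<^sub>R (- fund_weight \<alpha> k)"
        using n False by simp
      ultimately show ?thesis using leading_neg_fund_weight[of k] leading_power by metis
    qed
  qed
  have "\<exists>f. leading (\<Sum>k\<in>A. (p \<bullet> coroot (\<alpha> k)) *\<^sub>R fund_weight \<alpha> k) f" if "finite A" for A
    using that
  proof (induction A rule: finite_induct)
    case empty
    then show ?case using leading_zero by auto
  next
    case (insert k A)
    then obtain f where "leading (\<Sum>k\<in>A. (p \<bullet> coroot (\<alpha> k)) *\<^sub>R fund_weight \<alpha> k) f" by blast
    moreover obtain g where "leading ((p \<bullet> coroot (\<alpha> k)) *\<^sub>R fund_weight \<alpha> k) g" using one by blast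
    ultimately show ?case using leading_mult insert.hyps by fastforce
  qed
  from this[of UNIV] show ?thesis using weight_expansion[of p] by simp
qed

text \<open>Take an orbit element of maximal height: a negative pairing with a simple coroot of the
  stabilizer would let the reflection raise the height.\<close>

lemma W0_dominant_conjugate:
  "\<exists>\<sigma>\<in>W0. \<forall>i. m i = 0 \<longrightarrow> \<sigma> q \<bullet> coroot (\<alpha> i) \<ge> 0"
proof -
  let ?S = "(\<lambda>\<sigma>. \<sigma> q \<bullet> rho_check) ` W0"
  have S: "finite ?S" "?S \<noteq> {}" using finite_W0 W0_facts(1) by auto
  obtain \<sigma> where s: "\<sigma> \<in> W0" "\<sigma> q \<bullet> rho_check = Max ?S" using Max_in[OF S] by auto
  have "\<sigma> q \<bullet> coroot (\<alpha> i) \<ge> 0" if "m i = 0" for i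
  proof -
    have "reflection (\<alpha> i) \<circ> \<sigma> \<in> W0" using W0_facts(3)[OF reflection_in_W0[OF that] s(1)] .
    then have "(reflection (\<alpha> i) \<circ> \<sigma>) q \<bullet> rho_check \<le> Max ?S"
      by (intro Max_ge[OF S(1)] image_eqI[of _ _ "reflection (\<alpha> i) \<circ> \<sigma>"]) auto
    then show ?thesis using s by (simp add: reflection_coroot inner_diff_left)
  qed
  then show ?thesis using s by blast
qed

text \<open>Makes the cardinality of these sets a measure for induction on the length.
  Cauchy-Schwarz bounds the integral coordinates.\<close>

lemma finite_short_weights: "finite {q \<in> weight_lattice. q \<bullet> q < c}"
proof (rule finite_subset)
  let ?B = "\<lambda>i. sqrt c * norm (coroot (\<alpha> i))"
  let ?h = "\<lambda>n. \<Sum>j\<in>UNIV. of_int (n j :: int) *\<^sub>R fund_weight \<alpha> j"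
  show "finite (?h ` (PiE UNIV (\<lambda>i. {- \<lceil>?B i\<rceil>..\<lceil>?B i\<rceil>})))"
    by (intro finite_imageI finite_PiE) auto
  show "{q \<in> weight_lattice. q \<bullet> q < c} \<subseteq> ?h ` (PiE UNIV (\<lambda>i. {- \<lceil>?B i\<rceil>..\<lceil>?B i\<rceil>}))"
  proof
    fix q assume q: "q \<in> {q \<in> weight_lattice. q \<bullet> q < c}"
    then have e: "of_int \<lfloor>q \<bullet> coroot (\<alpha> i)\<rfloor> = q \<bullet> coroot (\<alpha> i)" for i
      by (auto simp: weight_lattice_def elim: Ints_cases)
    have "\<bar>q \<bullet> coroot (\<alpha> i)\<bar> \<le> of_int \<lceil>?B i\<rceil>" for i
    proof -
      have "norm q \<le> sqrt c" using q by (simp add: norm_eq_sqrt_inner)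
      then have "norm q * norm (coroot (\<alpha> i)) \<le> ?B i" by (rule mult_right_mono) simp
      then show ?thesis
        using Cauchy_Schwarz_ineq2[of q "coroot (\<alpha> i)"] le_of_int_ceiling[of "?B i"] by linarith
    qed
    then have "\<lfloor>q \<bullet> coroot (\<alpha> i)\<rfloor> \<in> {- \<lceil>?B i\<rceil>..\<lceil>?B i\<rceil>}" for i
    proof -
      assume "\<And>i. \<bar>q \<bullet> coroot (\<alpha> i)\<bar> \<le> of_int \<lceil>?B i\<rceil>"
      then have "\<bar>of_int \<lfloor>q \<bullet> coroot (\<alpha> i)\<rfloor> :: real\<bar> \<le> of_int \<lceil>?B i\<rceil>" by (simp only: e)
      then have "\<bar>\<lfloor>q \<bullet> coroot (\<alpha> i)\<rfloor>\<bar> \<le> \<lceil>?B i\<rceil>" by (simp only: of_int_abs[symmetric] of_int_le_iff)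
      then show ?thesis by (auto simp: abs_le_iff)
    qed
    then show "q \<in> ?h ` (PiE UNIV (\<lambda>i. {- \<lceil>?B i\<rceil>..\<lceil>?B i\<rceil>}))"
    proof (intro image_eqI[of _ _ "\<lambda>i. \<lfloor>q \<bullet> coroot (\<alpha> i)\<rfloor>"])
      show "q = ?h (\<lambda>i. \<lfloor>q \<bullet> coroot (\<alpha> i)\<rfloor>)" unfolding e by (rule weight_expansion)
    qed auto
  qed
qed

section \<open>Orbit sums of the stabilizer and separation of orbits\<close>

definition W0_sum :: "'a \<Rightarrow> complex^'b \<Rightarrow> complex" where
  "W0_sum p x = (\<Sum>\<sigma>\<in>W0. character (\<sigma> p) x)"

lemma W0_sum_conjugate:
  assumes t: "\<tau> \<in> W0" shows "W0_sum (\<tau> p) x = W0_sum p x"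
  unfolding W0_sum_def
proof (rule sum.reindex_bij_witness[where i = "\<lambda>\<sigma>. \<sigma> \<circ> fun_inv \<tau>" and j = "\<lambda>\<sigma>. \<sigma> \<circ> \<tau>"])
  fix \<sigma> assume s: "\<sigma> \<in> W0"
  show "\<sigma> \<circ> \<tau> \<circ> fun_inv \<tau> = \<sigma>" "\<sigma> \<circ> fun_inv \<tau> \<circ> \<tau> = \<sigma>"
    using inv_weyl[OF W0_weyl[OF t]] by (auto simp: fun_eq_iff)
  show "\<sigma> \<circ> \<tau> \<in> W0" "\<sigma> \<circ> fun_inv \<tau> \<in> W0"
    using W0_facts(3)[OF s t] W0_facts(3)[OF s W0_facts(4)[OF t]] by blast+
qed simp

lemma W0_sum_inv: "(\<Sum>\<sigma>\<in>W0. h (fun_inv \<sigma>)) = (\<Sum>\<sigma>\<in>W0. h \<sigma>)"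
proof (rule sum.reindex_bij_witness[where i = fun_inv and j = fun_inv])
  fix \<sigma> assume s: "\<sigma> \<in> W0"
  show "fun_inv (fun_inv \<sigma>) = \<sigma>" "fun_inv (fun_inv \<sigma>) = \<sigma>"
    using inv_inv_eq[OF W0_facts(2)[OF s]] by blast+
  show "fun_inv \<sigma> \<in> W0" "fun_inv \<sigma> \<in> W0" using W0_facts(4)[OF s] by blast+
qed simp

text \<open>The weights below \<open>p\<close> are shorter than \<open>p\<close>, so the orbit sums are, by induction on the
  length, polynomials in the coordinates of \<open>phi\<close> and the inverses of those which have no zeros.\<close>

lemma W0_sum_phi:
  assumes "phi x = phi y" "p \<in> weight_lattice" shows "W0_sum p x = W0_sum p y"
  using assms(2)
proof (induction "card {q \<in> weight_lattice. q \<bullet> q < p \<bullet> p}" arbitrary: p rule: less_induct)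
  case less
  obtain \<sigma> where s: "\<sigma> \<in> W0" "\<And>i. m i = 0 \<Longrightarrow> \<sigma> p \<bullet> coroot (\<alpha> i) \<ge> 0"
    using W0_dominant_conjugate by blast
  let ?p = "\<sigma> p"
  have p: "?p \<in> weight_lattice" "?p \<bullet> ?p = p \<bullet> p"
    using less.prems weight_lattice_weyl W0_weyl[OF s(1)] inner_weyl_weyl by auto
  obtain f qs where f: "\<And>x y. phi x = phi y \<Longrightarrow> f x = f y"
    and q: "?p \<in> set qs" "\<And>x. f x = (\<Sum>q\<leftarrow>qs. character q x)"
      "\<And>q. q \<in> set qs \<Longrightarrow> q \<in> weight_lattice \<and> q \<bullet> omega \<alpha> m = ?p \<bullet> omega \<alpha> m \<and> (\<forall>\<sigma>\<in>W0. ?p - \<sigma> q \<in> root_cone)"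
    using leading_exists[OF p(1) s(2)] unfolding leading_def by metis
  \<comment> \<open>\<open>f\<close> factors through \<open>phi\<close> and is therefore invariant;
    averaging its expansion over \<open>W0\<close> turns characters into orbit sums.\<close>
  have avg: "of_nat (card W0) * f x = (\<Sum>q\<leftarrow>qs. W0_sum q x)" for x
  proof -
    have "f x = (\<Sum>q\<leftarrow>qs. character (fun_inv \<tau> q) x)" if "\<tau> \<in> W0" for \<tau>
    proof -
      have "(\<lambda>u. \<tau> u + 0) \<in> affine_maps W0" using that coroot_lattice_closed(1) by (intro affine_mapsI)
      then have "f x = f (affine_ext \<alpha> (\<lambda>u. \<tau> u + 0) x)" by (intro f phi_invariant[symmetric])
      also have "\<dots> = (\<Sum>q\<leftarrow>qs. character (fun_inv \<tau> q) x)"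
        unfolding q(2)
        using character_affine[OF W0_weyl[OF that] coroot_lattice_closed(1)] q(3)
        by (intro arg_cong[of _ _ sum_list] map_cong) auto
      finally show ?thesis .
    qed
    then have "(\<Sum>\<tau>\<in>W0. f x) = (\<Sum>\<tau>\<in>W0. \<Sum>q\<leftarrow>qs. character (fun_inv \<tau> q) x)" by (intro sum.cong) auto
    also have "\<dots> = (\<Sum>\<tau>\<in>W0. \<Sum>q\<leftarrow>qs. character (\<tau> q) x)"
      by (rule W0_sum_inv)
    also have "\<dots> = (\<Sum>q\<leftarrow>qs. W0_sum q x)"
      unfolding W0_sum_def by (induction qs) (simp_all add: sum.distrib)
    finally show ?thesis by simp
  qed
  \<comment> \<open>The dominant conjugate of \<open>q\<close> lies below \<open>?p\<close> and
    differs from it by simple roots of the stabilizer. It either equals \<open>?p\<close> or is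
    shorter, and then the induction hypothesis applies.\<close>
  have cases: "(\<forall>u. W0_sum q u = W0_sum ?p u) \<or> W0_sum q x = W0_sum q y" if "q \<in> set qs" for q
  proof -
    obtain \<tau> where t: "\<tau> \<in> W0" "\<And>i. m i = 0 \<Longrightarrow> \<tau> q \<bullet> coroot (\<alpha> i) \<ge> 0"
      using W0_dominant_conjugate by blast
    have "\<tau> q = ?p \<or> \<tau> q \<bullet> \<tau> q < ?p \<bullet> ?p"
      using shorter_weight[of "\<tau> q" ?p] t q(3)[OF that] W0_omega[OF t(1), of q] by (simp add: inner_diff_left)
    then show ?thesis
    proof
      assume "\<tau> q = ?p"
      then show ?thesis using W0_sum_conjugate[OF t(1)] by metis
    next
      assume "\<tau> q \<bullet> \<tau> q < ?p \<bullet> ?p"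
      then have lt: "q \<bullet> q < p \<bullet> p" using p inner_weyl_weyl[OF W0_weyl[OF t(1)]] by simp
      then have "{r \<in> weight_lattice. r \<bullet> r < q \<bullet> q} \<subset> {r \<in> weight_lattice. r \<bullet> r < p \<bullet> p}"
        using q(3)[OF that] by fastforce
      then have "card {r \<in> weight_lattice. r \<bullet> r < q \<bullet> q} < card {r \<in> weight_lattice. r \<bullet> r < p \<bullet> p}"
        by (intro psubset_card_mono finite_short_weights)
      then show ?thesis using less.hyps q(3)[OF that] by blast
    qed
  qed
  \<comment> \<open>\<open>N\<close> counts the weights in the list whose orbit sum is that of
    \<open>?p\<close>; all others contribute equally at \<open>x\<close> and \<open>y\<close>. As
    \<open>?p\<close> itself is in \<open>qs\<close>, the factor \<open>N\<close> can be divided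
    out.\<close>
  have "\<exists>N. (N > 0 \<longleftrightarrow> (\<exists>r\<in>set rs. \<forall>u. W0_sum r u = W0_sum ?p u)) \<and>
    (\<Sum>q\<leftarrow>rs. W0_sum q x) - (\<Sum>q\<leftarrow>rs. W0_sum q y) = of_nat N * (W0_sum ?p x - W0_sum ?p y)"
    if "set rs \<subseteq> set qs" for rs
    using that
  proof (induction rs)
    case Nil
    show ?case by (intro exI[of _ 0]) simp
  next
    case (Cons r rs)
    then obtain N where N: "N > 0 \<longleftrightarrow> (\<exists>r\<in>set rs. \<forall>u. W0_sum r u = W0_sum ?p u)"
      "(\<Sum>q\<leftarrow>rs. W0_sum q x) - (\<Sum>q\<leftarrow>rs. W0_sum q y) = of_nat N * (W0_sum ?p x - W0_sum ?p y)" by auto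
    show ?case
    proof (cases "\<forall>u. W0_sum r u = W0_sum ?p u")
      case True
      then show ?thesis using N(2) by (intro exI[of _ "Suc N"]) (auto simp: algebra_simps)
    next
      case False
      then have "W0_sum r x = W0_sum r y" using cases Cons.prems by auto
      then show ?thesis using N False by (intro exI[of _ N]) auto
    qed
  qed
  from this[of qs] q(1) obtain N where "N > 0"
    "(\<Sum>q\<leftarrow>qs. W0_sum q x) - (\<Sum>q\<leftarrow>qs. W0_sum q y) = of_nat N * (W0_sum ?p x - W0_sum ?p y)" by auto
  then have "W0_sum ?p x = W0_sum ?p y" using avg[of x] avg[of y] f[OF assms(1)] by auto
  then show ?case using W0_sum_conjugate[OF s(1)] by simp
qed

text \<open>Linear independence of characters: a product of functions \<open>character p - const\<close> vanishes at all
  the points \<open>a i\<close> and \<open>c i\<close> except those which no character distinguishes from \<open>c j\<close>.\<close>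

lemma character_separates:
  assumes eq: "\<And>p. p \<in> weight_lattice \<Longrightarrow> (\<Sum>i\<in>I. character p (a i)) = (\<Sum>i\<in>I. character p (c i))"
    and I: "finite I" "j \<in> I"
  shows "\<exists>i\<in>I. \<forall>p\<in>weight_lattice. character p (a i) = character p (c j)"
proof (rule ccontr)
  assume neg: "\<not> ?thesis"
  define T where "T = {u \<in> a ` I \<union> c ` I. \<exists>p\<in>weight_lattice. character p u \<noteq> character p (c j)}"
  have "finite T" using I by (simp add: T_def)
  have "\<forall>u\<in>T. \<exists>p\<in>weight_lattice. character p u \<noteq> character p (c j)" unfolding T_def by blast
  then obtain P where P: "\<And>u. u \<in> T \<Longrightarrow> P u \<in> weight_lattice"
    "\<And>u. u \<in> T \<Longrightarrow> character (P u) u \<noteq> character (P u) (c j)" by metis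
  define F where "F S v = (\<Prod>u\<in>S. character (P u) v - character (P u) u)" for S v
  \<comment> \<open>Multiplying by a factor \<open>character (P u) - const\<close> stays within
    combinations of characters of weights, so the assumed equality of sums is inherited.\<close>
  have main: "(\<Sum>i\<in>I. F S (a i) * character p (a i)) = (\<Sum>i\<in>I. F S (c i) * character p (c i))"
    if "finite S" "S \<subseteq> T" "p \<in> weight_lattice" for S p
    using that
  proof (induction S arbitrary: p rule: finite_induct)
    case empty
    then show ?case using eq by (simp add: F_def)
  next
    case (insert u S)
    have step: "F (insert u S) v * character p v =
        F S v * character (P u + p) v - character (P u) u * (F S v * character p v)" for v
      using insert.hyps by (simp add: F_def character_add algebra_simps)
    have "P u + p \<in> weight_lattice" using insert.prems P weight_lattice_add by blast
    then show ?case
      unfolding step sum_subtractf sum_distrib_left[symmetric] using insert.IH insert.prems by simp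
  qed
  have "F T (a i) = 0" if "i \<in> I" for i
  proof -
    have "a i \<in> T" using neg that by (auto simp: T_def)
    then show ?thesis using \<open>finite T\<close> by (auto simp: F_def)
  qed
  moreover have "F T (c i) = (if c i \<in> T then 0 else F T (c j))" if "i \<in> I" for i
  proof (cases "c i \<in> T")
    case True
    then show ?thesis using \<open>finite T\<close> by (auto simp: F_def)
  next
    case False
    then show ?thesis using that P by (auto simp: F_def T_def intro!: prod.cong)
  qed
  \<comment> \<open>By the assumption to be refuted every \<open>a i\<close> lies in
    \<open>T\<close>. On the other side only the points not distinguished from \<open>c j\<close>
    remain, and \<open>j\<close> is one of their indices.\<close>
  ultimately have "0 = (\<Sum>i\<in>I. if c i \<in> T then 0 else F T (c j))"
    using main[OF \<open>finite T\<close>, of 0] by (simp add: weight_lattice_def)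
  also have "\<dots> = of_nat (card {i \<in> I. c i \<notin> T}) * F T (c j)"
    using I by (simp add: sum.If_cases Int_def)
  finally have "card {i \<in> I. c i \<notin> T} = 0 \<or> F T (c j) = 0" by auto
  moreover have "F T (c j) \<noteq> 0"
    using \<open>finite T\<close> P(2)[THEN not_sym] unfolding F_def by (simp add: prod_zero_iff)
  moreover have "j \<in> {i \<in> I. c i \<notin> T}" using I by (auto simp: T_def)
  ultimately show False using I by auto
qed

text \<open>Equal orbit sums mean that all characters have equal sums over the
  \<open>W0\<close>-orbits of \<open>x\<close> and \<open>y\<close>, so some
  \<open>\<sigma> x\<close> has the same characters as \<open>y\<close>. The characters of the
  fundamental weights show that the coordinates then differ by integers, that is, by a vector of the
  coroot lattice.\<close>

theorem phi_fibre:
  assumes "phi x = phi y" shows "\<exists>\<phi>\<in>affine_maps W0. y = affine_ext \<alpha> \<phi> x"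
proof -
  let ?a = "\<lambda>\<sigma>. affine_ext \<alpha> (\<lambda>u. \<sigma> u + 0)"
  have sum: "(\<Sum>\<sigma>\<in>W0. character p (?a \<sigma> x)) = W0_sum p x" if "p \<in> weight_lattice" for p x
  proof -
    have "(\<Sum>\<sigma>\<in>W0. character p (?a \<sigma> x)) = (\<Sum>\<sigma>\<in>W0. character (fun_inv \<sigma> p) x)"
      by (intro sum.cong refl character_affine[OF W0_weyl coroot_lattice_closed(1) that])
    then show ?thesis unfolding W0_sum_def using W0_sum_inv[of "\<lambda>\<sigma>. character (\<sigma> p) x"] by simp
  qed
  have "\<exists>\<sigma>\<in>W0. \<forall>p\<in>weight_lattice. character p (?a \<sigma> x) = character p (?a id y)"
    by (rule character_separates[OF _ finite_W0 W0_facts(1)]) (simp only: sum W0_sum_phi[OF assms])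
  then obtain \<sigma> where s: "\<sigma> \<in> W0" "\<And>p. p \<in> weight_lattice \<Longrightarrow> character p (?a \<sigma> x) = character p y"
    using affine_ext_id[of y] by (auto simp: id_def)
  let ?d = "y - ?a \<sigma> x"
  have "\<exists>n. ?d $ k = of_int n" for k
  proof -
    have "character (fund_weight \<alpha> k) y = character (fund_weight \<alpha> k) (?a \<sigma> x)"
      using s(2)[OF fund_weight_in_lattice] by simp
    then obtain n where "2 * of_real pi * \<i> * y $ k = 2 * of_real pi * \<i> * ?a \<sigma> x $ k + (of_int (2 * n) * pi) * \<i>"
      unfolding character_def cpairing_fund_weight exp_eq by blast
    then have "2 * of_real pi * \<i> * (y $ k - ?a \<sigma> x $ k) = 2 * of_real pi * \<i> * of_int n"
      by (simp add: algebra_simps)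
    then show ?thesis by auto
  qed
  then obtain n where n: "\<And>k. ?d $ k = of_int (n k)" by metis
  define t where "t = (\<Sum>k\<in>UNIV. of_int (n k) *\<^sub>R coroot (\<alpha> k))"
  have t: "t \<in> coroot_lattice \<alpha>" unfolding t_def coroot_lattice_def by blast
  have "y $ k = affine_ext \<alpha> (\<lambda>u. \<sigma> u + t) x $ k" for k
  proof -
    have "fund_weight \<alpha> k \<bullet> t = of_int (n k)"
      by (simp add: t_def inner_sum_right fund_weight_coroot if_distrib cong: if_cong)
    then have "cpairing \<alpha> (fund_weight \<alpha> k) (affine_ext \<alpha> (\<lambda>u. \<sigma> u + t) x) =
        cpairing \<alpha> (fund_weight \<alpha> k) (?a \<sigma> x) + of_int (n k)"
      unfolding cpairing_affine_ext[OF W0_weyl[OF s(1)]] by simp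
    then show ?thesis using n[of k] by (simp add: cpairing_fund_weight algebra_simps)
  qed
  then have "y = affine_ext \<alpha> (\<lambda>u. \<sigma> u + t) x" by (simp add: vec_eq_iff)
  then show ?thesis using affine_mapsI[OF s(1) t] by blast
qed

end

section \<open>Holomorphic functions of several variables\<close>

text \<open>Complex differentiability at a point: additivity is part of the real derivative, and
  complex homogeneity is added.\<close>

definition holo_at :: "(complex^'n::finite \<Rightarrow> complex) \<Rightarrow> complex^'n \<Rightarrow> bool" where
  "holo_at f z \<longleftrightarrow> (\<exists>f'. (f has_derivative f') (at z) \<and> (\<forall>c u. f' (c *s u) = c * f' u))"

lemma holomorphic_mv_holo_at: "holomorphic_mv f S \<longleftrightarrow> (\<forall>z\<in>S. holo_at f z)"
  by (simp add: holomorphic_mv_def holo_at_def)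

lemma holo_atI: "(f has_derivative f') (at z) \<Longrightarrow> (\<And>c u. f' (c *s u) = c * f' u) \<Longrightarrow> holo_at f z"
  unfolding holo_at_def by blast

lemma bounded_linear_axis: "bounded_linear (axis i :: complex \<Rightarrow> complex^'n::finite)"
  unfolding linear_conv_bounded_linear[symmetric]
  by (rule linearI) (auto simp: vec_eq_iff axis_def)

lemma axis_zero: "axis i (0::complex) = 0"
  by (auto simp: vec_eq_iff axis_def)

lemma axis_scale: "axis i t = t *s axis i (1::complex)"
  by (auto simp: vec_eq_iff axis_def)

lemma axis_expansion: "u = (\<Sum>i\<in>UNIV. (u $ i) *s axis i (1::complex))"
  by (simp add: vec_eq_iff axis_def if_distrib[of "\<lambda>x. _ * x"] cong: if_cong)

lemma norm_axis_complex: "norm (axis i (t::complex)) = norm t"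
proof -
  have "(\<lambda>j. norm (axis i t $ j)) = (\<lambda>j. if j = i then norm t else 0)" by (auto simp: axis_def)
  then show ?thesis by (simp add: norm_vec_def L2_set_def if_distrib[of "\<lambda>x. x\<^sup>2"] cong: if_cong)
qed

lemma complex_linear_expansion:
  fixes f' :: "complex^'n::finite \<Rightarrow> complex"
  assumes "linear f'" "\<And>c u. f' (c *s u) = c * f' u"
  shows "f' u = (\<Sum>i\<in>UNIV. u $ i * f' (axis i 1))"
proof -
  have "f' u = f' (\<Sum>i\<in>UNIV. (u $ i) *s axis i 1)" using axis_expansion[of u] by simp
  also have "\<dots> = (\<Sum>i\<in>UNIV. f' ((u $ i) *s axis i 1))" by (rule linear_sum[OF assms(1)])
  finally show ?thesis by (simp only: assms(2))
qed

lemma pd_eqI: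
  fixes f :: "complex^'n::finite \<Rightarrow> complex"
  assumes "(f has_derivative f') (at z)" "\<And>c u. f' (c *s u) = c * f' u"
  shows "((\<lambda>t. f (z + axis i t)) has_field_derivative f' (axis i 1)) (at 0)" "pd i f z = f' (axis i 1)"
proof -
  have "((\<lambda>t. z + axis i t) has_derivative (\<lambda>t. axis i t)) (at (0::complex))"
    by (auto intro!: derivative_eq_intros bounded_linear.has_derivative[OF bounded_linear_axis])
  moreover have "(f has_derivative f') (at (z + axis i 0))" using assms(1) by (simp add: axis_zero)
  ultimately have "((\<lambda>t. f (z + axis i t)) has_derivative (\<lambda>t. f' (axis i t))) (at 0)"
    by (rule has_derivative_compose)
  moreover have "f' (axis i t) = f' (axis i 1) * t" for t
    using assms(2)[of t "axis i 1"] by (simp only: axis_scale[symmetric] mult.commute)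
  then have "(\<lambda>t. f' (axis i t)) = (*) (f' (axis i 1))" by (rule ext)
  ultimately show *: "((\<lambda>t. f (z + axis i t)) has_field_derivative f' (axis i 1)) (at 0)"
    by (simp add: has_field_derivative_def)
  show "pd i f z = f' (axis i 1)" unfolding pd_def by (rule DERIV_imp_deriv[OF *])
qed

lemma holo_at_derivative:
  assumes "holo_at f z" shows "(f has_derivative (\<lambda>u. \<Sum>i\<in>UNIV. u $ i * pd i f z)) (at z)"
proof -
  obtain f' where f: "(f has_derivative f') (at z)" "\<And>c u. f' (c *s u) = c * f' u"
    using assms unfolding holo_at_def by blast
  have "linear f'" using f(1) has_derivative_linear by blast
  then have "f' = (\<lambda>u. \<Sum>i\<in>UNIV. u $ i * pd i f z)"
    unfolding pd_eqI(2)[OF f] by (intro ext complex_linear_expansion f(2))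
  then show ?thesis using f(1) by (simp only:)
qed

text \<open>The source of the rules for \<open>pd\<close>: a real derivative is written as a complex
  linear form in the increment and its coefficients are read off.\<close>

lemma pd_derivative_unique:
  fixes f :: "complex^'n::finite \<Rightarrow> complex"
  assumes "(f has_derivative (\<lambda>u. \<Sum>i\<in>UNIV. u $ i * a i)) (at z)"
  shows "holo_at f z" "pd k f z = a k"
proof -
  have lin: "(\<Sum>i\<in>UNIV. (c *s u) $ i * a i) = c * (\<Sum>i\<in>UNIV. u $ i * a i)" for c u
    by (simp add: sum_distrib_left mult.assoc)
  show "holo_at f z" by (rule holo_atI[OF assms lin])
  have "pd k f z = (\<Sum>i\<in>UNIV. axis k 1 $ i * a i)" by (rule pd_eqI(2)[OF assms lin])
  also have "\<dots> = (\<Sum>i\<in>UNIV. if i = k then a i else 0)" by (intro sum.cong) (auto simp: axis_def)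
  finally show "pd k f z = a k" by simp
qed

section \<open>Rules for partial derivatives\<close>

lemma holo_at_const: "holo_at (\<lambda>x. c) z" and pd_const: "pd k (\<lambda>x. c) z = 0"
  using pd_derivative_unique[of "\<lambda>x. c" "\<lambda>_. 0" z] by simp_all

lemma holo_at_nth: "holo_at (\<lambda>x. x $ j) z" and pd_nth: "pd k (\<lambda>x. x $ j) z = (if k = j then 1 else 0)"
proof -
  have "(\<lambda>u::complex^'a. \<Sum>i\<in>UNIV. u $ i * (if i = j then 1 else 0)) = (\<lambda>u. u $ j)"
    by (simp add: fun_eq_iff if_distrib[of "\<lambda>x. _ * x"] cong: if_cong)
  moreover have "((\<lambda>x. x $ j) has_derivative (\<lambda>u. u $ j)) (at z)"
    by (rule bounded_linear.has_derivative[OF bounded_linear_vec_nth has_derivative_ident])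
  ultimately have "((\<lambda>x. x $ j) has_derivative (\<lambda>u::complex^'a. \<Sum>i\<in>UNIV. u $ i * (if i = j then 1 else 0))) (at z)"
    by simp
  from pd_derivative_unique[OF this] show "holo_at (\<lambda>x. x $ j) z" "pd k (\<lambda>x. x $ j) z = (if k = j then 1 else 0)" by auto
qed

lemma assumes "holo_at f z" "holo_at g z"
  shows holo_at_add: "holo_at (\<lambda>x. f x + g x) z" and pd_add: "pd k (\<lambda>x. f x + g x) z = pd k f z + pd k g z"
    and holo_at_diff: "holo_at (\<lambda>x. f x - g x) z" and pd_diff: "pd k (\<lambda>x. f x - g x) z = pd k f z - pd k g z"
    and holo_at_mult: "holo_at (\<lambda>x. f x * g x) z" and pd_mult: "pd k (\<lambda>x. f x * g x) z = pd k f z * g z + f z * pd k g z"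
proof -
  note fg = holo_at_derivative[OF assms(1)] holo_at_derivative[OF assms(2)]
  have "((\<lambda>x. f x + g x) has_derivative (\<lambda>u. \<Sum>i\<in>UNIV. u $ i * (pd i f z + pd i g z))) (at z)"
    using has_derivative_add[OF fg] by (simp add: distrib_left sum.distrib)
  from pd_derivative_unique[OF this] show "holo_at (\<lambda>x. f x + g x) z" "pd k (\<lambda>x. f x + g x) z = pd k f z + pd k g z" by auto
  have "((\<lambda>x. f x - g x) has_derivative (\<lambda>u. \<Sum>i\<in>UNIV. u $ i * (pd i f z - pd i g z))) (at z)"
    using has_derivative_diff[OF fg] by (simp add: right_diff_distrib sum_subtractf)
  from pd_derivative_unique[OF this] show "holo_at (\<lambda>x. f x - g x) z" "pd k (\<lambda>x. f x - g x) z = pd k f z - pd k g z" by auto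
  have "((\<lambda>x. f x * g x) has_derivative (\<lambda>u. \<Sum>i\<in>UNIV. u $ i * (pd i f z * g z + f z * pd i g z))) (at z)"
    using has_derivative_mult[OF fg]
    by (simp add: distrib_left sum.distrib sum_distrib_left sum_distrib_right mult_ac add.commute)
  from pd_derivative_unique[OF this] show "holo_at (\<lambda>x. f x * g x) z"
    "pd k (\<lambda>x. f x * g x) z = pd k f z * g z + f z * pd k g z" by auto
qed

lemma holo_at_cmult: "holo_at f z \<Longrightarrow> holo_at (\<lambda>x. c * f x) z"
  and pd_cmult: "holo_at f z \<Longrightarrow> pd k (\<lambda>x. c * f x) z = c * pd k f z"
  using holo_at_mult[OF holo_at_const] pd_mult[OF holo_at_const] by (auto simp: pd_const)

lemma holo_at_sum_pd:
  assumes "finite A" "\<And>a. a \<in> A \<Longrightarrow> holo_at (f a) z"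
  shows "holo_at (\<lambda>x. \<Sum>a\<in>A. f a x) z \<and> pd k (\<lambda>x. \<Sum>a\<in>A. f a x) z = (\<Sum>a\<in>A. pd k (f a) z)"
  using assms by (induction A rule: finite_induct) (auto simp: holo_at_const pd_const holo_at_add pd_add)

lemmas holo_at_sum = conjunct1[OF holo_at_sum_pd] and pd_sum = conjunct2[OF holo_at_sum_pd]

lemma holo_at_prod: "finite A \<Longrightarrow> (\<And>a. a \<in> A \<Longrightarrow> holo_at (f a) z) \<Longrightarrow> holo_at (\<lambda>x. \<Prod>a\<in>A. f a x) z"
  by (induction A rule: finite_induct) (auto simp: holo_at_const holo_at_mult)

lemma holo_at_power: "holo_at f z \<Longrightarrow> holo_at (\<lambda>x. f x ^ n) z"
  by (induction n) (auto simp: holo_at_const holo_at_mult)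

lemma
  assumes "holo_at f z" "(h has_field_derivative h') (at (f z))"
  shows holo_at_field_compose: "holo_at (\<lambda>x. h (f x)) z"
    and pd_field_compose: "pd k (\<lambda>x. h (f x)) z = h' * pd k f z"
proof -
  have "((\<lambda>x. h (f x)) has_derivative (\<lambda>u. h' * (\<Sum>i\<in>UNIV. u $ i * pd i f z))) (at z)"
    using has_derivative_compose[OF holo_at_derivative[OF assms(1)]] assms(2)
    by (simp add: has_field_derivative_def)
  then have "((\<lambda>x. h (f x)) has_derivative (\<lambda>u. \<Sum>i\<in>UNIV. u $ i * (h' * pd i f z))) (at z)"
    by (simp add: sum_distrib_left mult_ac)
  from pd_derivative_unique[OF this] show "holo_at (\<lambda>x. h (f x)) z" "pd k (\<lambda>x. h (f x)) z = h' * pd k f z" by auto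
qed

lemma holo_at_divide:
  assumes "holo_at f z" "holo_at g z" "g z \<noteq> 0" shows "holo_at (\<lambda>x. f x / g x) z"
proof -
  have "holo_at (\<lambda>x. inverse (g x)) z"
    using assms by (intro holo_at_field_compose[OF assms(2) DERIV_inverse]) auto
  then show ?thesis using holo_at_mult[OF assms(1)] by (simp add: divide_inverse)
qed

lemma has_derivative_vecI:
  fixes F :: "'a::real_normed_vector \<Rightarrow> complex^'n::finite"
  assumes "\<And>i. ((\<lambda>x. F x $ i) has_derivative (\<lambda>u. F' u $ i)) (at z)"
  shows "(F has_derivative F') (at z)"
proof -
  have e: "w = (\<Sum>i\<in>UNIV. axis i (w $ i))" for w :: "complex^'n"
    by (simp add: vec_eq_iff axis_def cong: if_cong)
  have "((\<lambda>x. \<Sum>i\<in>UNIV. axis i (F x $ i)) has_derivative (\<lambda>u. \<Sum>i\<in>UNIV. axis i (F' u $ i))) (at z)"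
    by (intro has_derivative_sum bounded_linear.has_derivative[OF bounded_linear_axis] assms)
  then show ?thesis by (simp only: e[symmetric])
qed

lemma
  fixes F :: "complex^'m::finite \<Rightarrow> complex^'n::finite"
  assumes "holo_at f (F z)" "\<And>j. holo_at (\<lambda>x. F x $ j) z"
  shows holo_at_compose: "holo_at (\<lambda>x. f (F x)) z"
    and pd_compose: "pd r (\<lambda>x. f (F x)) z = (\<Sum>j\<in>UNIV. pd j f (F z) * pd r (\<lambda>x. F x $ j) z)"
proof -
  have "(F has_derivative (\<lambda>u. \<chi> j. \<Sum>i\<in>UNIV. u $ i * pd i (\<lambda>x. F x $ j) z)) (at z)"
    by (rule has_derivative_vecI) (simp add: holo_at_derivative assms)
  from has_derivative_compose[OF this holo_at_derivative[OF assms(1)]]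
  have "((\<lambda>x. f (F x)) has_derivative
      (\<lambda>u. \<Sum>j\<in>UNIV. (\<Sum>i\<in>UNIV. u $ i * pd i (\<lambda>x. F x $ j) z) * pd j f (F z))) (at z)" by simp
  moreover have "(\<Sum>j\<in>UNIV. (\<Sum>i\<in>UNIV. u $ i * pd i (\<lambda>x. F x $ j) z) * pd j f (F z)) =
      (\<Sum>i\<in>UNIV. u $ i * (\<Sum>j\<in>UNIV. pd j f (F z) * pd i (\<lambda>x. F x $ j) z))" for u :: "complex^'m"
    unfolding sum_distrib_right sum_distrib_left by (subst sum.swap) (simp add: mult_ac)
  ultimately have "((\<lambda>x. f (F x)) has_derivative
      (\<lambda>u. \<Sum>i\<in>UNIV. u $ i * (\<Sum>j\<in>UNIV. pd j f (F z) * pd i (\<lambda>x. F x $ j) z))) (at z)" by simp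
  from pd_derivative_unique[OF this] show "holo_at (\<lambda>x. f (F x)) z"
    "pd r (\<lambda>x. f (F x)) z = (\<Sum>j\<in>UNIV. pd j f (F z) * pd r (\<lambda>x. F x $ j) z)" by auto
qed

lemma holo_at_continuous: "holo_at f z \<Longrightarrow> isCont f z"
  unfolding holo_at_def using has_derivative_continuous by blast

lemma holo_at_cong:
  assumes "open U" "z \<in> U" "\<And>x. x \<in> U \<Longrightarrow> f x = g x"
  shows "holo_at f z \<Longrightarrow> holo_at g z"
  unfolding holo_at_def using has_derivative_transform_within_open[where f = f and g = g, OF _ assms(1,2)] assms(3) by blast

lemma pd_cong:
  assumes "open U" "z \<in> U" "\<And>x. x \<in> U \<Longrightarrow> f x = g x"
  shows "pd i f z = pd i g z"
  unfolding pd_def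
proof (rule deriv_cong_ev[OF _ refl])
  have "((\<lambda>t. z + axis i t) \<longlongrightarrow> z + axis i 0) (nhds (0::complex))"
    by (intro tendsto_intros bounded_linear.tendsto[OF bounded_linear_axis]) (simp add: filterlim_ident)
  moreover have "z + axis i 0 \<in> U" using assms(2) by (simp add: axis_zero)
  ultimately have "\<forall>\<^sub>F t in nhds 0. z + axis i t \<in> U" using topological_tendstoD assms(1) by blast
  then show "\<forall>\<^sub>F t in nhds 0. f (z + axis i t) = g (z + axis i t)"
    by (rule eventually_mono) (use assms(3) in auto)
qed

lemma holo_at_line:
  assumes "holo_at f (a + t *s u)"
  shows "(\<lambda>t. f (a + t *s u)) field_differentiable (at t)"
proof -
  obtain f' where f: "(f has_derivative f') (at (a + t *s u))" "\<And>c u. f' (c *s u) = c * f' u"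
    using assms unfolding holo_at_def by blast
  have "((\<lambda>t. a + t *s u) has_derivative (\<lambda>h. h *s u)) (at t)"
    by (rule has_derivative_vecI) (auto intro!: derivative_eq_intros)
  from has_derivative_compose[OF this f(1)]
  have "((\<lambda>t. f (a + t *s u)) has_derivative (\<lambda>h. h * f' u)) (at t)" by (simp only: f(2))
  moreover have "(\<lambda>h. h * f' u) = (*) (f' u)" by (simp add: fun_eq_iff mult.commute)
  ultimately show ?thesis by (auto simp: field_differentiable_def has_field_derivative_def)
qed

text \<open>Cauchy's formula on a circle in the \<open>i\<close>-th coordinate direction. The
  derivative of the parametrization cancels the constant and one power of the denominator.\<close>

lemma pd_integral:
  assumes hol: "\<And>w. w \<in> ball z e \<Longrightarrow> holo_at f w" and r: "0 < r" "r < e"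
  shows "pd i f z = integral {0..1} (\<lambda>t. f (z + axis i (of_real r * exp (2 * of_real pi * \<i> * of_real t))) /
           (of_real r * exp (2 * of_real pi * \<i> * of_real t)))"
proof -
  let ?g = "\<lambda>\<zeta>. f (z + axis i \<zeta>)"
  have d: "?g field_differentiable (at \<zeta>)" if "norm \<zeta> < e" for \<zeta>
  proof -
    have "z + \<zeta> *s axis i 1 \<in> ball z e"
      using that by (simp add: axis_scale[symmetric] dist_norm norm_axis_complex)
    from holo_at_line[OF hol[OF this]] show ?thesis by (simp only: axis_scale[symmetric])
  qed
  have "continuous_on (cball 0 r) ?g"
    by (intro continuous_at_imp_continuous_on ballI field_differentiable_imp_continuous_at d) (use r in auto)
  moreover have "?g holomorphic_on ball 0 r"
    unfolding holomorphic_on_def using d r by (auto intro: field_differentiable_at_within)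
  ultimately have "(?g has_field_derivative
      (1 / (2 * of_real pi * \<i>) * contour_integral (circlepath 0 r) (\<lambda>u. ?g u / (u - 0)^2))) (at 0)"
    using r by (intro Cauchy_derivative_integral_circlepath) auto
  then have "pd i f z = 1 / (2 * of_real pi * \<i>) * contour_integral (circlepath 0 r) (\<lambda>u. ?g u / (u - 0)^2)"
    unfolding pd_def by (rule DERIV_imp_deriv)
  also have "\<dots> = integral {0..1} (\<lambda>t. 1 / (2 * of_real pi * \<i>) * (?g (circlepath 0 r t) / (circlepath 0 r t)^2 *
      vector_derivative (circlepath 0 r) (at t)))"
    unfolding contour_integral_integral by (simp only: integral_mult_right diff_zero)
  also have "\<dots> = integral {0..1} (\<lambda>t. f (z + axis i (of_real r * exp (2 * of_real pi * \<i> * of_real t))) /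
           (of_real r * exp (2 * of_real pi * \<i> * of_real t)))"
    using r unfolding vector_derivative_circlepath
    by (intro integral_cong) (simp add: circlepath power2_eq_square)
  finally show ?thesis .
qed

text \<open>One contour \<open>k\<close> serves all points near \<open>z0\<close>, so the parameter
  enters the integrand only through \<open>f\<close> and the integral can be differentiated in
  it.\<close>

lemma pd_integral_local:
  assumes S: "open S" "\<forall>w\<in>S. holo_at f w" and z0: "z0 \<in> S"
  shows "\<exists>U (k :: real \<Rightarrow> complex). open U \<and> convex U \<and> z0 \<in> U \<and> (\<forall>t. k t \<noteq> 0) \<and> (\<forall>A. continuous_on A k) \<and>
    (\<forall>z\<in>U. \<forall>t. z + axis i (k t) \<in> S) \<and>
    (\<forall>z\<in>U. pd i f z = integral (cbox 0 1) (\<lambda>t. f (z + axis i (k t)) / k t))"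
proof -
  obtain e where e: "e > 0" "ball z0 e \<subseteq> S" using S(1) z0 openE by blast
  \<comment> \<open>A radius below \<open>e/2\<close>, around centres at distance below
    \<open>e/2\<close> from \<open>z0\<close>, stays inside the ball of radius
    \<open>e\<close>.\<close>
  let ?k = "\<lambda>t. of_real (e/4) * exp (2 * of_real pi * \<i> * of_real t) :: complex"
  show ?thesis
  proof (intro exI[of _ "ball z0 (e/2)"] exI[of _ ?k] conjI allI ballI)
    fix z assume z: "z \<in> ball z0 (e/2)"
    show "z + axis i (?k t) \<in> S" for t
    proof -
      have "dist z (z + axis i (?k t)) = e/4" using e by (simp add: dist_norm norm_axis_complex norm_mult)
      moreover have "dist z0 z < e/2" using z by simp
      ultimately have "dist z0 (z + axis i (?k t)) < e"
        using dist_triangle[of z0 "z + axis i (?k t)" z] e by linarith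
      then show ?thesis using e by auto
    qed
    show "pd i f z = integral (cbox 0 1) (\<lambda>t. f (z + axis i (?k t)) / ?k t)"
    proof -
      have "holo_at f w" if "w \<in> ball z (e/2)" for w
      proof -
        have "dist z0 w < e" using that z dist_triangle[of z0 w z] by simp
        then show ?thesis using e S(2) by auto
      qed
      then show ?thesis using e pd_integral[of z "e/2" f "e/4" i] by simp
    qed
  qed (use e in \<open>auto intro!: continuous_intros\<close>)
qed

text \<open>Integrals over a fixed contour depend continuously on the parameter. The result prepares
  the Leibniz rule in \<open>holo_at_pd\<close>.\<close>

lemma continuous_pd:
  assumes "open S" "\<And>w. w \<in> S \<Longrightarrow> holo_at f w" shows "continuous_on S (pd i f)"
proof (rule continuous_at_imp_continuous_on, rule ballI)
  fix z0 assume "z0 \<in> S"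
  have ball: "\<forall>w\<in>S. holo_at f w" using assms(2) by (rule ballI)
  obtain U and k :: "real \<Rightarrow> complex" where ex: "open U \<and> convex U \<and> z0 \<in> U \<and> (\<forall>t. k t \<noteq> 0) \<and> (\<forall>A. continuous_on A k) \<and>
    (\<forall>z\<in>U. \<forall>t. z + axis i (k t) \<in> S) \<and>
    (\<forall>z\<in>U. pd i f z = integral (cbox 0 1) (\<lambda>t. f (z + axis i (k t)) / k t))"
    using pd_integral_local[OF assms(1) ball \<open>z0 \<in> S\<close>, of i] by (elim exE)
  then have U: "open U" "convex U" "z0 \<in> U" and k: "\<And>t. k t \<noteq> 0" "\<And>A. continuous_on A k"
    and sub: "\<And>z t. z \<in> U \<Longrightarrow> z + axis i (k t) \<in> S"
    and pd: "\<And>z. z \<in> U \<Longrightarrow> pd i f z = integral (cbox 0 1) (\<lambda>t. f (z + axis i (k t)) / k t)"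
    by (elim conjE; blast)+
  have cf: "continuous_on S f" using assms by (intro continuous_at_imp_continuous_on ballI holo_at_continuous)
  have ck: "continuous_on (U \<times> cbox 0 1) (\<lambda>x. k (snd x))"
    by (rule continuous_on_compose2[OF k(2)[of UNIV] continuous_on_snd[OF continuous_on_id]]) simp
  have "continuous_on (U \<times> cbox 0 1) (\<lambda>x. fst x + axis i (k (snd x)))"
    by (intro continuous_on_add continuous_on_fst continuous_on_id bounded_linear.continuous_on[OF bounded_linear_axis] ck)
  then have "continuous_on (U \<times> cbox 0 1) (\<lambda>x. f (fst x + axis i (k (snd x))))"
    by (rule continuous_on_compose2[OF cf]) (use sub in auto)
  then have "continuous_on (U \<times> cbox 0 1) (\<lambda>x. f (fst x + axis i (k (snd x))) / k (snd x))"
    by (rule continuous_on_divide[OF _ ck]) (use k(1) in blast)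
  then have "continuous_on U (\<lambda>z. integral (cbox 0 1) (\<lambda>t. f (z + axis i (k t)) / k t))"
    by (intro integral_continuous_on_param) (simp add: case_prod_unfold)
  then have "continuous_on U (pd i f)" by (rule continuous_on_eq) (simp only: pd)
  then show "isCont (pd i f) z0" using U by (simp add: continuous_on_eq_continuous_at)
qed

text \<open>The Cauchy integral is differentiated under the integral sign; the Leibniz rule asks for
  a jointly continuous derivative, which \<open>continuous_pd\<close> provides. Complex homogeneity
  passes through the integral.\<close>

theorem holo_at_pd:
  assumes "open S" "\<And>w. w \<in> S \<Longrightarrow> holo_at f w" and \<open>z0 \<in> S\<close> shows "holo_at (pd i f) z0"
proof -
  have ball: "\<forall>w\<in>S. holo_at f w" using assms(2) by (rule ballI)
  obtain U and k :: "real \<Rightarrow> complex" where ex: "open U \<and> convex U \<and> z0 \<in> U \<and> (\<forall>t. k t \<noteq> 0) \<and> (\<forall>A. continuous_on A k) \<and>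
    (\<forall>z\<in>U. \<forall>t. z + axis i (k t) \<in> S) \<and>
    (\<forall>z\<in>U. pd i f z = integral (cbox 0 1) (\<lambda>t. f (z + axis i (k t)) / k t))"
    using pd_integral_local[OF assms(1) ball \<open>z0 \<in> S\<close>, of i] by (elim exE)
  then have U: "open U" "convex U" "z0 \<in> U" and k: "\<And>t. k t \<noteq> 0" "\<And>A. continuous_on A k"
    and sub: "\<And>z t. z \<in> U \<Longrightarrow> z + axis i (k t) \<in> S"
    and pd: "\<And>z. z \<in> U \<Longrightarrow> pd i f z = integral (cbox 0 1) (\<lambda>t. f (z + axis i (k t)) / k t)"
    by (elim conjE; blast)+
  have cf: "continuous_on S f" using assms by (intro continuous_at_imp_continuous_on ballI holo_at_continuous)
  have cp: "continuous_on S (pd j f)" for j using assms by (intro continuous_pd)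
  define P where "P j = Blinfun (\<lambda>u::complex^'a. u $ j)" for j
  have P: "blinfun_apply (P j) u = u $ j" for j u
    unfolding P_def bounded_linear_Blinfun_apply[OF bounded_linear_vec_nth] ..
  \<comment> \<open>The derivative of the integrand in the parameter, as the bounded linear function
    that the Leibniz rule expects.\<close>
  define fx where "fx z t = (\<Sum>j\<in>UNIV. blinfun_mult_right (pd j f (z + axis i (k t)) / k t) o\<^sub>L P j)" for z t
  have fx: "blinfun_apply (fx z t) u = (\<Sum>j\<in>UNIV. pd j f (z + axis i (k t)) / k t * u $ j)" for z t u
    by (simp add: fx_def blinfun.sum_left P)
  have ck: "continuous_on (U \<times> cbox 0 1) (\<lambda>x. k (snd x))"
    by (rule continuous_on_compose2[OF k(2)[of UNIV] continuous_on_snd[OF continuous_on_id]]) simp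
  have cs: "continuous_on (U \<times> cbox 0 1) (\<lambda>x. fst x + axis i (k (snd x)))"
    by (intro continuous_on_add continuous_on_fst continuous_on_id bounded_linear.continuous_on[OF bounded_linear_axis] ck)
  have "continuous_on (U \<times> cbox 0 1) (\<lambda>x. pd j f (fst x + axis i (k (snd x))))" for j
    by (rule continuous_on_compose2[OF cp cs]) (use sub in auto)
  then have "continuous_on (U \<times> cbox 0 1) (\<lambda>x. pd j f (fst x + axis i (k (snd x))) / k (snd x))" for j
    by (rule continuous_on_divide[OF _ ck]) (use k(1) in blast)
  then have cfx: "continuous_on (U \<times> cbox 0 1) (\<lambda>(z, t). fx z t)"
    unfolding case_prod_unfold fx_def
    by (intro continuous_on_sum bounded_bilinear.continuous_on[OF bounded_bilinear_blinfun_compose]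
        bounded_linear.continuous_on[OF bounded_linear_blinfun_mult_right] continuous_on_const)
  have slice: "continuous_on (cbox 0 1) (\<lambda>t. z + axis i (k t))" for z
    by (intro continuous_on_add continuous_on_const bounded_linear.continuous_on[OF bounded_linear_axis] k)
  have G: "((\<lambda>z. integral (cbox 0 1) (\<lambda>t. f (z + axis i (k t)) / k t)) has_derivative
      blinfun_apply (integral (cbox 0 1) (fx z0))) (at z0 within U)"
  proof (rule leibniz_rule[OF _ _ cfx])
    fix z t assume z: "z \<in> U" and "t \<in> cbox 0 (1::real)"
    have "((\<lambda>z. z + axis i (k t)) has_derivative (\<lambda>u. u)) (at z)" by (auto intro!: derivative_eq_intros)
    from has_derivative_compose[OF this holo_at_derivative[OF assms(2)[OF sub[OF z]]]]
    have "((\<lambda>z. f (z + axis i (k t))) has_derivative (\<lambda>u. \<Sum>j\<in>UNIV. u $ j * pd j f (z + axis i (k t)))) (at z)" .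
    from has_derivative_mult_left[OF this, of "1 / k t"]
    have "((\<lambda>z. f (z + axis i (k t)) / k t) has_derivative (\<lambda>u. (\<Sum>j\<in>UNIV. u $ j * pd j f (z + axis i (k t))) * (1 / k t))) (at z)"
      by simp
    moreover have "blinfun_apply (fx z t) = (\<lambda>u. (\<Sum>j\<in>UNIV. u $ j * pd j f (z + axis i (k t))) * (1 / k t))"
      unfolding fx sum_distrib_right fun_eq_iff by (intro allI sum.cong refl) (simp add: fx mult_ac sum_distrib_right)
    ultimately show "((\<lambda>z. f (z + axis i (k t)) / k t) has_derivative blinfun_apply (fx z t)) (at z within U)"
      by (simp only: has_derivative_at_withinI)
  next
    fix z assume z: "z \<in> U"
    have "continuous_on (cbox 0 1) (\<lambda>t. f (z + axis i (k t)))"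
      by (rule continuous_on_compose2[OF cf slice]) (use sub[OF z] in auto)
    then have "continuous_on (cbox 0 1) (\<lambda>t. f (z + axis i (k t)) / k t)"
      by (rule continuous_on_divide[OF _ k(2)]) (use k(1) in blast)
    then show "(\<lambda>t. f (z + axis i (k t)) / k t) integrable_on cbox 0 (1::real)" by (rule integrable_continuous)
  qed (use U in auto)
  have int: "fx z0 integrable_on cbox 0 1"
  proof (rule integrable_continuous)
    have "continuous_on (cbox 0 1) (\<lambda>t. (\<lambda>(z, t). fx z t) (z0, t))"
      by (rule continuous_on_compose2[OF cfx]) (use U in \<open>auto intro!: continuous_intros\<close>)
    then show "continuous_on (cbox 0 1) (fx z0)" by simp
  qed
  have app: "blinfun_apply (integral (cbox 0 1) (fx z0)) u = integral (cbox 0 1) (\<lambda>t. blinfun_apply (fx z0 t) u)" for u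
    using integral_linear[OF int blinfun.bounded_linear_left, of u] by (simp add: o_def)
  have "blinfun_apply (fx z0 t) (c *s u) = c * blinfun_apply (fx z0 t) u" for t c u
    unfolding fx sum_distrib_left by (intro sum.cong refl) (simp add: mult_ac)
  then have "blinfun_apply (integral (cbox 0 1) (fx z0)) (c *s u) = c * blinfun_apply (integral (cbox 0 1) (fx z0)) u" for c u
    unfolding app by (simp only: integral_mult_right)
  then have "holo_at (\<lambda>z. integral (cbox 0 1) (\<lambda>t. f (z + axis i (k t)) / k t)) z0"
    using G U by (intro holo_atI[of _ "blinfun_apply (integral (cbox 0 1) (fx z0))"]) (simp_all add: at_within_open[of z0 U])
  then show ?thesis by (rule holo_at_cong[OF U(1,3), rotated]) (simp only: pd)
qed

section \<open>Identity theorem and complements of zero sets\<close>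

lemma continuous_on_complex_line: "continuous_on A (\<lambda>t. q + t *s (u :: complex^'n::finite))"
  by (intro continuous_on_add continuous_on_const continuous_on_vec_lambda[where f = "\<lambda>i t. t * u $ i", folded vector_scalar_mult_def])
    (intro continuous_intros)

text \<open>Restriction to the complex line through \<open>q\<close> and \<open>w\<close>: it meets
  the ball in a convex set of parameters, where the identity theorem in one variable
  applies.\<close>

lemma holo_at_ball_identity:
  fixes f :: "complex^'n::finite \<Rightarrow> complex"
  assumes hol: "\<And>w. w \<in> ball c e \<Longrightarrow> holo_at f w" and q: "q \<in> ball c e" "d > 0" "\<And>w. w \<in> ball q d \<Longrightarrow> f w = 0"
    and w: "w \<in> ball c e"
  shows "f w = 0"
proof -
  define l where "l t = q + t *s (w - q)" for t
  have ends: "l 0 = q" "l 1 = w" by (simp_all add: l_def)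
  have cont: "continuous_on UNIV l" unfolding l_def by (rule continuous_on_complex_line)
  have open_l: "open {t. l t \<in> ball p r}" for p r
    using open_vimage[OF open_ball[of p r] cont] by (simp only: vimage_def)
  have "convex {t. l t \<in> ball c e}"
  proof (rule convexI)
    fix s t :: complex and a b :: real
    assume s: "s \<in> {t. l t \<in> ball c e}" "t \<in> {t. l t \<in> ball c e}" and ab: "a \<ge> 0" "b \<ge> 0" "a + b = 1"
    have "a *\<^sub>R q $ i + b *\<^sub>R q $ i = q $ i" for i using ab by (simp add: scaleR_left_distrib[symmetric])
    then have "l (a *\<^sub>R s + b *\<^sub>R t) = a *\<^sub>R l s + b *\<^sub>R l t"
      by (simp add: l_def vec_eq_iff algebra_simps)
    then show "a *\<^sub>R s + b *\<^sub>R t \<in> {t. l t \<in> ball c e}"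
      using convexD[OF convex_ball _ _ ab, of "l s" c e "l t"] s by (simp only: mem_Collect_eq)
  qed
  then have conn: "connected {t. l t \<in> ball c e}" by (rule convex_connected)
  have hol_l: "(\<lambda>t. f (l t)) holomorphic_on {t. l t \<in> ball c e}"
    unfolding holomorphic_on_def
  proof
    fix t assume "t \<in> {t. l t \<in> ball c e}"
    then have "holo_at f (q + t *s (w - q))" using hol[of "l t"] by (simp add: l_def)
    then show "(\<lambda>t. f (l t)) field_differentiable at t within {t. l t \<in> ball c e}"
      unfolding l_def by (rule field_differentiable_at_within[OF holo_at_line])
  qed
  let ?V = "{t. l t \<in> ball c e} \<inter> {t. l t \<in> ball q d}"
  have "0 \<in> ?V" using q(1,2) ends by simp
  moreover have "open ?V" using open_l by (intro open_Int)
  ultimately have "0 islimpt ?V" by (intro interior_limit_point) (simp only: interior_open)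
  then have "f (l 1) = 0"
  proof (rule analytic_continuation[OF hol_l open_l conn _ _ _ _ _, rotated 2])
    show "?V \<subseteq> {t. l t \<in> ball c e}" by blast
    show "0 \<in> {t. l t \<in> ball c e}" using q(1) ends by simp
    show "1 \<in> {t. l t \<in> ball c e}" using w ends by simp
    show "f (l t) = 0" if "t \<in> ?V" for t using that q(3) by simp
  qed
  then show ?thesis using ends by simp
qed

text \<open>Two points outside the zero set span a complex line on which the zeros of
  \<open>D\<close> are countable, and the plane minus a countable set is path connected.\<close>

lemma path_connected_nonzero:
  assumes hol: "\<And>w. holo_at D w" shows "path_connected {w. D w \<noteq> 0}"
proof -
  have "\<exists>g. path g \<and> path_image g \<subseteq> {w. D w \<noteq> 0} \<and> pathstart g = p \<and> pathfinish g = q"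
    if p: "D p \<noteq> 0" and q: "D q \<noteq> 0" for p q
  proof -
    let ?l = "\<lambda>t. p + t *s (q - p)"
    have cont: "continuous_on A ?l" for A by (rule continuous_on_complex_line)
    have "(\<lambda>t. D (?l t)) holomorphic_on UNIV"
      unfolding holomorphic_on_def by (intro ballI field_differentiable_at_within[OF holo_at_line[OF hol]])
    \<comment> \<open>If \<open>D\<close> is constant on the line, its value at \<open>p\<close>
      excludes zeros altogether.\<close>
    then have "countable {t\<in>UNIV. D (?l t) = 0}"
    proof (cases "(\<lambda>t. D (?l t)) constant_on UNIV")
      case True
      then obtain y where "\<forall>t\<in>UNIV. D (?l t) = y" unfolding constant_on_def by (elim exE)
      then have "D (?l t) = D (?l 0)" for t using UNIV_I[of t] UNIV_I[of 0] by (blast intro: trans sym)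
      then show ?thesis using p by simp
    next
      case False
      then show ?thesis
        using \<open>(\<lambda>t. D (?l t)) holomorphic_on UNIV\<close> by (intro holomorphic_countable_zeros) auto
    qed
    then have "path_connected (- {t. D (?l t) = 0})" by (intro path_connected_complement_countable) auto
    moreover have "0 \<in> - {t. D (?l t) = 0}" "1 \<in> - {t. D (?l t) = 0}" using p q by auto
    ultimately obtain g where g: "path g" "path_image g \<subseteq> - {t. D (?l t) = 0}" "pathstart g = 0" "pathfinish g = 1"
      unfolding path_connected_def by blast
    have "path (?l \<circ> g)" using g(1) cont path_continuous_image by blast
    moreover have "path_image (?l \<circ> g) \<subseteq> {w. D w \<noteq> 0}" using g(2) by (auto simp: path_image_compose)
    moreover have "pathstart (?l \<circ> g) = p" "pathfinish (?l \<circ> g) = q" using g by (auto simp: pathstart_compose pathfinish_compose)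
    ultimately show ?thesis by blast
  qed
  then show ?thesis unfolding path_connected_def by blast
qed

lemma pd_zero_constant:
  assumes "\<And>w. w \<in> ball c e \<Longrightarrow> holo_at f w" "\<And>w i. w \<in> ball c e \<Longrightarrow> pd i f w = 0" "w \<in> ball c e"
  shows "f w = f c"
proof -
  have "(f has_derivative (\<lambda>u. 0)) (at z within ball c e)" if "z \<in> ball c e" for z
    using holo_at_derivative[OF assms(1)[OF that]] assms(2)[OF that]
    by (simp add: has_derivative_at_withinI)
  then obtain k where "\<And>z. z \<in> ball c e \<Longrightarrow> f z = k"
    using has_derivative_zero_constant[OF convex_ball, of c e f] by blast
  moreover have "c \<in> ball c e" using assms(3) by (auto intro: le_less_trans[OF zero_le_dist])
  ultimately show ?thesis using assms(3) by simp
qed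

text \<open>Subtracting the linear part given by the constant first derivatives leaves a function
  whose first derivatives vanish.\<close>

lemma pd_pd_zero_affine:
  assumes hol: "\<And>w. w \<in> ball c e \<Longrightarrow> holo_at f w"
    and zero: "\<And>w r s. w \<in> ball c e \<Longrightarrow> pd r (pd s f) w = 0" and w: "w \<in> ball c e"
  shows "f w = f c + (\<Sum>s\<in>UNIV. (w $ s - c $ s) * pd s f c)"
proof -
  have const: "pd s f z = pd s f c" if "z \<in> ball c e" for z s
    using zero that holo_at_pd[OF open_ball hol] by (intro pd_zero_constant[of c e]) auto
  let ?h = "\<lambda>z. f z - (\<Sum>s\<in>UNIV. (z $ s - c $ s) * pd s f c)"
  have l: "holo_at (\<lambda>z. (z $ s - c $ s) * pd s f c) z"
    "pd k (\<lambda>z. (z $ s - c $ s) * pd s f c) z = (if k = s then pd s f c else 0)" for z s k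
    by (auto simp: pd_mult pd_diff pd_nth pd_const holo_at_diff holo_at_nth holo_at_const intro!: holo_at_mult)
  have "?h w = ?h c"
  proof (rule pd_zero_constant[of c e])
    fix z i assume z: "z \<in> ball c e"
    show "holo_at ?h z" using hol[OF z] l by (intro holo_at_diff holo_at_sum) auto
    show "pd i ?h z = 0"
      using hol[OF z] l const[OF z] by (simp add: pd_diff pd_sum holo_at_sum)
  qed (rule w)
  then show ?thesis by (simp add: algebra_simps)
qed

section \<open>Pulling back flat functions\<close>

text \<open>The Koszul computation in coordinates. \<open>H\<close> is the metric, \<open>D\<close>
  its first derivatives, \<open>J\<close> the Jacobian of a map and \<open>F\<close> its second
  derivatives; \<open>E\<close> says that the derivatives of the pulled back metric vanish. The
  conclusion is the Levi-Civita formula with lowered index, contracted with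
  \<open>J\<close>.\<close>

lemma christoffel_algebra:
  fixes J :: "'n::finite \<Rightarrow> 'n \<Rightarrow> complex" and F :: "'n \<Rightarrow> 'n \<Rightarrow> 'n \<Rightarrow> complex"
  assumes F: "\<And>i r t. F i r t = F i t r" and H: "\<And>i j. H i j = H j i"
    and E: "\<And>r s t. (\<Sum>j\<in>UNIV. (\<Sum>i\<in>UNIV. F i r t * H i j + J i r * (\<Sum>l\<in>UNIV. D l i j * J l t)) * J j s +
      (\<Sum>i\<in>UNIV. J i r * H i j) * F j s t) = 0"
  shows "(\<Sum>l\<in>UNIV. J l t * ((\<Sum>i\<in>UNIV. \<Sum>j\<in>UNIV. (D i l j + D j l i - D l i j) * (J i r * J j s)) +
      2 * (\<Sum>i\<in>UNIV. H l i * F i r s))) = 0"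
proof -
  \<comment> \<open>The derivative of the pulled back metric splits into terms \<open>U\<close> with
    second derivatives of the map and terms \<open>T\<close> with derivatives of the metric.\<close>
  define U where "U a b c = (\<Sum>i\<in>UNIV. \<Sum>j\<in>UNIV. F i a b * H i j * J j c)" for a b c
  define T where "T t r s = (\<Sum>i\<in>UNIV. \<Sum>j\<in>UNIV. \<Sum>l\<in>UNIV. D l i j * (J l t * (J i r * J j s)))" for t r s
  have U_sym: "U a b c = U b a c" for a b c by (simp only: U_def F[of _ a b])
  have E': "U r t s + T t r s + U s t r = 0" for r s t
  proof -
    have 1: "(\<Sum>j\<in>UNIV. (\<Sum>i\<in>UNIV. F i r t * H i j) * J j s) = U r t s"
      unfolding U_def sum_distrib_right by (rule sum.swap)
    have 2: "(\<Sum>j\<in>UNIV. (\<Sum>i\<in>UNIV. J i r * (\<Sum>l\<in>UNIV. D l i j * J l t)) * J j s) = T t r s"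
      unfolding T_def sum_distrib_right sum_distrib_left
      by (subst sum.swap) (intro sum.cong refl, simp add: mult_ac)
    have 3: "(\<Sum>j\<in>UNIV. (\<Sum>i\<in>UNIV. J i r * H i j) * F j s t) = U s t r"
      unfolding U_def sum_distrib_right
      by (intro sum.cong refl) (simp add: H[of _ j for j] mult_ac)
    show ?thesis
      using E[of r t s] by (simp only: sum.distrib distrib_right 1 2 3)
  qed
  have T1: "(\<Sum>l\<in>UNIV. \<Sum>i\<in>UNIV. \<Sum>j\<in>UNIV. J l t * (D i l j * (J i r * J j s))) = T r t s"
    unfolding T_def
    by (rule sum.cong[OF refl], rule trans[OF sum.swap], intro sum.cong refl) (simp add: mult_ac)
  have T2: "(\<Sum>l\<in>UNIV. \<Sum>i\<in>UNIV. \<Sum>j\<in>UNIV. J l t * (D j l i * (J i r * J j s))) = T s t r"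
    unfolding T_def by (intro sum.cong refl) (simp add: mult_ac)
  have T3: "(\<Sum>l\<in>UNIV. \<Sum>i\<in>UNIV. \<Sum>j\<in>UNIV. J l t * (D l i j * (J i r * J j s))) = T t r s"
  proof -
    have "(\<Sum>l\<in>UNIV. \<Sum>i\<in>UNIV. \<Sum>j\<in>UNIV. J l t * (D l i j * (J i r * J j s))) =
        (\<Sum>i\<in>UNIV. \<Sum>l\<in>UNIV. \<Sum>j\<in>UNIV. J l t * (D l i j * (J i r * J j s)))" by (rule sum.swap)
    also have "\<dots> = T t r s"
      unfolding T_def
      by (rule sum.cong[OF refl], rule trans[OF sum.swap], intro sum.cong refl) (simp add: mult_ac)
    finally show ?thesis .
  qed
  have U1: "(\<Sum>l\<in>UNIV. \<Sum>i\<in>UNIV. J l t * (H l i * F i r s)) = U r s t"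
    unfolding U_def by (subst sum.swap) (intro sum.cong refl, simp add: H[of _ j for j] mult_ac)
  have "(\<Sum>l\<in>UNIV. J l t * ((\<Sum>i\<in>UNIV. \<Sum>j\<in>UNIV. (D i l j + D j l i - D l i j) * (J i r * J j s)) +
      2 * (\<Sum>i\<in>UNIV. H l i * F i r s))) =
      (\<Sum>l\<in>UNIV. \<Sum>i\<in>UNIV. \<Sum>j\<in>UNIV. J l t * (D i l j * (J i r * J j s))) +
      (\<Sum>l\<in>UNIV. \<Sum>i\<in>UNIV. \<Sum>j\<in>UNIV. J l t * (D j l i * (J i r * J j s))) -
      (\<Sum>l\<in>UNIV. \<Sum>i\<in>UNIV. \<Sum>j\<in>UNIV. J l t * (D l i j * (J i r * J j s))) +
      2 * (\<Sum>l\<in>UNIV. \<Sum>i\<in>UNIV. J l t * (H l i * F i r s))"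
    by (simp only: distrib_left distrib_right left_diff_distrib right_diff_distrib sum.distrib sum_subtractf
        sum_distrib_left mult.left_commute[of _ 2])
  also have "\<dots> = T r t s + T s t r - T t r s + 2 * U r s t" by (simp only: T1 T2 T3 U1)
  \<comment> \<open>Two instances of the vanishing derivative minus the third; symmetry of second
    derivatives cancels all \<open>U\<close> terms but one pair.\<close>
  also have "\<dots> = 0"
    using E'[of t r s] E'[of t s r] E'[of r t s] U_sym[of t r s] U_sym[of s r t] U_sym[of t s r]
    by algebra
  finally show ?thesis .
qed

lemma matrix_inverse_facts:
  fixes M :: "complex^'n::finite^'n"
  assumes "det M \<noteq> 0" shows "M ** matrix_inv M = mat 1" "matrix_inv M ** M = mat 1"
proof -
  have "invertible M" using assms by (simp add: invertible_det_nz)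
  then have "M ** matrix_inv M = mat 1 \<and> matrix_inv M ** M = mat 1"
    unfolding invertible_def matrix_inv_def by (rule someI_ex)
  then show "M ** matrix_inv M = mat 1" "matrix_inv M ** M = mat 1" by blast+
qed

lemma holo_at_det:
  assumes "\<And>i j. holo_at (\<lambda>w. M w $ i $ j) z" shows "holo_at (\<lambda>w. det (M w)) z"
  unfolding det_def by (intro holo_at_sum holo_at_mult holo_at_const holo_at_prod assms finite_permutations finite)

text \<open>Cramer's rule makes each entry of the inverse a quotient of determinants.\<close>

lemma holo_at_matrix_inv:
  fixes M :: "complex^'m::finite \<Rightarrow> complex^'n::finite^'n"
  assumes hol: "\<And>i j w. holo_at (\<lambda>w. M w $ i $ j) w" and d: "det (M z) \<noteq> 0"
  shows "holo_at (\<lambda>w. matrix_inv (M w) $ a $ b) z"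
proof -
  let ?N = "\<lambda>w. \<chi> i j. if j = a then axis b 1 $ i else M w $ i $ j"
  let ?U = "{w. det (M w) \<noteq> 0}"
  have hd: "holo_at (\<lambda>w. det (M w)) w" for w by (rule holo_at_det) (rule hol)
  have "continuous_on UNIV (\<lambda>w. det (M w))"
    by (intro continuous_at_imp_continuous_on ballI holo_at_continuous hd)
  then have U: "open ?U" by (intro open_Collect_neq continuous_on_const)
  have hn: "holo_at (\<lambda>w. det (?N w)) w" for w
  proof (rule holo_at_det)
    show "holo_at (\<lambda>w. ?N w $ i $ j) w" for i j by (cases "j = a") (simp_all add: holo_at_const hol)
  qed
  have eq: "det (?N w) / det (M w) = matrix_inv (M w) $ a $ b" if "w \<in> ?U" for w
  proof -
    let ?x = "\<chi> i. matrix_inv (M w) $ i $ b"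
    have "(M w ** matrix_inv (M w)) $ i $ b = mat 1 $ i $ b" for i using that by (simp add: matrix_inverse_facts)
    then have "M w *v ?x = axis b 1"
      by (simp add: vec_eq_iff matrix_vector_mult_def matrix_matrix_mult_def mat_def axis_def)
    then have "?x = (\<chi> k. det (\<chi> i j. if j = k then axis b 1 $ i else M w $ i $ j) / det (M w))"
      using cramer[of "M w" ?x "axis b 1"] that by simp
    then show ?thesis by (simp add: vec_eq_iff)
  qed
  have quot: "holo_at (\<lambda>w. det (?N w) / det (M w)) z" by (intro holo_at_divide hn hd d)
  have "z \<in> ?U" using d by simp
  show ?thesis by (rule holo_at_cong[OF U \<open>z \<in> ?U\<close> _ quot]) (rule eq)
qed

text \<open>The cotangent metric \<open>g\<close> is the image under \<phi> of the constant
  \<open>A\<close>, so the source coordinates are flat. Symmetry of second derivatives is assumed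
  here because for \<open>phi\<close> it can be read off the exponentials.\<close>

locale metric_pullback =
  fixes \<phi> :: "complex^'n::finite \<Rightarrow> complex^'n" and g :: "complex^'n \<Rightarrow> complex^'n^'n" and A :: "complex^'n^'n"
  assumes holo: "\<And>k x. holo_at (\<lambda>u. \<phi> u $ k) x"
    and mixed: "\<And>k r s x. pd r (pd s (\<lambda>u. \<phi> u $ k)) x = pd s (pd r (\<lambda>u. \<phi> u $ k)) x"
    and holo_g: "\<And>i j w. holo_at (\<lambda>w. g w $ i $ j) w"
    and A_sym: "transpose A = A"
    and metric: "\<And>x. g (\<phi> x) = (\<chi> k r. pd r (\<lambda>u. \<phi> u $ k) x) ** A ** transpose (\<chi> k r. pd r (\<lambda>u. \<phi> u $ k) x)"
begin

abbreviation J :: "'n \<Rightarrow> 'n \<Rightarrow> complex^'n \<Rightarrow> complex" where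
  "J k r \<equiv> pd r (\<lambda>u. \<phi> u $ k)"

abbreviation Jac :: "complex^'n \<Rightarrow> complex^'n^'n" where
  "Jac x \<equiv> (\<chi> k r. J k r x)"

lemma holo_J: "holo_at (J k r) x"
  by (rule holo_at_pd[OF open_UNIV holo UNIV_I])

lemma det_Jac: assumes "det (g (\<phi> x)) \<noteq> 0" shows "det (Jac x) \<noteq> 0"
  using assms by (simp add: metric det_mul)

lemma holo_det: "holo_at (\<lambda>x. det (g (\<phi> x))) x"
  by (rule holo_at_det, rule holo_at_compose[of "\<lambda>w. g w $ _ $ _"]) (rule holo_g holo)+

lemma open_regular: "open {x. det (g (\<phi> x)) \<noteq> 0}"
  by (intro open_Collect_neq continuous_on_const continuous_at_imp_continuous_on ballI holo_at_continuous holo_det)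

lemma metric_inverse_sym: assumes "det (g (\<phi> x)) \<noteq> 0" shows "transpose (matrix_inv (g (\<phi> x))) = matrix_inv (g (\<phi> x))"
proof -
  let ?G = "g (\<phi> x)"
  have s: "transpose ?G = ?G" by (simp add: metric matrix_transpose_mul A_sym matrix_mul_assoc)
  have "transpose (matrix_inv ?G) ** ?G = transpose (transpose ?G ** matrix_inv ?G)"
    by (simp only: matrix_transpose_mul transpose_transpose)
  also have "\<dots> = mat 1" unfolding s matrix_inverse_facts[OF assms] by (rule transpose_mat)
  finally have "transpose (matrix_inv ?G) ** (?G ** matrix_inv ?G) = matrix_inv ?G"
    unfolding matrix_mul_assoc by (simp only: matrix_mul_lid)
  then show ?thesis unfolding matrix_inverse_facts[OF assms] by (simp only: matrix_mul_rid)
qed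

text \<open>Both sides are the inverse of \<open>A\<close>: write the metric as Jacobian times
  \<open>A\<close> times transposed Jacobian and cancel the invertible Jacobian on the left.\<close>

lemma metric_constant:
  assumes x: "det (g (\<phi> x)) \<noteq> 0" and y: "det (g (\<phi> y)) \<noteq> 0"
  shows "transpose (Jac x) ** matrix_inv (g (\<phi> x)) ** Jac x = transpose (Jac y) ** matrix_inv (g (\<phi> y)) ** Jac y"
proof -
  let ?Q = "\<lambda>x. transpose (Jac x) ** matrix_inv (g (\<phi> x)) ** Jac x"
  have AQ: "A ** ?Q x = mat 1" if x: "det (g (\<phi> x)) \<noteq> 0" for x
  proof -
    have "Jac x ** (A ** ?Q x) = (Jac x ** A ** transpose (Jac x)) ** matrix_inv (g (\<phi> x)) ** Jac x"
      by (simp only: matrix_mul_assoc)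
    also have "\<dots> = Jac x" unfolding metric[symmetric] matrix_inverse_facts[OF x] by (rule matrix_mul_lid)
    finally have "matrix_inv (Jac x) ** (Jac x ** (A ** ?Q x)) = matrix_inv (Jac x) ** Jac x" by (simp only:)
    then show ?thesis
      unfolding matrix_mul_assoc[of "matrix_inv (Jac x)" "Jac x"] matrix_inverse_facts[OF det_Jac[OF x]]
      by (simp only: matrix_mul_lid)
  qed
  have "?Q y ** A = mat 1" using AQ[OF y] matrix_left_right_inverse by blast
  then have "?Q x = (?Q y ** A) ** ?Q x" by (simp only: matrix_mul_lid)
  also have "\<dots> = ?Q y" unfolding matrix_mul_assoc[symmetric, of "?Q y" A] AQ[OF x] by (rule matrix_mul_rid)
  finally show ?thesis .
qed

text \<open>The transformation law of Christoffel symbols, in which those of the constant metric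
  vanish.\<close>

lemma christoffel_pullback:
  assumes y: "det (g (\<phi> y)) \<noteq> 0"
  shows "(\<Sum>i\<in>UNIV. \<Sum>j\<in>UNIV. christoffel g k i j (\<phi> y) * (J i r y * J j s y)) = - pd s (J k r) y"
proof -
  define h where "h i j w = matrix_inv (g w) $ i $ j" for i j w
  define D where "D l i j = pd l (h i j) (\<phi> y)" for l i j
  let ?F = "\<lambda>i r t. pd t (J i r) y" and ?H = "\<lambda>i j. h i j (\<phi> y)" and ?J = "\<lambda>i r. J i r y"
  have holo_h: "holo_at (h i j) (\<phi> y)" for i j unfolding h_def by (rule holo_at_matrix_inv[OF holo_g y])
  have holo_hp: "holo_at (\<lambda>x. h i j (\<phi> x)) y" for i j by (rule holo_at_compose[OF holo_h holo])
  have pd_hp: "pd t (\<lambda>x. h i j (\<phi> x)) y = (\<Sum>l\<in>UNIV. D l i j * J l t y)" for i j t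
    unfolding D_def by (rule pd_compose[OF holo_h holo])
  have H: "?H i j = ?H j i" for i j
    unfolding h_def by (subst metric_inverse_sym[OF y, symmetric]) (simp add: transpose_def)
  have E: "(\<Sum>j\<in>UNIV. (\<Sum>i\<in>UNIV. ?F i r t * ?H i j + ?J i r * (\<Sum>l\<in>UNIV. D l i j * ?J l t)) * ?J j s +
      (\<Sum>i\<in>UNIV. ?J i r * ?H i j) * ?F j s t) = 0" for r s t
  proof -
    \<comment> \<open>An entry of the pulled back metric, constant on the open set of regular
      points; its derivative expands to the hypothesis of
      \<open>christoffel_algebra\<close>.\<close>
    let ?q = "\<lambda>x. \<Sum>j\<in>UNIV. (\<Sum>i\<in>UNIV. J i r x * h i j (\<phi> x)) * J j s x"
    have q: "?q x = (transpose (Jac x) ** matrix_inv (g (\<phi> x)) ** Jac x) $ r $ s" for x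
      by (simp add: matrix_matrix_mult_def transpose_def h_def)
    have "?q x = ?q y" if "x \<in> {x. det (g (\<phi> x)) \<noteq> 0}" for x
      unfolding q using metric_constant[of x y] that y by simp
    moreover have "y \<in> {x. det (g (\<phi> x)) \<noteq> 0}" using y by simp
    ultimately have "pd t ?q y = pd t (\<lambda>x. ?q y) y" by (intro pd_cong[OF open_regular])
    then have "pd t ?q y = 0" by (simp only: pd_const)
    moreover have "pd t ?q y = (\<Sum>j\<in>UNIV. (\<Sum>i\<in>UNIV. ?F i r t * ?H i j + ?J i r * (\<Sum>l\<in>UNIV. D l i j * ?J l t)) * ?J j s +
      (\<Sum>i\<in>UNIV. ?J i r * ?H i j) * ?F j s t)"
      by (subst pd_sum pd_mult | intro holo_at_sum holo_at_mult holo_J holo_hp finite sum.cong refl)+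
        (simp add: pd_sum pd_mult holo_at_sum holo_at_mult holo_J holo_hp pd_hp)
    ultimately show ?thesis by (simp only:)
  qed
  \<comment> \<open>The identity with its upper index lowered. Contracted with the invertible
    Jacobian it vanishes, hence it vanishes itself.\<close>
  define b where "b = (\<chi> l. (\<Sum>i\<in>UNIV. \<Sum>j\<in>UNIV. (D i l j + D j l i - D l i j) * (?J i r * ?J j s)) +
      2 * (\<Sum>i\<in>UNIV. ?H l i * ?F i r s))"
  have Tb: "transpose (Jac y) *v b = 0"
  proof -
    have "(\<Sum>l\<in>UNIV. ?J l t * b $ l) = 0" for t
      unfolding b_def vec_lambda_beta
      by (rule christoffel_algebra[where F = ?F and H = ?H]) (use mixed H E in blast)+
    then show ?thesis by (simp add: vec_eq_iff matrix_vector_mult_def transpose_def)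
  qed
  have MT: "matrix_inv (transpose (Jac y)) ** transpose (Jac y) = mat 1"
    using det_Jac[OF y] by (intro matrix_inverse_facts) (simp add: det_transpose)
  have "mat 1 *v b = matrix_inv (transpose (Jac y)) *v (transpose (Jac y) *v b)"
    unfolding MT[symmetric] by (rule matrix_vector_mul_assoc[symmetric])
  then have "mat 1 *v b = matrix_inv (transpose (Jac y)) *v 0" unfolding Tb .
  then have "b = 0" by (simp only: matrix_vector_mul_lid matrix_vector_mult_0_right)
  then have C: "(\<Sum>i\<in>UNIV. \<Sum>j\<in>UNIV. (D i l j + D j l i - D l i j) * (?J i r * ?J j s)) =
      - 2 * (\<Sum>i\<in>UNIV. ?H l i * ?F i r s)" for l
    unfolding b_def by (simp add: vec_eq_iff eq_neg_iff_add_eq_0)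
  have gH: "(\<Sum>l\<in>UNIV. g (\<phi> y) $ k $ l * ?H l i) = (if k = i then 1 else 0)" for i
  proof -
    have "(g (\<phi> y) ** matrix_inv (g (\<phi> y))) $ k $ i = mat 1 $ k $ i" by (simp add: matrix_inverse_facts[OF y])
    then show ?thesis by (simp add: matrix_matrix_mult_def mat_def h_def)
  qed
  have "christoffel g k i j (\<phi> y) = 1/2 * (\<Sum>l\<in>UNIV. g (\<phi> y) $ k $ l * (D i l j + D j l i - D l i j))" for i j
    unfolding christoffel_def D_def h_def[abs_def] Let_def by (rule refl)
  then have "(\<Sum>i\<in>UNIV. \<Sum>j\<in>UNIV. christoffel g k i j (\<phi> y) * (?J i r * ?J j s)) =
      (\<Sum>i\<in>UNIV. \<Sum>j\<in>UNIV. \<Sum>l\<in>UNIV. 1/2 * g (\<phi> y) $ k $ l * ((D i l j + D j l i - D l i j) * (?J i r * ?J j s)))"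
    by (simp only: sum_distrib_right sum_distrib_left mult.assoc)
  also have "\<dots> = (\<Sum>i\<in>UNIV. \<Sum>l\<in>UNIV. \<Sum>j\<in>UNIV. 1/2 * g (\<phi> y) $ k $ l * ((D i l j + D j l i - D l i j) * (?J i r * ?J j s)))"
    by (rule sum.cong[OF refl sum.swap])
  also have "\<dots> = (\<Sum>l\<in>UNIV. \<Sum>i\<in>UNIV. \<Sum>j\<in>UNIV. 1/2 * g (\<phi> y) $ k $ l * ((D i l j + D j l i - D l i j) * (?J i r * ?J j s)))"
    by (rule sum.swap)
  also have "\<dots> = (\<Sum>l\<in>UNIV. 1/2 * g (\<phi> y) $ k $ l * (- 2 * (\<Sum>i\<in>UNIV. ?H l i * ?F i r s)))"
    by (simp only: sum_distrib_left[symmetric] C)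
  also have "\<dots> = - (\<Sum>l\<in>UNIV. \<Sum>i\<in>UNIV. g (\<phi> y) $ k $ l * ?H l i * ?F i r s)"
    by (simp add: sum_distrib_left sum_negf mult.assoc)
  also have "\<dots> = - (\<Sum>i\<in>UNIV. (\<Sum>l\<in>UNIV. g (\<phi> y) $ k $ l * ?H l i) * ?F i r s)"
    unfolding sum_distrib_right by (subst sum.swap) (rule refl)
  also have "\<dots> = - ?F k r s" unfolding gH by (simp add: if_distribR if_distrib[of "\<lambda>x. x * _"] cong: if_cong)
  finally show ?thesis .
qed

text \<open>By the chain rule a second derivative of the composite is a Hessian term plus the
  gradient paired with second derivatives of \<phi>. For a flat function the Hessian is expressed by
  Christoffel symbols, and the two terms cancel, so the composite is affine.\<close>

theorem flat_pullback:
  assumes y: "det (g (\<phi> y)) \<noteq> 0" and e: "e > 0" and f: "\<And>w. w \<in> ball (\<phi> y) e \<Longrightarrow> holo_at f w"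
    and flat: "\<And>w i j. w \<in> ball (\<phi> y) e \<Longrightarrow>
      pd i (pd j f) w = (\<Sum>k\<in>UNIV. christoffel g k i j w * pd k f w)"
  shows "\<exists>d>0. \<forall>x\<in>ball y d. f (\<phi> x) = f (\<phi> y) + (\<Sum>s\<in>UNIV. (x $ s - y $ s) * (\<Sum>j\<in>UNIV. pd j f (\<phi> y) * J j s y))"
proof -
  let ?U = "{x. det (g (\<phi> x)) \<noteq> 0} \<inter> {x. \<phi> x \<in> ball (\<phi> y) e}"
  have cont: "continuous_on UNIV \<phi>"
  proof -
    have "continuous_on UNIV (\<lambda>x. \<phi> x $ k)" for k
      by (intro continuous_at_imp_continuous_on ballI holo_at_continuous holo)
    then have "continuous_on UNIV (\<lambda>x. \<chi> k. \<phi> x $ k)" by (rule continuous_on_vec_lambda)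
    then show ?thesis by (simp only: vec_nth_inverse)
  qed
  have U: "open ?U"
    using open_regular open_vimage[OF open_ball cont] by (simp add: open_Int vimage_def)
  have "y \<in> ?U" using y e by simp
  then obtain d where d: "d > 0" "ball y d \<subseteq> ?U" using U openE by blast
  have chain: "holo_at (\<lambda>x. f (\<phi> x)) x" "pd s (\<lambda>x. f (\<phi> x)) x = (\<Sum>j\<in>UNIV. pd j f (\<phi> x) * J j s x)"
    if "x \<in> ball y d" for x s
  proof -
    have "holo_at f (\<phi> x)" using that d f by blast
    from holo_at_compose[OF this holo] pd_compose[OF this holo]
    show "holo_at (\<lambda>x. f (\<phi> x)) x" "pd s (\<lambda>x. f (\<phi> x)) x = (\<Sum>j\<in>UNIV. pd j f (\<phi> x) * J j s x)" by blast+
  qed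
  have second: "pd r (pd s (\<lambda>x. f (\<phi> x))) x = 0" if x: "x \<in> ball y d" for x r s
  proof -
    have w: "\<phi> x \<in> ball (\<phi> y) e" "det (g (\<phi> x)) \<noteq> 0" using x d by auto
    have hp: "holo_at (pd j f) (\<phi> x)" for j by (rule holo_at_pd[OF open_ball f w(1)])
    have hpp: "holo_at (\<lambda>x. pd j f (\<phi> x)) x" for j by (rule holo_at_compose[OF hp holo])
    have pp: "pd r (\<lambda>x. pd j f (\<phi> x)) x = (\<Sum>i\<in>UNIV. (\<Sum>k\<in>UNIV. christoffel g k i j (\<phi> x) * pd k f (\<phi> x)) * J i r x)" for j
      unfolding flat[OF w(1), symmetric] by (rule pd_compose[OF hp holo])
    have "pd r (pd s (\<lambda>x. f (\<phi> x))) x = pd r (\<lambda>x. \<Sum>j\<in>UNIV. pd j f (\<phi> x) * J j s x) x"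
      by (rule pd_cong[OF open_ball x]) (rule chain(2))
    also have "\<dots> = (\<Sum>j\<in>UNIV. pd r (\<lambda>x. pd j f (\<phi> x) * J j s x) x)"
      by (intro pd_sum finite holo_at_mult hpp holo_J)
    also have "\<dots> = (\<Sum>j\<in>UNIV. (\<Sum>i\<in>UNIV. (\<Sum>k\<in>UNIV. christoffel g k i j (\<phi> x) * pd k f (\<phi> x)) * J i r x) * J j s x
        + pd j f (\<phi> x) * pd r (J j s) x)"
      by (intro sum.cong refl) (simp only: pd_mult[OF hpp holo_J] pp)
    also have "\<dots> = (\<Sum>j\<in>UNIV. \<Sum>i\<in>UNIV. \<Sum>k\<in>UNIV. pd k f (\<phi> x) * (christoffel g k i j (\<phi> x) * (J i r x * J j s x)))
        + (\<Sum>k\<in>UNIV. pd k f (\<phi> x) * pd r (J k s) x)"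
      unfolding sum.distrib sum_distrib_right
      by (intro arg_cong2[where f = "(+)"] sum.cong refl) (simp add: mult_ac)
    also have "(\<Sum>j\<in>UNIV. \<Sum>i\<in>UNIV. \<Sum>k\<in>UNIV. pd k f (\<phi> x) * (christoffel g k i j (\<phi> x) * (J i r x * J j s x))) =
        (\<Sum>k\<in>UNIV. \<Sum>i\<in>UNIV. \<Sum>j\<in>UNIV. pd k f (\<phi> x) * (christoffel g k i j (\<phi> x) * (J i r x * J j s x)))"
    proof -
      let ?t = "\<lambda>i j k. pd k f (\<phi> x) * (christoffel g k i j (\<phi> x) * (J i r x * J j s x))"
      have "(\<Sum>j\<in>UNIV. \<Sum>i\<in>UNIV. \<Sum>k\<in>UNIV. ?t i j k) = (\<Sum>i\<in>UNIV. \<Sum>j\<in>UNIV. \<Sum>k\<in>UNIV. ?t i j k)" by (rule sum.swap)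
      also have "\<dots> = (\<Sum>i\<in>UNIV. \<Sum>k\<in>UNIV. \<Sum>j\<in>UNIV. ?t i j k)" by (rule sum.cong[OF refl sum.swap])
      also have "\<dots> = (\<Sum>k\<in>UNIV. \<Sum>i\<in>UNIV. \<Sum>j\<in>UNIV. ?t i j k)" by (rule sum.swap)
      finally show ?thesis .
    qed
    also have "\<dots> = (\<Sum>k\<in>UNIV. pd k f (\<phi> x) * (\<Sum>i\<in>UNIV. \<Sum>j\<in>UNIV. christoffel g k i j (\<phi> x) * (J i r x * J j s x)))"
      by (simp only: sum_distrib_left)
    \<comment> \<open>The remaining sum carries the two derivatives of \<phi> in the other order,
      which \<open>mixed\<close> reconciles.\<close>
    also have "\<dots> = (\<Sum>k\<in>UNIV. pd k f (\<phi> x) * - pd s (J k r) x)" by (simp only: christoffel_pullback[OF w(2)])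
    also have "\<dots> + (\<Sum>k\<in>UNIV. pd k f (\<phi> x) * pd r (J k s) x) = 0"
      unfolding mixed[of r s] by (simp add: sum_negf)
    finally show ?thesis .
  qed
  have aff: "f (\<phi> x) = f (\<phi> y) + (\<Sum>s\<in>UNIV. (x $ s - y $ s) * pd s (\<lambda>x. f (\<phi> x)) y)" if "x \<in> ball y d" for x
    by (rule pd_pd_zero_affine[OF chain(1) second that])
  have yd: "y \<in> ball y d" using d(1) by simp
  show ?thesis
  proof (intro exI[of _ d] conjI ballI)
    fix x assume "x \<in> ball y d"
    from aff[OF this]
    show "f (\<phi> x) = f (\<phi> y) + (\<Sum>s\<in>UNIV. (x $ s - y $ s) * (\<Sum>j\<in>UNIV. pd j f (\<phi> y) * J j s y))"
      unfolding chain(2)[OF yd] .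
  qed (rule d(1))
qed

end

section \<open>Functions on the universal cover\<close>

lemma ucover_pathsD:
  assumes "\<gamma> \<in> ucover_paths X b"
  shows "path \<gamma>" "path_image \<gamma> \<subseteq> X" "pathstart \<gamma> = b" "pathfinish \<gamma> \<in> X"
proof -
  show "path \<gamma>" "path_image \<gamma> \<subseteq> X" "pathstart \<gamma> = b" using assms unfolding ucover_paths_def by blast+
  then show "pathfinish \<gamma> \<in> X" using pathfinish_in_path_image by blast
qed

lemma ucover_pathsI: "path \<gamma> \<Longrightarrow> path_image \<gamma> \<subseteq> X \<Longrightarrow> pathstart \<gamma> = b \<Longrightarrow> \<gamma> \<in> ucover_paths X b"
  unfolding ucover_paths_def by blast

lemma ucover_paths_join:
  assumes "\<gamma> \<in> ucover_paths X b" "path \<zeta>" "path_image \<zeta> \<subseteq> X" "pathstart \<zeta> = pathfinish \<gamma>"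
  shows "\<gamma> +++ \<zeta> \<in> ucover_paths X b"
  using assms ucover_pathsD[OF assms(1)] by (intro ucover_pathsI) (simp_all add: path_image_join)

text \<open>The codomain is arbitrary so that vector valued functions on the cover, such as
  \<open>v\<close>, are included.\<close>

definition homotopy_invariant :: "(complex^'n::finite) set \<Rightarrow> complex^'n \<Rightarrow> ((real \<Rightarrow> complex^'n) \<Rightarrow> 'b) \<Rightarrow> bool" where
  "homotopy_invariant X b F \<longleftrightarrow> (\<forall>\<gamma>\<in>ucover_paths X b. \<forall>\<delta>. homotopic_paths X \<gamma> \<delta> \<longrightarrow> F \<gamma> = F \<delta>)"

lemma homotopy_invariantD:
  "homotopy_invariant X b F \<Longrightarrow> \<gamma> \<in> ucover_paths X b \<Longrightarrow> homotopic_paths X \<gamma> \<delta> \<Longrightarrow> F \<gamma> = F \<delta>"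
  unfolding homotopy_invariant_def by blast

lemma homotopic_paths_convex:
  fixes C :: "'a::real_normed_vector set"
  assumes "convex C" "C \<subseteq> X" "path p" "path q" "path_image p \<subseteq> C" "path_image q \<subseteq> C"
    "pathstart p = pathstart q" "pathfinish p = pathfinish q"
  shows "homotopic_paths X p q"
proof -
  have "homotopic_paths C p q"
    using convex_imp_simply_connected[OF assms(1)] unfolding simply_connected_eq_homotopic_paths
    by (elim conjE allE[of _ p] allE[of _ q] impE) (use assms(3-) in auto)
  then show ?thesis using assms(2) by (rule homotopic_paths_subset)
qed

lemma linepath_in_convex: "convex C \<Longrightarrow> p \<in> C \<Longrightarrow> q \<in> C \<Longrightarrow> path_image (linepath p q) \<subseteq> C"
  by (simp add: closed_segment_subset)

text \<open>\<open>branch\<close> with arbitrary codomain.\<close>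

definition vbranch :: "((real \<Rightarrow> complex^'n::finite) \<Rightarrow> 'b) \<Rightarrow> (real \<Rightarrow> complex^'n) \<Rightarrow> complex^'n \<Rightarrow> 'b" where
  "vbranch F \<gamma> q = F (\<gamma> +++ linepath (pathfinish \<gamma>) q)"

lemma vbranch_nth: "vbranch (\<lambda>\<gamma>. F \<gamma> $ a) \<delta> q = vbranch F \<delta> q $ a"
  by (simp add: vbranch_def)

lemma branch_vbranch: "branch F = vbranch F"
  by (simp add: fun_eq_iff branch_def vbranch_def)

section \<open>Local branches on the universal cover\<close>

context
  fixes X :: "(complex^'n::finite) set" and b :: "complex^'n" and F :: "(real \<Rightarrow> complex^'n) \<Rightarrow> 'b"
  assumes inv: "homotopy_invariant X b F"
begin

lemma extend_in_convex:
  assumes a: "\<alpha> \<in> ucover_paths X b" and C: "convex C" "C \<subseteq> X"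
    and z: "path \<zeta>" "path_image \<zeta> \<subseteq> C" "pathstart \<zeta> = pathfinish \<alpha>"
  shows "F (\<alpha> +++ \<zeta>) = vbranch F \<alpha> (pathfinish \<zeta>)"
proof -
  have ends: "pathfinish \<alpha> \<in> C" "pathfinish \<zeta> \<in> C"
    using z pathstart_in_path_image[of \<zeta>] pathfinish_in_path_image[of \<zeta>] by auto
  have "homotopic_paths X \<zeta> (linepath (pathfinish \<alpha>) (pathfinish \<zeta>))"
    using z ends linepath_in_convex[OF C(1) ends] by (intro homotopic_paths_convex[OF C]) simp_all
  then have "homotopic_paths X (\<alpha> +++ \<zeta>) (\<alpha> +++ linepath (pathfinish \<alpha>) (pathfinish \<zeta>))"
    using ucover_pathsD[OF a] z by (intro homotopic_paths_join) simp_all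
  moreover have "\<alpha> +++ \<zeta> \<in> ucover_paths X b"
    using z C by (intro ucover_paths_join[OF a]) auto
  ultimately show ?thesis unfolding vbranch_def using homotopy_invariantD[OF inv] by blast
qed

text \<open>Compatibility of the charts of the cover: inside a convex set all paths with given ends
  are homotopic, so extending the path there does not change the local function.\<close>

lemma vbranch_extend:
  assumes a: "\<alpha> \<in> ucover_paths X b" and C: "convex C" "C \<subseteq> X"
    and z: "path \<zeta>" "path_image \<zeta> \<subseteq> C" "pathstart \<zeta> = pathfinish \<alpha>" and q: "q \<in> C"
  shows "vbranch F (\<alpha> +++ \<zeta>) q = vbranch F \<alpha> q"
proof -
  let ?l = "linepath (pathfinish \<zeta>) q"
  have e: "pathfinish \<zeta> \<in> C" using z pathfinish_in_path_image[of \<zeta>] by auto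
  note l = linepath_in_convex[OF C(1) e q]
  have "(\<alpha> +++ \<zeta>) +++ ?l \<in> ucover_paths X b"
    using z C l by (intro ucover_paths_join a) auto
  moreover have "homotopic_paths X (\<alpha> +++ (\<zeta> +++ ?l)) ((\<alpha> +++ \<zeta>) +++ ?l)"
    using ucover_pathsD[OF a] z C l by (intro homotopic_paths_assoc) auto
  ultimately have "F ((\<alpha> +++ \<zeta>) +++ ?l) = F (\<alpha> +++ (\<zeta> +++ ?l))"
    using homotopy_invariantD[OF inv] homotopic_paths_sym by blast
  also have "\<dots> = vbranch F \<alpha> (pathfinish (\<zeta> +++ ?l))"
    using z l by (intro extend_in_convex[OF a C]) (simp_all add: path_image_join)
  finally show ?thesis by (simp add: vbranch_def)
qed

lemma vbranch_cong:
  assumes a: "\<alpha> \<in> ucover_paths X b" and h: "homotopic_paths X \<alpha> \<beta>"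
    and q: "path_image (linepath (pathfinish \<alpha>) q) \<subseteq> X"
  shows "vbranch F \<alpha> q = vbranch F \<beta> q"
proof -
  have e: "pathfinish \<beta> = pathfinish \<alpha>" using homotopic_paths_imp_pathfinish[OF h] by simp
  have "homotopic_paths X (\<alpha> +++ linepath (pathfinish \<alpha>) q) (\<beta> +++ linepath (pathfinish \<alpha>) q)"
    using h q by (intro homotopic_paths_join) simp_all
  moreover have "\<alpha> +++ linepath (pathfinish \<alpha>) q \<in> ucover_paths X b"
    using q by (intro ucover_paths_join[OF a]) simp_all
  ultimately show ?thesis unfolding vbranch_def e using homotopy_invariantD[OF inv] by blast
qed

lemma vbranch_pathfinish:
  assumes a: "\<alpha> \<in> ucover_paths X b" shows "vbranch F \<alpha> (pathfinish \<alpha>) = F \<alpha>"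
proof -
  have "homotopic_paths X (\<alpha> +++ linepath (pathfinish \<alpha>) (pathfinish \<alpha>)) \<alpha>"
    using ucover_pathsD[OF a] by (intro homotopic_paths_rid)
  moreover have "\<alpha> +++ linepath (pathfinish \<alpha>) (pathfinish \<alpha>) \<in> ucover_paths X b"
    using ucover_pathsD[OF a] by (intro ucover_paths_join[OF a]) simp_all
  ultimately show ?thesis unfolding vbranch_def using homotopy_invariantD[OF inv] by blast
qed

text \<open>The form needed for continuation along \<eta>: truncations at nearby times define the
  same local function.\<close>

lemma vbranch_subpath:
  assumes a: "\<alpha> \<in> ucover_paths X b" and p: "path \<eta>" "path_image \<eta> \<subseteq> X" "pathfinish \<alpha> = \<eta> 0"
    and C: "convex C" "C \<subseteq> X" and t: "t \<in> {0..1}" "t0 \<in> {0..1}" "\<eta> ` closed_segment t0 t \<subseteq> C" and q: "q \<in> C"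
  shows "vbranch F (\<alpha> +++ subpath 0 t \<eta>) q = vbranch F (\<alpha> +++ subpath 0 t0 \<eta>) q"
proof -
  have sub: "path (subpath u v \<eta>)" "path_image (subpath u v \<eta>) \<subseteq> X" if "u \<in> {0..1}" "v \<in> {0..1}" for u v
    using that p path_image_subpath_subset[of u v \<eta>] by (auto intro: path_subpath)
  have z: "(0::real) \<in> {0..1}" by simp
  let ?s = "subpath 0 t0 \<eta>" and ?d = "subpath t0 t \<eta>"
  have d: "path_image ?d \<subseteq> C" using t(3) by (simp add: path_image_subpath_gen)
  have a0: "\<alpha> +++ ?s \<in> ucover_paths X b"
    using sub[OF z t(2)] p by (intro ucover_paths_join[OF a]) simp_all
  have e: "\<eta> t \<in> C" using t(3) by auto
  have at: "\<alpha> +++ subpath 0 t \<eta> \<in> ucover_paths X b"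
    using sub[OF z t(1)] p by (intro ucover_paths_join[OF a]) simp_all
  have "homotopic_paths X (subpath 0 t \<eta>) (?s +++ ?d)"
    using homotopic_join_subpaths[OF p(1,2), of 0 t0 t] t homotopic_paths_sym by auto
  then have "homotopic_paths X (\<alpha> +++ subpath 0 t \<eta>) (\<alpha> +++ (?s +++ ?d))"
    using ucover_pathsD[OF a] p by (intro homotopic_paths_join) simp_all
  moreover have "homotopic_paths X (\<alpha> +++ (?s +++ ?d)) ((\<alpha> +++ ?s) +++ ?d)"
    using ucover_pathsD[OF a] p sub[OF z t(2)] sub[OF t(2) t(1)]
    by (intro homotopic_paths_assoc) simp_all
  ultimately have h: "homotopic_paths X (\<alpha> +++ subpath 0 t \<eta>) ((\<alpha> +++ ?s) +++ ?d)" by (rule homotopic_paths_trans)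
  have "vbranch F (\<alpha> +++ subpath 0 t \<eta>) q = vbranch F ((\<alpha> +++ ?s) +++ ?d) q"
    using linepath_in_convex[OF C(1) e q] C(2)
    by (intro vbranch_cong[OF at h]) simp
  also have "\<dots> = vbranch F (\<alpha> +++ ?s) q"
    using sub[OF t(2) t(1)] d by (intro vbranch_extend[OF a0 C _ _ _ q]) simp_all
  finally show ?thesis .
qed

end

text \<open>The whole segment of times is controlled, as \<open>vbranch_subpath\<close>
  requires.\<close>

lemma path_near:
  assumes "path \<eta>" "t0 \<in> {0..1}" "open B" "\<eta> t0 \<in> B"
  shows "\<exists>d>0. \<forall>t\<in>{0..1}. dist t t0 < d \<longrightarrow> \<eta> ` closed_segment t0 t \<subseteq> B"
proof -
  have "continuous (at t0 within {0..1}) \<eta>" using assms(1,2) by (simp add: path_def continuous_on_eq_continuous_within)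
  then obtain d where d: "d > 0" "\<And>t. t \<in> {0..1} \<Longrightarrow> dist t t0 < d \<Longrightarrow> \<eta> t \<in> B"
    using assms(3,4) unfolding continuous_within_topological
    by (metis (no_types, lifting) open_dist dist_commute continuous_within_topological assms(2) Elementary_Metric_Spaces.open_contains_ball mem_ball)
  have "\<eta> ` closed_segment t0 t \<subseteq> B" if t: "t \<in> {0..1}" "dist t t0 < d" for t
  proof
    fix w assume "w \<in> \<eta> ` closed_segment t0 t"
    then obtain s where s: "s \<in> closed_segment t0 t" "w = \<eta> s" by blast
    then have "s \<in> {0..1}" using closed_segment_subset[of t0 "{0..1}" t] t assms(2) by auto
    moreover have "dist s t0 < d" using dist_in_closed_segment[OF s(1)] t(2) by (simp add: dist_commute)
    ultimately show "w \<in> B" using d s by blast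
  qed
  then show ?thesis using d(1) by blast
qed

lemma ucover_holomorphicD:
  assumes "ucover_holomorphic X b F"
  shows "homotopy_invariant X b F"
    "\<gamma> \<in> ucover_paths X b \<Longrightarrow> \<exists>\<epsilon>>0. ball (pathfinish \<gamma>) \<epsilon> \<subseteq> X \<and> (\<forall>w\<in>ball (pathfinish \<gamma>) \<epsilon>. holo_at (vbranch F \<gamma>) w)"
  using assms unfolding ucover_holomorphic_def homotopy_invariant_def branch_vbranch holomorphic_mv_holo_at by blast+

text \<open>The set of times at which the germ of \<open>F\<close> along a path vanishes is open and closed.\<close>

theorem ucover_holomorphic_identity:
  fixes X :: "(complex^'n::finite) set"
  assumes F: "ucover_holomorphic X b F" and a: "\<alpha> \<in> ucover_paths X b"
    and zero: "e > 0" "\<And>q. q \<in> ball (pathfinish \<alpha>) e \<Longrightarrow> vbranch F \<alpha> q = 0"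
    and d: "\<delta> \<in> ucover_paths X b"
  shows "F \<delta> = 0"
proof -
  note inv = ucover_holomorphicD(1)[OF F]
  \<comment> \<open>Back along \<alpha> and then along \<delta>, so that \<alpha> followed by \<eta>
    is homotopic to \<delta> and the germ can be transported from the end of \<alpha>.\<close>
  define \<eta> where "\<eta> = reversepath \<alpha> +++ \<delta>"
  have \<eta>: "path \<eta>" "path_image \<eta> \<subseteq> X" "pathstart \<eta> = pathfinish \<alpha>" "pathfinish \<eta> = pathfinish \<delta>"
    using ucover_pathsD[OF a] ucover_pathsD[OF d] by (simp_all add: \<eta>_def path_image_join)
  then have \<eta>0: "pathfinish \<alpha> = \<eta> 0" by (simp add: pathstart_def)
  define \<beta> where "\<beta> t = \<alpha> +++ subpath 0 t \<eta>" for t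
  have \<beta>: "\<beta> t \<in> ucover_paths X b" "pathfinish (\<beta> t) = \<eta> t" if "t \<in> {0..1}" for t
  proof -
    have "path (subpath 0 t \<eta>)" "path_image (subpath 0 t \<eta>) \<subseteq> X"
      using that \<eta> path_image_subpath_subset[of 0 t \<eta>] by (auto intro: path_subpath)
    then show "\<beta> t \<in> ucover_paths X b"
      unfolding \<beta>_def using \<eta>0 by (intro ucover_paths_join[OF a]) simp_all
    show "pathfinish (\<beta> t) = \<eta> t" by (simp add: \<beta>_def)
  qed
  define Q where "Q t \<longleftrightarrow> (\<exists>e>0. \<forall>q\<in>ball (\<eta> t) e. vbranch F (\<beta> t) q = 0)" for t
  have "Q 1"
  proof (rule connected_induction_simple[where S = "{0..1::real}" and P = Q and a = 0 and b = 1])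
    obtain r where r: "r > 0" "ball (pathfinish \<alpha>) r \<subseteq> X" using ucover_holomorphicD(2)[OF F a] by blast
    have \<beta>0: "\<beta> 0 = \<alpha> +++ linepath (pathfinish \<alpha>) (pathfinish \<alpha>)"
      by (simp add: \<beta>_def subpath_refl \<eta>0 linepath_def[abs_def] algebra_simps)
    have "vbranch F (\<beta> 0) q = 0" if "q \<in> ball (\<eta> 0) (min e r)" for q
    proof -
      have "vbranch F (\<beta> 0) q = vbranch F \<alpha> q"
        unfolding \<beta>0 using that r \<eta>0
        by (intro vbranch_extend[OF inv a convex_ball r(2)]) (simp_all add: pathstart_def)
      then show ?thesis using zero(2)[of q] that \<eta>0 by simp
    qed
    then show "Q 0" unfolding Q_def using zero(1) r(1) by (intro exI[of _ "min e r"]) simp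
  next
    fix t0 :: real assume t0: "t0 \<in> {0..1}"
    obtain r where r: "r > 0" "ball (\<eta> t0) r \<subseteq> X" "\<And>w. w \<in> ball (\<eta> t0) r \<Longrightarrow> holo_at (vbranch F (\<beta> t0)) w"
      using ucover_holomorphicD(2)[OF F \<beta>(1)[OF t0]] \<beta>(2)[OF t0] by metis
    obtain d where d: "d > 0" "\<And>t. t \<in> {0..1} \<Longrightarrow> dist t t0 < d \<Longrightarrow> \<eta> ` closed_segment t0 t \<subseteq> ball (\<eta> t0) r"
      using path_near[OF \<eta>(1) t0 open_ball, of "\<eta> t0" r] r(1) by auto
    have same: "vbranch F (\<beta> t) q = vbranch F (\<beta> t0) q"
      if "t \<in> {0..1}" "dist t t0 < d" "q \<in> ball (\<eta> t0) r" for t q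
      unfolding \<beta>_def using vbranch_subpath[OF inv a \<eta>(1,2) \<eta>0 convex_ball r(2) that(1) t0 d(2)[OF that(1,2)] that(3)] .
    have "Q t" if t: "t \<in> {0..1}" "dist t t0 < d" and s: "s \<in> {0..1}" "dist s t0 < d" and "Q s" for s t
    proof -
      have \<eta>s: "\<eta> s \<in> ball (\<eta> t0) r" "\<eta> t \<in> ball (\<eta> t0) r"        using d(2)[OF s] d(2)[OF t] ends_in_segment(2) unfolding image_subset_iff by blast+
      obtain e' where e': "e' > 0" "\<And>q. q \<in> ball (\<eta> s) e' \<Longrightarrow> vbranch F (\<beta> s) q = 0" using \<open>Q s\<close> unfolding Q_def by blast
      obtain e1 where e1: "e1 > 0" "ball (\<eta> s) e1 \<subseteq> ball (\<eta> t0) r" using \<eta>s(1) openE[OF open_ball] by blast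
      obtain e2 where e2: "e2 > 0" "ball (\<eta> t) e2 \<subseteq> ball (\<eta> t0) r" using \<eta>s(2) openE[OF open_ball] by blast
      \<comment> \<open>Times near \<open>t0\<close> share the local function at \<open>t0\<close>,
        so its vanishing near \<open>\<eta> s\<close> spreads over the whole ball.\<close>
      have "vbranch F (\<beta> t0) w = 0" if "w \<in> ball (\<eta> t0) r" for w
      proof (rule holo_at_ball_identity[OF r(3) \<eta>s(1), of "min e' e1"])
        fix q assume "q \<in> ball (\<eta> s) (min e' e1)"
        then have "q \<in> ball (\<eta> s) e'" "q \<in> ball (\<eta> t0) r" using e1(2) by auto
        then show "vbranch F (\<beta> t0) q = 0" using e'(2) same[OF s] by metis
      qed (use e' e1 that in auto)
      then have "vbranch F (\<beta> t) q = 0" if "q \<in> ball (\<eta> t) e2" for q using same[OF t] e2(2) that by (metis subsetD)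
      then show ?thesis unfolding Q_def using e2(1) by blast
    qed
    then have "\<forall>x\<in>{0..1} \<inter> ball t0 d. \<forall>y\<in>{0..1} \<inter> ball t0 d. Q x \<longrightarrow> Q y"
      by (intro ballI impI) (simp only: Int_iff mem_ball dist_commute, blast)
    moreover have "openin (top_of_set {0..1}) ({0..1} \<inter> ball t0 d)" by (rule openin_open_Int[OF open_ball])
    moreover have "t0 \<in> {0..1} \<inter> ball t0 d" using t0 d(1) by simp
    ultimately show "\<exists>T. openin (top_of_set {0..1}) T \<and> t0 \<in> T \<and> (\<forall>x\<in>T. \<forall>y\<in>T. Q x \<longrightarrow> Q y)" by blast
  qed auto
  then have "vbranch F (\<beta> 1) (\<eta> 1) = 0" unfolding Q_def using centre_in_ball by blast
  then have "F (\<beta> 1) = 0" using vbranch_pathfinish[OF inv \<beta>(1)[of 1]] \<beta>(2)[of 1] by simp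
  moreover have "homotopic_paths X (\<beta> 1) \<delta>"
  proof -
    note A = ucover_pathsD[OF a] and D = ucover_pathsD[OF d]
    have "\<beta> 1 = \<alpha> +++ (reversepath \<alpha> +++ \<delta>)" by (simp add: \<beta>_def \<eta>_def)
    moreover have "homotopic_paths X (\<alpha> +++ (reversepath \<alpha> +++ \<delta>)) ((\<alpha> +++ reversepath \<alpha>) +++ \<delta>)"
      using A D by (intro homotopic_paths_assoc) simp_all
    moreover have "homotopic_paths X ((\<alpha> +++ reversepath \<alpha>) +++ \<delta>) (linepath (pathstart \<alpha>) (pathstart \<alpha>) +++ \<delta>)"
      using A D by (intro homotopic_paths_join homotopic_paths_rinv) simp_all
    moreover have "homotopic_paths X (linepath (pathstart \<delta>) (pathstart \<delta>) +++ \<delta>) \<delta>"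
      using D by (intro homotopic_paths_lid)
    ultimately show ?thesis using A(3) D(3) by (metis homotopic_paths_trans)
  qed
  ultimately show ?thesis using homotopy_invariantD[OF inv \<beta>(1)[of 1]] by simp
qed

section \<open>The map \<open>phi\<close> and flat coordinates\<close>

context weighted_root_system
begin

section \<open>Derivatives of \<open>phi\<close>\<close>

lemma
  shows holo_character: "holo_at (character p) x"
    and pd_character: "pd r (character p) x = 2 * of_real pi * \<i> * of_real (p \<bullet> coroot (\<alpha> r)) * character p x"
proof -
  have h: "holo_at (\<lambda>x. x $ s * complex_of_real (p \<bullet> coroot (\<alpha> s))) x"
    and p: "pd r (\<lambda>x. x $ s * complex_of_real (p \<bullet> coroot (\<alpha> s))) x = (if r = s then complex_of_real (p \<bullet> coroot (\<alpha> s)) else 0)" for s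
    by (auto simp: pd_mult holo_at_nth holo_at_const pd_nth pd_const intro!: holo_at_mult)
  have hc: "holo_at (cpairing \<alpha> p) x"
    unfolding cpairing_def[abs_def] by (intro holo_at_sum finite h)
  have "pd r (cpairing \<alpha> p) x = (\<Sum>s\<in>UNIV. if r = s then complex_of_real (p \<bullet> coroot (\<alpha> s)) else 0)"
    unfolding cpairing_def[abs_def] by (subst pd_sum) (use h p in auto)
  then have pc: "pd r (cpairing \<alpha> p) x = complex_of_real (p \<bullet> coroot (\<alpha> r))" by simp
  have "((\<lambda>u. exp (2 * of_real pi * \<i> * u)) has_field_derivative (2 * of_real pi * \<i> * character p x)) (at (cpairing \<alpha> p x))"
    by (auto intro!: derivative_eq_intros simp: character_def)
  from holo_at_field_compose[OF hc this] pd_field_compose[OF hc this, of r]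
  show "holo_at (character p) x" "pd r (character p) x = 2 * of_real pi * \<i> * of_real (p \<bullet> coroot (\<alpha> r)) * character p x"
    unfolding character_def[abs_def] pc by simp_all
qed

lemma
  assumes "finite S"
  shows holo_character_sum: "holo_at (\<lambda>u. \<Sum>\<sigma>\<in>S. a \<sigma> * character (q \<sigma>) u) x"
    and pd_character_sum: "pd r (\<lambda>u. \<Sum>\<sigma>\<in>S. a \<sigma> * character (q \<sigma>) u) =
      (\<lambda>x. \<Sum>\<sigma>\<in>S. (a \<sigma> * (2 * of_real pi * \<i> * of_real (q \<sigma> \<bullet> coroot (\<alpha> r)))) * character (q \<sigma>) x)"
proof -
  have h: "holo_at (\<lambda>u. a \<sigma> * character (q \<sigma>) u) x" for \<sigma> x by (rule holo_at_cmult[OF holo_character])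
  show "holo_at (\<lambda>u. \<Sum>\<sigma>\<in>S. a \<sigma> * character (q \<sigma>) u) x" by (intro holo_at_sum assms h)
  show "pd r (\<lambda>u. \<Sum>\<sigma>\<in>S. a \<sigma> * character (q \<sigma>) u) =
      (\<lambda>x. \<Sum>\<sigma>\<in>S. (a \<sigma> * (2 * of_real pi * \<i> * of_real (q \<sigma> \<bullet> coroot (\<alpha> r)))) * character (q \<sigma>) x)"
    by (rule ext, subst pd_sum[OF assms h], rule sum.cong[OF refl])
      (simp only: pd_cmult[OF holo_character] pd_character mult.assoc)
qed

lemma phi_sum: "(\<lambda>u. phi u $ k) = (\<lambda>u. \<Sum>\<sigma>\<in>top_weyl k. 1 / of_nat (card (stab_weyl R (fund_weight \<alpha> k))) *
    character (\<sigma> (fund_weight \<alpha> k)) u)"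
  by (simp only: phi_nth sum_distrib_left)

lemma holo_phi: "holo_at (\<lambda>u. phi u $ k) x"
  unfolding phi_sum by (rule holo_character_sum[OF finite_top_weyl])

lemma pd_phi: "pd r (\<lambda>u. phi u $ k) = (\<lambda>x. \<Sum>\<sigma>\<in>top_weyl k. (1 / of_nat (card (stab_weyl R (fund_weight \<alpha> k))) *
    (2 * of_real pi * \<i> * of_real (\<sigma> (fund_weight \<alpha> k) \<bullet> coroot (\<alpha> r)))) * character (\<sigma> (fund_weight \<alpha> k)) x)"
  unfolding phi_sum by (rule pd_character_sum[OF finite_top_weyl])

lemma pd_pd_phi: "pd r (pd s (\<lambda>u. phi u $ k)) x = pd s (pd r (\<lambda>u. phi u $ k)) x"
  unfolding pd_phi pd_character_sum[OF finite_top_weyl] by (intro sum.cong refl) (simp add: mult_ac)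

text \<open>Far in the direction of \<open>-\<i> * rho_check\<close> the highest weights dominate and the Jacobian of \<open>phi\<close>
  becomes diagonal.\<close>

lemma phi_regular_point: "\<exists>x. det (\<chi> k r. pd r (\<lambda>u. phi u $ k) x) \<noteq> 0"
proof -
  define x where "x t = (- \<i> * of_real t) *s coords \<alpha> rho_check" for t :: real
  have ch: "character p (x t) = of_real (exp (2 * pi * t * (p \<bullet> rho_check)))" for p t
    unfolding character_def x_def cpairing_scale_right cpairing_coords exp_of_real[symmetric]
    by (rule arg_cong[where f = exp]) (simp add: algebra_simps)
  define c where "c k \<sigma> r = 1 / of_nat (card (stab_weyl R (fund_weight \<alpha> k))) *
    (2 * of_real pi * \<i> * complex_of_real (\<sigma> (fund_weight \<alpha> k) \<bullet> coroot (\<alpha> r)))" for k and \<sigma> :: "'a \<Rightarrow> 'a" and r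
  define h where "h k \<sigma> = (\<sigma> (fund_weight \<alpha> k) - fund_weight \<alpha> k) \<bullet> rho_check" for k and \<sigma> :: "'a \<Rightarrow> 'a"
  have h: "h k \<sigma> < 0 \<or> \<sigma> (fund_weight \<alpha> k) = fund_weight \<alpha> k" if "\<sigma> \<in> top_weyl k" for k \<sigma>
  proof -
    have "fund_weight \<alpha> k - \<sigma> (fund_weight \<alpha> k) \<in> root_cone"
      using that dominant_minus_weyl[OF fund_weight_dominant] unfolding top_weyl_def by blast
    then have "fund_weight \<alpha> k - \<sigma> (fund_weight \<alpha> k) \<noteq> 0 \<Longrightarrow> (fund_weight \<alpha> k - \<sigma> (fund_weight \<alpha> k)) \<bullet> rho_check > 0"
      by (rule root_cone_rho_check)
    then show ?thesis by (auto simp: h_def inner_diff_left)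
  qed
  \<comment> \<open>The \<open>k\<close>-th row of the Jacobian divided by the exponential of its
    highest weight, so that the limit exists.\<close>
  define M where "M t k r = (\<Sum>\<sigma>\<in>top_weyl k. c k \<sigma> r * of_real (exp (2 * pi * h k \<sigma> * t)))" for t k r
  have J: "pd r (\<lambda>u. phi u $ k) (x t) = of_real (exp (2 * pi * t * (fund_weight \<alpha> k \<bullet> rho_check))) * M t k r" for k r t
  proof -
    have "complex_of_real (exp (2 * pi * t * (\<sigma> (fund_weight \<alpha> k) \<bullet> rho_check))) =
        of_real (exp (2 * pi * t * (fund_weight \<alpha> k \<bullet> rho_check))) * of_real (exp (2 * pi * h k \<sigma> * t))" for \<sigma> :: "'a \<Rightarrow> 'a"
      unfolding of_real_mult[symmetric] exp_add[symmetric] h_def inner_diff_left by (simp add: algebra_simps)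
    then show ?thesis
      unfolding pd_phi ch M_def sum_distrib_left c_def[symmetric] by (intro sum.cong refl) (simp only: mult.left_commute)
  qed
  \<comment> \<open>In the limit only terms equal to the highest weight remain, and the fundamental
    weight pairs to zero with every other simple coroot.\<close>
  define L where "L k = (\<Sum>\<sigma>\<in>{\<sigma> \<in> top_weyl k. \<sigma> (fund_weight \<alpha> k) = fund_weight \<alpha> k}.
     1 / of_nat (card (stab_weyl R (fund_weight \<alpha> k))) * (2 * of_real pi * \<i>))" for k :: 'b
  have lim: "((\<lambda>t. M t k r) \<longlongrightarrow> (if k = r then L k else 0)) at_top" for k r
  proof -
    have "((\<lambda>t. c k \<sigma> r * of_real (exp (2 * pi * h k \<sigma> * t))) \<longlongrightarrow>
        (if \<sigma> (fund_weight \<alpha> k) = fund_weight \<alpha> k then c k \<sigma> r else 0)) at_top" if "\<sigma> \<in> top_weyl k" for \<sigma>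
    proof (cases "\<sigma> (fund_weight \<alpha> k) = fund_weight \<alpha> k")
      case True
      then show ?thesis by (simp add: h_def)
    next
      case False
      then have "2 * pi * h k \<sigma> < 0" using h[OF that] by (simp add: mult_pos_neg)
      then have "filterlim (\<lambda>t. 2 * pi * h k \<sigma> * t) at_bot at_top"
        by (rule filterlim_tendsto_neg_mult_at_bot[OF tendsto_const _ filterlim_ident])
      then have "((\<lambda>t. exp (2 * pi * h k \<sigma> * t)) \<longlongrightarrow> 0) at_top" by (rule filterlim_compose[OF exp_at_bot])
      then have "((\<lambda>t. c k \<sigma> r * of_real (exp (2 * pi * h k \<sigma> * t))) \<longlongrightarrow> c k \<sigma> r * of_real 0) at_top"
        by (intro tendsto_intros)
      then show ?thesis using False by simp
    qed
    then have "((\<lambda>t. M t k r) \<longlongrightarrow> (\<Sum>\<sigma>\<in>top_weyl k. if \<sigma> (fund_weight \<alpha> k) = fund_weight \<alpha> k then c k \<sigma> r else 0)) at_top"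
      unfolding M_def by (rule tendsto_sum)
    also have "(\<Sum>\<sigma>\<in>top_weyl k. if \<sigma> (fund_weight \<alpha> k) = fund_weight \<alpha> k then c k \<sigma> r else 0) =
        (\<Sum>\<sigma>\<in>{\<sigma> \<in> top_weyl k. \<sigma> (fund_weight \<alpha> k) = fund_weight \<alpha> k}. c k \<sigma> r)"
      by (rule sum.inter_filter[OF finite_top_weyl, symmetric])
    also have "\<dots> = (if k = r then L k else 0)"
      unfolding L_def c_def by (auto simp: fund_weight_coroot)
    finally show ?thesis .
  qed
  have L: "L k \<noteq> 0" for k
  proof -
    have "id \<in> {\<sigma> \<in> top_weyl k. \<sigma> (fund_weight \<alpha> k) = fund_weight \<alpha> k}" using id_in_top_weyl by simp
    then have "card {\<sigma> \<in> top_weyl k. \<sigma> (fund_weight \<alpha> k) = fund_weight \<alpha> k} \<noteq> 0"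
      using finite_top_weyl by (metis (no_types, lifting) card_eq_0_iff empty_iff finite_Collect_conjI finite_subset mem_Collect_eq subsetI)
    then show ?thesis unfolding L_def using card_stab_pos[of "fund_weight \<alpha> k"] by simp
  qed
  have "((\<lambda>t. det (\<chi> k r. M t k r)) \<longlongrightarrow> det (\<chi> k r. if k = r then L k else 0)) at_top"
    unfolding det_def by (intro tendsto_intros) (simp add: lim)
  moreover have "det (\<chi> k r. if k = r then L k else 0) \<noteq> 0"
    by (subst det_diagonal) (simp_all add: L)
  ultimately have "\<forall>\<^sub>F t in at_top. det (\<chi> k r. M t k r) \<noteq> 0" by (rule tendsto_imp_eventually_ne)
  from eventually_happens'[OF trivial_limit_at_top_linorder this]
  obtain t where t: "det (\<chi> k r. M t k r) \<noteq> 0" by (elim exE)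
  \<comment> \<open>Restoring the nonzero row factors does not affect regularity.\<close>
  have "(\<chi> k r. pd r (\<lambda>u. phi u $ k) (x t)) = (\<chi> k. of_real (exp (2 * pi * t * (fund_weight \<alpha> k \<bullet> rho_check))) *s (\<chi> r. M t k r))"
    by (simp only: J vec_eq_iff vec_lambda_beta vector_smult_component) simp
  then have "det (\<chi> k r. pd r (\<lambda>u. phi u $ k) (x t)) \<noteq> 0" using t by (simp add: det_rows_mul)
  then show ?thesis by blast
qed

text \<open>Fundamental weights and simple coroots are dual bases, so the inverse Gram matrix of the
  coroots is the Gram matrix of the fundamental weights.\<close>

lemma inv_coroot_gram_sym: "transpose (inv_coroot_gram \<alpha>) = inv_coroot_gram \<alpha>"
proof -
  let ?G = "\<chi> i j. coroot (\<alpha> i) \<bullet> coroot (\<alpha> j)" and ?B = "\<chi> r s. fund_weight \<alpha> r \<bullet> fund_weight \<alpha> s"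
  have "(?B ** ?G) $ i $ j = mat 1 $ i $ j" for i j
  proof -
    have "(\<Sum>s\<in>UNIV. (fund_weight \<alpha> s \<bullet> fund_weight \<alpha> i) *\<^sub>R coroot (\<alpha> s)) = fund_weight \<alpha> i"
      using coroot_expansion[of "fund_weight \<alpha> i"] by simp
    then have "(\<Sum>s\<in>UNIV. (fund_weight \<alpha> s \<bullet> fund_weight \<alpha> i) *\<^sub>R coroot (\<alpha> s)) \<bullet> coroot (\<alpha> j) = fund_weight \<alpha> i \<bullet> coroot (\<alpha> j)"
      by (simp only:)
    then show ?thesis
      by (simp add: matrix_matrix_mult_def mat_def inner_sum_left fund_weight_coroot inner_commute[of "fund_weight \<alpha> i"])
  qed
  then have BG: "?B ** ?G = mat 1" by (simp only: vec_eq_iff) blast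
  then have GB: "?G ** ?B = mat 1" using matrix_left_right_inverse by blast
  have "?G ** matrix_inv ?G = mat 1 \<and> matrix_inv ?G ** ?G = mat 1"
    unfolding matrix_inv_def by (rule someI[of "\<lambda>N. ?G ** N = mat 1 \<and> N ** ?G = mat 1" ?B]) (use BG GB in blast)
  then have "?B ** (?G ** matrix_inv ?G) = ?B" by (simp only: matrix_mul_rid)
  then have "matrix_inv ?G = ?B" unfolding matrix_mul_assoc BG by (simp only: matrix_mul_lid)
  then show ?thesis by (simp add: inv_coroot_gram_def transpose_def inner_commute)
qed

end

lemma holo_polynomial_mv:
  fixes f :: "complex^'n::finite \<Rightarrow> complex"
  assumes "polynomial_mv f" shows "holo_at f w"
proof -
  from assms obtain p :: "(nat^'n) \<Rightarrow>\<^sub>0 complex" where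
    "\<forall>z. f z = (\<Sum>e\<in>Poly_Mapping.keys p. Poly_Mapping.lookup p e * (\<Prod>i\<in>UNIV. (z $ i) ^ (e $ i)))"
    unfolding polynomial_mv_def by (elim exE)
  then have f: "f = (\<lambda>z. \<Sum>e\<in>Poly_Mapping.keys p. Poly_Mapping.lookup p e * (\<Prod>i\<in>UNIV. (z $ i) ^ (e $ i)))"
    by (intro ext) (rule spec)
  show ?thesis unfolding f
    by (intro holo_at_sum holo_at_cmult holo_at_prod holo_at_power holo_at_nth finite finite_keys)
qed

section \<open>The regular set, its preimage and the flat coordinates\<close>

locale flat_pencil = weighted_root_system +
  fixes z :: "'b \<Rightarrow> complex \<Rightarrow> complex^'b \<Rightarrow> complex" and g \<eta> :: "complex^'b \<Rightarrow> complex^'b^'b"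
    and z0 :: "complex^'b" and v :: "(real \<Rightarrow> complex^'b) \<Rightarrow> complex^'b"
  assumes pencil: "pencil_generators R \<alpha> m z g \<eta>"
    and z0: "z0 \<in> M_D m \<eta> - Sigma_D m g \<eta>"
    and flat: "flat_coordinates (M_D m \<eta> - Sigma_D m g \<eta>) z0 g v"
begin

abbreviation X :: "(complex^'b) set" where
  "X \<equiv> M_D m \<eta> - Sigma_D m g \<eta>"

abbreviation paths :: "(real \<Rightarrow> complex^'b) set" where
  "paths \<equiv> ucover_paths X z0"

text \<open>One holomorphic function for everything that is removed, so that
  \<open>path_connected_nonzero\<close> applies both to \<open>X\<close> and to its preimage under
  \<open>phi\<close>.\<close>

definition discriminant :: "complex^'b \<Rightarrow> complex" where
  "discriminant w = det (\<eta> w) * det (g w) * (\<Prod>i\<in>{i. m i > 0}. w $ i)"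

lemma X_eq: "X = {w. discriminant w \<noteq> 0}"
proof -
  have p: "(\<Prod>i\<in>{i. m i > 0}. w $ i) = 0 \<longleftrightarrow> (\<exists>i. m i > 0 \<and> w $ i = 0)" for w :: "complex^'b"
    by (subst prod_zero_iff) auto
  show ?thesis
    unfolding discriminant_def M_D_def D_eta_def D_zero_def Sigma_D_def set_eq_iff mult_eq_0_iff p by blast
qed

lemma holo_g: "holo_at (\<lambda>w. g w $ i $ j) w" and holo_eta: "holo_at (\<lambda>w. \<eta> w $ i $ j) w"
  using pencil unfolding pencil_generators_def by (intro holo_polynomial_mv; blast)+

lemma holo_discriminant: "holo_at discriminant w"
proof -
  have "holo_at (\<lambda>w. det (\<eta> w) * det (g w) * (\<Prod>i\<in>{i. m i > 0}. w $ i)) w"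
    by (intro holo_at_mult holo_at_det holo_at_prod holo_at_nth holo_g holo_eta finite)
  then show ?thesis by (simp only: discriminant_def[abs_def])
qed

lemma path_connected_X: "path_connected X"
  unfolding X_eq by (rule path_connected_nonzero) (rule holo_discriminant)

definition base_metric :: "complex^'b^'b" where
  "base_metric = (\<chi> r s. 1 / (4 * (of_real pi)\<^sup>2) * of_real (inv_coroot_gram \<alpha> $ r $ s))"

text \<open>The pencil identity at \<lambda> = 0, where the term with \<eta> drops out.\<close>

lemma pulled_back_metric:
  "g (phi x) = (\<chi> k r. pd r (\<lambda>u. phi u $ k) x) ** base_metric ** transpose (\<chi> k r. pd r (\<lambda>u. phi u $ k) x)"
proof -
  let ?J = "\<lambda>k r. pd r (\<lambda>u. phi u $ k) x" and ?A = "\<lambda>r s. complex_of_real (inv_coroot_gram \<alpha> $ r $ s)"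
  have proper: "proper_generators R \<alpha> m z" using pencil unfolding pencil_generators_def by blast
  have z: "z i 0 = (\<lambda>u. phi u $ i)" for i
    using proper_generators_zero[OF proper] by (metis vec_lambda_beta)
  have "pencil_metric \<alpha> z i j 0 x = g (\<chi> k. z k 0 x) $ i $ j + 0 * \<eta> (\<chi> k. z k 0 x) $ i $ j" for i j
    using pencil unfolding pencil_generators_def by blast
  then have "g (phi x) $ i $ j = pencil_metric \<alpha> z i j 0 x" for i j
    unfolding proper_generators_zero[OF proper] by simp
  also have "pencil_metric \<alpha> z i j 0 x = (\<Sum>r\<in>UNIV. \<Sum>s\<in>UNIV. ?J i r * (1 / (4 * (of_real pi)\<^sup>2) * ?A r s) * ?J j s)" for i j
    unfolding pencil_metric_def z sum_distrib_left by (simp add: mult_ac)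
  also have "\<dots> i j = (\<Sum>s\<in>UNIV. \<Sum>r\<in>UNIV. ?J i r * (1 / (4 * (of_real pi)\<^sup>2) * ?A r s) * ?J j s)" for i j
    by (rule sum.swap)
  finally show ?thesis
    unfolding vec_eq_iff
    by (simp add: matrix_matrix_mult_def transpose_def base_metric_def sum_distrib_right)
qed

sublocale pull: metric_pullback phi g base_metric
proof
  show "transpose base_metric = base_metric"
  proof -
    have "inv_coroot_gram \<alpha> $ s $ r = inv_coroot_gram \<alpha> $ r $ s" for r s
      using arg_cong[OF inv_coroot_gram_sym, of "\<lambda>M. M $ r $ s"] by (simp add: transpose_def)
    then show ?thesis by (simp add: base_metric_def transpose_def vec_eq_iff)
  qed
qed (rule holo_phi pd_pd_phi holo_g pulled_back_metric)+

lemma phi_X: "phi y \<in> X \<Longrightarrow> det (g (phi y)) \<noteq> 0"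
  by (auto simp: X_eq discriminant_def)

lemma continuous_phi: "continuous_on A phi"
proof -
  have "continuous_on A (\<lambda>x. phi x $ k)" for k
    by (intro continuous_at_imp_continuous_on ballI holo_at_continuous holo_phi)
  then have "continuous_on A (\<lambda>x. \<chi> k. phi x $ k)" by (rule continuous_on_vec_lambda)
  then show ?thesis by (simp only: vec_nth_inverse)
qed

text \<open>A right inverse of the derivative at \<open>y\<close> suffices for openness at this
  point.\<close>

lemma phi_open_at:
  assumes "det (pull.Jac y) \<noteq> 0" "d > 0" shows "\<exists>e>0. ball (phi y) e \<subseteq> phi ` ball y d"
proof -
  let ?J = "pull.Jac y"
  have "((*v) ?J) = (\<lambda>u. \<chi> k. \<Sum>i\<in>UNIV. u $ i * pd i (\<lambda>u. phi u $ k) y)"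
    by (simp add: fun_eq_iff matrix_vector_mult_def vec_eq_iff mult.commute)
  moreover have "(phi has_derivative (\<lambda>u. \<chi> k. \<Sum>i\<in>UNIV. u $ i * pd i (\<lambda>u. phi u $ k) y)) (at y)"
    by (rule has_derivative_vecI) (simp add: holo_at_derivative holo_phi)
  ultimately have der: "(phi has_derivative ((*v) ?J)) (at y)" by (simp only:)
  have "((*v) ?J) \<circ> ((*v) (matrix_inv ?J)) = id"
    by (rule ext) (simp only: o_apply id_apply matrix_vector_mul_assoc matrix_inverse_facts[OF assms(1)] matrix_vector_mul_lid)
  moreover have "bounded_linear ((*v) (matrix_inv ?J))" by (rule matrix_vector_mul_bounded_linear)
  moreover have "y \<in> interior (ball y d)" using assms(2) by simp
  ultimately have "phi y \<in> interior (phi ` ball y d)"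
    using sussmann_open_mapping[OF open_UNIV continuous_phi UNIV_I der, of "(*v) (matrix_inv ?J)" "ball y d"] by blast
  then show ?thesis by (simp only: mem_interior)
qed

definition Y :: "(complex^'b) set" where
  "Y = {y. phi y \<in> X}"

text \<open>Near a regular point the image of \<open>phi\<close> contains a ball. If the
  discriminant vanished there, it would vanish everywhere, in particular at
  \<open>z0\<close>.\<close>

lemma Y_nonempty: "\<exists>y. y \<in> Y"
proof (rule ccontr)
  assume neg: "\<not> ?thesis"
  obtain x where x: "det (pull.Jac x) \<noteq> 0" using phi_regular_point by blast
  obtain e where e: "e > 0" "ball (phi x) e \<subseteq> phi ` ball x 1" using phi_open_at[OF x zero_less_one] by blast
  have zero: "discriminant q = 0" if "q \<in> ball (phi x) e" for q
    using that e(2) neg by (auto simp: Y_def X_eq)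
  have "discriminant z0 = 0"
  proof (rule holo_at_ball_identity[of "phi x" "dist (phi x) z0 + 1" discriminant "phi x" e])
    show "discriminant w = 0" if "w \<in> ball (phi x) e" for w using zero that .
  qed (use e holo_discriminant in \<open>auto intro: add_nonneg_pos\<close>)
  then show False using z0 unfolding X_eq by simp
qed

lemma path_connected_Y: "path_connected Y"
proof -
  have "holo_at (\<lambda>x. discriminant (phi x)) x" for x by (rule holo_at_compose[OF holo_discriminant holo_phi])
  then have "path_connected {x. discriminant (phi x) \<noteq> 0}" by (rule path_connected_nonzero)
  then show ?thesis unfolding Y_def X_eq by simp
qed

lemma v_component: "ucover_holomorphic X z0 (\<lambda>\<gamma>. v \<gamma> $ a)"
  using flat unfolding flat_coordinates_def flat_function_def by blast

lemma v_invariant: "homotopy_invariant X z0 v"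
proof -
  have "homotopy_invariant X z0 (\<lambda>\<gamma>. v \<gamma> $ a)" for a by (rule ucover_holomorphicD(1)[OF v_component])
  then show ?thesis unfolding homotopy_invariant_def vec_eq_iff by blast
qed

text \<open>The equations are imposed at end points of paths only. Extending the path by a segment
  moves the end point through the ball without changing the local function.\<close>

lemma flat_equation_near:
  assumes d: "\<delta> \<in> paths" and B: "ball (pathfinish \<delta>) e \<subseteq> X" and w: "w \<in> ball (pathfinish \<delta>) e"
  shows "pd i (pd j (vbranch (\<lambda>\<gamma>. v \<gamma> $ a) \<delta>)) w =
    (\<Sum>k\<in>UNIV. christoffel g k i j w * pd k (vbranch (\<lambda>\<gamma>. v \<gamma> $ a) \<delta>) w)"
proof -
  let ?F = "\<lambda>\<gamma>. v \<gamma> $ a" and ?l = "linepath (pathfinish \<delta>) w" and ?B = "ball (pathfinish \<delta>) e"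
  have c: "pathfinish \<delta> \<in> ?B" using w by (auto intro: le_less_trans[OF zero_le_dist])
  note l = linepath_in_convex[OF convex_ball c w]
  have p: "\<delta> +++ ?l \<in> paths" using l B by (intro ucover_paths_join[OF d]) auto
  have eq: "vbranch ?F (\<delta> +++ ?l) q = vbranch ?F \<delta> q" if "q \<in> ?B" for q
    using l that by (intro vbranch_extend[OF ucover_holomorphicD(1)[OF v_component] d convex_ball B]) simp_all
  have 1: "pd k (vbranch ?F (\<delta> +++ ?l)) q = pd k (vbranch ?F \<delta>) q" if "q \<in> ?B" for k q
    by (rule pd_cong[OF open_ball that eq])
  have 2: "pd i (pd j (vbranch ?F (\<delta> +++ ?l))) w = pd i (pd j (vbranch ?F \<delta>)) w"
    by (rule pd_cong[OF open_ball w 1])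
  have "flat_function X z0 g ?F" using flat unfolding flat_coordinates_def by blast
  then have "pd i (pd j (vbranch ?F (\<delta> +++ ?l))) (pathfinish (\<delta> +++ ?l)) =
        (\<Sum>k\<in>UNIV. christoffel g k i j (pathfinish (\<delta> +++ ?l)) * pd k (vbranch ?F (\<delta> +++ ?l)) (pathfinish (\<delta> +++ ?l)))"
    using p unfolding flat_function_def branch_vbranch by blast
  then show ?thesis unfolding pathfinish_join pathfinish_linepath 2 1[OF w] .
qed

text \<open>\<open>flat_pullback\<close> in each component. The linear part is the Jacobian of the
  flat coordinates times that of \<open>phi\<close>, both invertible over the regular set.\<close>

theorem v_affine_near:
  assumes d: "\<delta> \<in> paths" and y: "phi y = pathfinish \<delta>"
  shows "\<exists>e M B. e > 0 \<and> det M \<noteq> 0 \<and> (\<forall>x\<in>ball y e. vbranch v \<delta> (phi x) = M *v x + B)"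
proof -
  have yX: "phi y \<in> X" using ucover_pathsD(4)[OF d] y by simp
  note reg = phi_X[OF yX]
  define N where "N a s = (\<Sum>j\<in>UNIV. pd j (vbranch (\<lambda>\<gamma>. v \<gamma> $ a) \<delta>) (phi y) * pull.J j s y)" for a s
  have "\<exists>e>0. \<forall>x\<in>ball y e. vbranch v \<delta> (phi x) $ a = vbranch v \<delta> (phi y) $ a + (\<Sum>s\<in>UNIV. (x $ s - y $ s) * N a s)" for a
  proof -
    obtain e where e: "e > 0" "ball (pathfinish \<delta>) e \<subseteq> X"
      "\<And>w. w \<in> ball (pathfinish \<delta>) e \<Longrightarrow> holo_at (vbranch (\<lambda>\<gamma>. v \<gamma> $ a) \<delta>) w"
      using ucover_holomorphicD(2)[OF v_component d, of a] by blast
    from pull.flat_pullback[OF reg e(1), of "vbranch (\<lambda>\<gamma>. v \<gamma> $ a) \<delta>"] e(3) flat_equation_near[OF d e(2)]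
    show ?thesis unfolding y N_def vbranch_nth by blast
  qed
  then obtain r where r: "\<And>a. r a > 0" "\<And>a x. x \<in> ball y (r a) \<Longrightarrow>
      vbranch v \<delta> (phi x) $ a = vbranch v \<delta> (phi y) $ a + (\<Sum>s\<in>UNIV. (x $ s - y $ s) * N a s)" by metis
  define e where "e = Min (range r)"
  have e: "e > 0" "e \<le> r a" for a using r(1) by (auto simp: e_def)
  let ?M = "\<chi> a s. N a s"
  have "?M = (\<chi> a k. pd k (branch (\<lambda>\<gamma>. v \<gamma> $ a) \<delta>) (pathfinish \<delta>)) ** pull.Jac y"
    unfolding N_def branch_vbranch y by (simp add: matrix_matrix_mult_def vec_eq_iff)
  moreover have "det (\<chi> a k. pd k (branch (\<lambda>\<gamma>. v \<gamma> $ a) \<delta>) (pathfinish \<delta>)) \<noteq> 0"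
    using flat d unfolding flat_coordinates_def by blast
  ultimately have "det ?M \<noteq> 0" using pull.det_Jac[OF reg] by (simp add: det_mul)
  moreover have "vbranch v \<delta> (phi x) = ?M *v x + (vbranch v \<delta> (phi y) - ?M *v y)" if "x \<in> ball y e" for x
  proof -
    have "vbranch v \<delta> (phi x) $ a = (?M *v x + (vbranch v \<delta> (phi y) - ?M *v y)) $ a" for a
    proof -
      have "x \<in> ball y (r a)" using that e(2)[of a] by simp
      from r(2)[OF this] show ?thesis
        by (simp add: matrix_vector_mult_def right_diff_distrib sum_subtractf mult.commute)
    qed
    then show ?thesis by (simp only: vec_eq_iff) blast
  qed
  ultimately show ?thesis using e(1) by blast
qed

text \<open>An injective affine map factors through \<open>phi\<close> near \<open>y\<close>, by
  \<open>v_affine_near\<close> for any path ending at \<open>phi y\<close>.\<close>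

lemma phi_locally_injective:
  assumes "y \<in> Y" shows "\<exists>e>0. inj_on phi (ball y e)"
proof -
  have "phi y \<in> X" using assms by (simp add: Y_def)
  then obtain \<delta> where d: "path \<delta>" "path_image \<delta> \<subseteq> X" "pathstart \<delta> = z0" "pathfinish \<delta> = phi y"
    using path_connected_X z0 unfolding path_connected_def by blast
  then have "\<delta> \<in> paths" by (intro ucover_pathsI)
  then obtain e M B where e: "e > 0" "det M \<noteq> 0" "\<And>x. x \<in> ball y e \<Longrightarrow> vbranch v \<delta> (phi x) = M *v x + B"
    using v_affine_near[of \<delta> y] d(4) by metis
  have "inj_on phi (ball y e)"
  proof (rule inj_onI)
    fix x x' assume x: "x \<in> ball y e" "x' \<in> ball y e" "phi x = phi x'"
    then have "M *v x = M *v x'" using e(3)[of x] e(3)[of x'] by simp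
    then have "matrix_inv M *v (M *v x) = matrix_inv M *v (M *v x')" by simp
    then show "x = x'" by (simp only: matrix_vector_mul_assoc matrix_inverse_facts[OF e(2)] matrix_vector_mul_lid)
  qed
  then show ?thesis using e(1) by blast
qed

end

section \<open>Monodromy\<close>

lemma affine_eq_on_ball:
  fixes N1 N2 :: "complex^'n::finite^'n"
  assumes e: "e > 0" and eq: "\<And>x. x \<in> ball y e \<Longrightarrow> N1 *v x + n1 = N2 *v x + n2"
  shows "N1 *v x + n1 = N2 *v x + n2"
proof -
  define D where "D u = (N1 - N2) *v u + (n1 - n2)" for u
  have zero: "D u = 0" if "u \<in> ball y e" for u
    using eq[OF that] by (simp add: D_def matrix_vector_mult_diff_rdistrib algebra_simps)
  \<comment> \<open>The summand 1 keeps the denominator of \<open>t\<close> positive when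
    \<open>x = y\<close>.\<close>
  define n where "n = norm (x - y) + 1"
  have n: "n > 0" by (simp add: n_def add_nonneg_pos)
  define t where "t = e / (2 * n)"
  have t: "t > 0" using e n by (simp add: t_def)
  have "t * norm (x - y) < e"
  proof -
    have "t * norm (x - y) \<le> t * n" using t by (simp add: n_def)
    also have "t * n = e / 2" using n by (simp add: t_def)
    finally show ?thesis using e by simp
  qed
  then have "y + of_real t *s (x - y) \<in> ball y e"
  proof -
    have "of_real t *s (x - y) = t *\<^sub>R (x - y)"
      unfolding vec_eq_iff vector_scaleR_component vector_smult_component scaleR_conv_of_real[where 'a = complex] by simp
    then show ?thesis using t \<open>t * norm (x - y) < e\<close> by (simp add: dist_norm)
  qed
  then have "D (y + of_real t *s (x - y)) = 0" by (rule zero)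
  moreover have "D (y + of_real t *s (x - y)) = D y + of_real t *s ((N1 - N2) *v (x - y))"
    by (simp only: D_def matrix_vector_right_distrib vector_scalar_commute add.assoc add.commute add.left_commute)
  moreover have "D y = 0" using e by (intro zero) simp
  ultimately have "(N1 - N2) *v (x - y) = 0" using t by (simp add: vec_eq_iff)
  then have "D x = 0" using \<open>D y = 0\<close> by (simp add: D_def matrix_vector_mult_diff_distrib)
  then show ?thesis by (simp add: D_def matrix_vector_mult_diff_rdistrib algebra_simps)
qed

section \<open>Holomorphy of lifts and of affine changes of coordinates\<close>

lemma ucover_holomorphicI:
  assumes "homotopy_invariant X b F"
    and "\<And>\<gamma>. \<gamma> \<in> ucover_paths X b \<Longrightarrow> \<exists>e>0. ball (pathfinish \<gamma>) e \<subseteq> X \<and> (\<forall>w\<in>ball (pathfinish \<gamma>) e. holo_at (vbranch F \<gamma>) w)"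
  shows "ucover_holomorphic X b F"
  using assms unfolding ucover_holomorphic_def homotopy_invariant_def branch_vbranch holomorphic_mv_holo_at by blast

lemma holo_at_matrix_vector:
  fixes K :: "complex^'m::finite^'n::finite"
  assumes "\<And>a. holo_at (\<lambda>w. F w $ a) x"
  shows "holo_at (\<lambda>w. (K *v F w) $ k) x"
  unfolding matrix_vector_mult_def vec_lambda_beta by (intro holo_at_sum holo_at_cmult assms finite)

lemma affine_ext_matrix:
  "affine_ext \<alpha> \<phi> x = (\<chi> k r. coords \<alpha> (\<phi> (coroot (\<alpha> r)) - \<phi> 0) $ k) *v x + coords \<alpha> (\<phi> 0)"
  by (simp add: affine_ext_def matrix_vector_mult_def vec_eq_iff mult.commute)

lemma holo_at_affine_ext:
  assumes "\<And>a. holo_at (\<lambda>w. F w $ a) x" shows "holo_at (\<lambda>w. affine_ext \<alpha> \<phi> (F w) $ k) x"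
  unfolding affine_ext_matrix vector_add_component
  by (intro holo_at_add holo_at_matrix_vector holo_at_const assms)

lemma isCont_componentwise:
  fixes F :: "'a::t2_space \<Rightarrow> complex^'n::finite"
  assumes "\<And>k. isCont (\<lambda>w. F w $ k) x" shows "isCont F x"
  using assms unfolding isCont_def by (rule vec_tendstoI)

lemma (in flat_pencil) v_holo_near:
  assumes "\<gamma> \<in> paths"
  shows "\<exists>e>0. ball (pathfinish \<gamma>) e \<subseteq> X \<and> (\<forall>w\<in>ball (pathfinish \<gamma>) e. \<forall>a. holo_at (\<lambda>q. vbranch v \<gamma> q $ a) w)"
proof -
  have "\<exists>e>0. ball (pathfinish \<gamma>) e \<subseteq> X \<and> (\<forall>w\<in>ball (pathfinish \<gamma>) e. holo_at (\<lambda>q. vbranch v \<gamma> q $ a) w)" for a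
    using ucover_holomorphicD(2)[OF v_component assms, of a] unfolding vbranch_nth[abs_def] .
  then obtain r where r: "\<And>a. r a > 0" "\<And>a. ball (pathfinish \<gamma>) (r a) \<subseteq> X"
    "\<And>a w. w \<in> ball (pathfinish \<gamma>) (r a) \<Longrightarrow> holo_at (\<lambda>q. vbranch v \<gamma> q $ a) w" by metis
  define e where "e = Min (range r)"
  have e: "e > 0" "e \<le> r a" for a using r(1) by (auto simp: e_def)
  then have sub: "ball (pathfinish \<gamma>) e \<subseteq> ball (pathfinish \<gamma>) (r a)" for a by (intro subset_ball)
  show ?thesis
  proof (intro exI[of _ e] conjI ballI allI)
    show "ball (pathfinish \<gamma>) e \<subseteq> X" using sub r(2) by (rule subset_trans)
    fix w a assume "w \<in> ball (pathfinish \<gamma>) e"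
    then show "holo_at (\<lambda>q. vbranch v \<gamma> q $ a) w" using sub[of a] by (intro r(3)) blast
  qed (rule e(1))
qed

text \<open>A single germ of \<open>v\<close> is compared with the coordinates \<open>x\<close>; the
  affine change \<open>M\<close>, \<open>B\<close> found there is kept for the whole cover.\<close>

locale developed_pencil = flat_pencil +
  fixes M :: "complex^'b^'b" and B :: "complex^'b" and \<delta>1 y1 e1
  assumes det_M: "det M \<noteq> 0" and \<delta>1: "\<delta>1 \<in> paths" "phi y1 = pathfinish \<delta>1"
    and germ: "e1 > 0" "\<And>x. x \<in> ball y1 e1 \<Longrightarrow> vbranch v \<delta>1 (phi x) = M *v x + B"
begin

text \<open>The developing map: the flat coordinates after the affine change that makes them the
  multivalued inverse of \<open>phi\<close>.\<close>

definition lift :: "(real \<Rightarrow> complex^'b) \<Rightarrow> complex^'b" where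
  "lift \<delta> = matrix_inv M *v (v \<delta> - B)"

lemma M_inverse: "matrix_inv M *v (M *v x) = x" "M *v (matrix_inv M *v x) = x"
  by (simp_all only: matrix_vector_mul_assoc matrix_inverse_facts[OF det_M] matrix_vector_mul_lid)

lemma v_lift: "v \<delta> = M *v lift \<delta> + B"
  by (simp add: lift_def M_inverse)

lemma lift_invariant: "homotopy_invariant X z0 lift"
  using v_invariant unfolding homotopy_invariant_def lift_def by (metis (no_types, lifting))

lemma vbranch_lift: "vbranch lift \<gamma> q = matrix_inv M *v (vbranch v \<gamma> q - B)"
  by (simp add: vbranch_def lift_def)

lemma lift_holo_near:
  assumes "\<gamma> \<in> paths"
  shows "\<exists>e>0. ball (pathfinish \<gamma>) e \<subseteq> X \<and> (\<forall>w\<in>ball (pathfinish \<gamma>) e. \<forall>a. holo_at (\<lambda>q. vbranch lift \<gamma> q $ a) w)"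
proof -
  obtain e where e: "e > 0" "ball (pathfinish \<gamma>) e \<subseteq> X"
    "\<And>w a. w \<in> ball (pathfinish \<gamma>) e \<Longrightarrow> holo_at (\<lambda>q. vbranch v \<gamma> q $ a) w" using v_holo_near[OF assms] by blast
  have "holo_at (\<lambda>q. vbranch lift \<gamma> q $ a) w" if "w \<in> ball (pathfinish \<gamma>) e" for w a
    unfolding vbranch_lift
    by (rule holo_at_matrix_vector) (unfold vector_minus_component, intro holo_at_diff holo_at_const e(3)[OF that])
  then show ?thesis using e(1,2) by blast
qed

text \<open>True near the end of \<open>\<delta>1\<close> by the choice of \<open>M\<close> and
  \<open>B\<close>, hence on the whole cover by the identity theorem. It also shows that end points
  of paths from \<open>z0\<close> lie in the image of \<open>phi\<close>.\<close>

lemma phi_lift: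
  assumes d: "\<delta> \<in> paths" shows "phi (lift \<delta>) = pathfinish \<delta>"
proof -
  have "phi (lift \<delta>) $ k - pathfinish \<delta> $ k = 0" for k
  proof -
    let ?F = "\<lambda>\<delta>. phi (lift \<delta>) $ k - pathfinish \<delta> $ k"
    have br: "vbranch ?F \<gamma> = (\<lambda>q. phi (vbranch lift \<gamma> q) $ k - q $ k)" for \<gamma>
      by (simp add: vbranch_def fun_eq_iff)
    have "ucover_holomorphic X z0 ?F"
    proof (rule ucover_holomorphicI)
      have "?F \<gamma> = ?F \<delta>" if "\<gamma> \<in> paths" "homotopic_paths X \<gamma> \<delta>" for \<gamma> \<delta>
        using homotopy_invariantD[OF lift_invariant that] homotopic_paths_imp_pathfinish[OF that(2)] by simp
      then show "homotopy_invariant X z0 ?F" unfolding homotopy_invariant_def by blast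
      fix \<gamma> assume "\<gamma> \<in> paths"
      then obtain e where e: "e > 0" "ball (pathfinish \<gamma>) e \<subseteq> X"
        "\<And>w a. w \<in> ball (pathfinish \<gamma>) e \<Longrightarrow> holo_at (\<lambda>q. vbranch lift \<gamma> q $ a) w" using lift_holo_near by blast
      have "holo_at (vbranch ?F \<gamma>) w" if "w \<in> ball (pathfinish \<gamma>) e" for w
        unfolding br by (intro holo_at_diff holo_at_nth holo_at_compose[OF holo_phi] e(3)[OF that])
      then show "\<exists>e>0. ball (pathfinish \<gamma>) e \<subseteq> X \<and> (\<forall>w\<in>ball (pathfinish \<gamma>) e. holo_at (vbranch ?F \<gamma>) w)"
        using e(1,2) by blast
    qed
    \<comment> \<open>The germ is known at points \<open>phi x\<close>; openness of
      \<open>phi\<close> at \<open>y1\<close> makes these fill a ball of end points.\<close>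
    moreover have "phi y1 \<in> X" using ucover_pathsD(4)[OF \<delta>1(1)] \<delta>1(2) by simp
    then obtain e where e: "e > 0" "ball (phi y1) e \<subseteq> phi ` ball y1 e1"
      using phi_open_at[OF pull.det_Jac[OF phi_X] germ(1)] by blast
    have "vbranch ?F \<delta>1 q = 0" if q: "q \<in> ball (pathfinish \<delta>1) e" for q
    proof -
      obtain x where x: "x \<in> ball y1 e1" "q = phi x" using q e(2) \<delta>1(2) by auto
      then have "vbranch lift \<delta>1 q = x" using germ(2)[OF x(1)] by (simp add: vbranch_lift M_inverse)
      then show ?thesis by (simp add: br x(2))
    qed
    ultimately show ?thesis using ucover_holomorphic_identity[OF _ \<delta>1(1) e(1) _ d] by blast
  qed
  then show ?thesis by (simp add: vec_eq_iff)
qed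

lemma phi_vbranch_lift:
  assumes "\<gamma> \<in> paths" "ball (pathfinish \<gamma>) e \<subseteq> X" "w \<in> ball (pathfinish \<gamma>) e"
  shows "phi (vbranch lift \<gamma> w) = w"
proof -
  have "pathfinish \<gamma> \<in> ball (pathfinish \<gamma>) e" using assms(3) by (auto intro: le_less_trans[OF zero_le_dist])
  from linepath_in_convex[OF convex_ball this assms(3)]
  have "\<gamma> +++ linepath (pathfinish \<gamma>) w \<in> paths" using assms(2) by (intro ucover_paths_join[OF assms(1)]) auto
  from phi_lift[OF this] show ?thesis by (simp add: vbranch_def)
qed

text \<open>The base point of the cover.\<close>

definition origin :: "real \<Rightarrow> complex^'b" where
  "origin = linepath z0 z0"

lemma origin_path: "origin \<in> paths" and origin_finish: "pathfinish origin = z0"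
  using z0 by (auto simp: origin_def intro!: ucover_pathsI)

text \<open>Uniqueness of lifts: the development along truncations of \<open>phi \<circ> p\<close>
  and the path \<open>p\<close> have the same projection and the same start. Agreement is open by
  local injectivity of \<open>phi\<close> and closed by continuity.\<close>

lemma lift_path:
  assumes p: "path p" "path_image p \<subseteq> Y" "p 0 = lift origin"
  shows "phi \<circ> p \<in> paths" "lift (phi \<circ> p) = p 1"
proof -
  define \<gamma> where "\<gamma> = phi \<circ> p"
  have \<gamma>: "path \<gamma>" "path_image \<gamma> \<subseteq> X"
    using path_continuous_image[OF p(1) continuous_phi] p(2) by (auto simp: \<gamma>_def path_image_compose Y_def)
  have \<gamma>0: "\<gamma> 0 = z0" using phi_lift[OF origin_path] p(3) by (simp add: \<gamma>_def origin_finish)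
  then have start: "pathstart \<gamma> = z0" "pathfinish origin = \<gamma> 0" by (simp_all add: pathstart_def origin_finish)
  have \<gamma>_path: "\<gamma> \<in> paths" using \<gamma> start by (intro ucover_pathsI)
  then show "phi \<circ> p \<in> paths" by (simp add: \<gamma>_def)
  define \<beta> where "\<beta> t = origin +++ subpath 0 t \<gamma>" for t
  have \<beta>: "\<beta> t \<in> paths" "pathfinish (\<beta> t) = \<gamma> t" if "t \<in> {0..1}" for t
  proof -
    have "path (subpath 0 t \<gamma>)" "path_image (subpath 0 t \<gamma>) \<subseteq> X"
      using that \<gamma> path_image_subpath_subset[of 0 t \<gamma>] by (auto intro: path_subpath)
    then show "\<beta> t \<in> paths" unfolding \<beta>_def using start by (intro ucover_paths_join[OF origin_path]) simp_all
    show "pathfinish (\<beta> t) = \<gamma> t" by (simp add: \<beta>_def)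
  qed
  define Q where "Q t \<longleftrightarrow> lift (\<beta> t) = p t" for t
  have "Q 1"
  proof (rule connected_induction_simple[where S = "{0..1::real}" and P = Q and a = 0 and b = 1])
    have "\<beta> 0 = origin +++ linepath (pathfinish origin) (pathfinish origin)"
      by (simp add: \<beta>_def subpath_refl \<gamma>0 origin_finish linepath_def[abs_def] algebra_simps)
    then have "lift (\<beta> 0) = lift origin"
      using vbranch_pathfinish[OF lift_invariant origin_path] by (simp add: vbranch_def)
    then show "Q 0" using p(3) by (simp add: Q_def)
  next
    fix t0 :: real assume t0: "t0 \<in> {0..1}"
    obtain r where r: "r > 0" "ball (\<gamma> t0) r \<subseteq> X"
      "\<And>w a. w \<in> ball (\<gamma> t0) r \<Longrightarrow> holo_at (\<lambda>q. vbranch lift (\<beta> t0) q $ a) w"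
      using lift_holo_near[OF \<beta>(1)[OF t0]] unfolding \<beta>(2)[OF t0] by blast
    obtain d where d: "d > 0" "\<And>t. t \<in> {0..1} \<Longrightarrow> dist t t0 < d \<Longrightarrow> \<gamma> ` closed_segment t0 t \<subseteq> ball (\<gamma> t0) r"
      using path_near[OF \<gamma>(1) t0 open_ball, of "\<gamma> t0" r] r(1) by auto
    define u where "u t = vbranch lift (\<beta> t0) (\<gamma> t)" for t
    have lift_u: "lift (\<beta> t) = u t" if t: "t \<in> {0..1}" "dist t t0 < d" for t
    proof -
      have "\<gamma> t \<in> ball (\<gamma> t0) r" using d(2)[OF t] ends_in_segment(2) unfolding image_subset_iff by blast
      then have "vbranch lift (\<beta> t) (\<gamma> t) = u t"
        unfolding \<beta>_def u_def
        by (rule vbranch_subpath[OF lift_invariant origin_path \<gamma> start(2) convex_ball r(2) t(1) t0 d(2)[OF t]])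
      then show ?thesis using vbranch_pathfinish[OF lift_invariant \<beta>(1)[OF t(1)]] \<beta>(2)[OF t(1)] by simp
    qed
    have phi_u: "phi (u t) = phi (p t)" if t: "t \<in> {0..1}" "dist t t0 < d" for t
      using phi_lift[OF \<beta>(1)[OF t(1)]] lift_u[OF t] \<beta>(2)[OF t(1)] by (simp add: \<gamma>_def)
    have cont_p: "continuous (at t0 within {0..1}) p" and cont_g: "continuous (at t0 within {0..1}) \<gamma>"
      using p(1) \<gamma>(1) t0 by (simp_all add: path_def continuous_on_eq_continuous_within)
    have "isCont (vbranch lift (\<beta> t0)) (\<gamma> t0)"
      using r(1) by (intro isCont_componentwise holo_at_continuous r(3)) simp
    then have cont_u: "continuous (at t0 within {0..1}) u"
      unfolding u_def by (rule continuous_within_compose3[OF _ cont_g])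
    have near: "\<exists>d'>0. \<forall>t\<in>{0..1}. dist t t0 < d' \<longrightarrow> dist (u t) (u t0) < \<epsilon> \<and> dist (p t) (p t0) < \<epsilon>" if "\<epsilon> > 0" for \<epsilon>
    proof -
      obtain d1 d2 where "d1 > 0" "\<forall>t\<in>{0..1}. dist t t0 < d1 \<longrightarrow> dist (u t) (u t0) < \<epsilon>"
        "d2 > 0" "\<forall>t\<in>{0..1}. dist t t0 < d2 \<longrightarrow> dist (p t) (p t0) < \<epsilon>"
        using cont_u cont_p \<open>\<epsilon> > 0\<close> unfolding continuous_within_eps_delta by metis
      then show ?thesis by (intro exI[of _ "min d1 d2"]) simp
    qed
    \<comment> \<open>Agreement at \<open>t0\<close> persists because both values stay where
      \<open>phi\<close> is injective; disagreement persists because neither value moves by half of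
      their distance.\<close>
    have "\<exists>d'>0. \<forall>t\<in>{0..1}. dist t t0 < d' \<longrightarrow> (u t = p t \<longleftrightarrow> u t0 = p t0)"
    proof (cases "u t0 = p t0")
      case True
      have "p t0 \<in> Y" using p(2) t0 by (auto simp: path_image_def)
      then obtain \<epsilon> where \<epsilon>: "\<epsilon> > 0" "inj_on phi (ball (p t0) \<epsilon>)" using phi_locally_injective by blast
      obtain d' where d': "d' > 0" "\<forall>t\<in>{0..1}. dist t t0 < d' \<longrightarrow> dist (u t) (u t0) < \<epsilon> \<and> dist (p t) (p t0) < \<epsilon>"
        using near[OF \<epsilon>(1)] by blast
      have "u t = p t" if "t \<in> {0..1}" "dist t t0 < min d d'" for t
      proof (rule inj_onD[OF \<epsilon>(2)])
        have t: "dist t t0 < d" "dist t t0 < d'" using that(2) by simp_all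
        show "phi (u t) = phi (p t)" by (rule phi_u[OF that(1) t(1)])
        have "dist (u t) (p t0) < \<epsilon>" "dist (p t) (p t0) < \<epsilon>"
          using d'(2) that(1) t(2) unfolding True[symmetric] by blast+
        then show "u t \<in> ball (p t0) \<epsilon>" "p t \<in> ball (p t0) \<epsilon>" by (simp_all only: mem_ball dist_commute)
      qed
      then show ?thesis using True d(1) d'(1) by (intro exI[of _ "min d d'"]) auto
    next
      case False
      then have "dist (u t0) (p t0) / 2 > 0" by simp
      then obtain d' where d': "d' > 0" "\<forall>t\<in>{0..1}. dist t t0 < d' \<longrightarrow>
          dist (u t) (u t0) < dist (u t0) (p t0) / 2 \<and> dist (p t) (p t0) < dist (u t0) (p t0) / 2"
        using near by blast
      have "u t \<noteq> p t" if "t \<in> {0..1}" "dist t t0 < d'" for t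
      proof
        assume "u t = p t"
        then have "dist (u t) (u t0) < dist (u t0) (p t0) / 2" "dist (u t) (p t0) < dist (u t0) (p t0) / 2"
          using d'(2) that by auto
        then show False using dist_triangle2[of "u t0" "p t0" "u t"] by (simp add: dist_commute)
      qed
      then show ?thesis using False d'(1) by blast
    qed
    then obtain d' where d': "d' > 0" "\<And>t. t \<in> {0..1} \<Longrightarrow> dist t t0 < d' \<Longrightarrow> (u t = p t \<longleftrightarrow> u t0 = p t0)" by blast
    let ?T = "{0..1} \<inter> ball t0 (min d d')"
    have "Q t \<longleftrightarrow> u t0 = p t0" if "t \<in> ?T" for t
      using that lift_u[of t] d'(2)[of t] by (auto simp: Q_def dist_commute)
    then have "\<forall>x\<in>?T. \<forall>y\<in>?T. Q x \<longrightarrow> Q y" by blast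
    moreover have "openin (top_of_set {0..1}) ?T" by (rule openin_open_Int[OF open_ball])
    moreover have "t0 \<in> ?T" using t0 d(1) d'(1) by simp
    ultimately show "\<exists>T. openin (top_of_set {0..1}) T \<and> t0 \<in> T \<and> (\<forall>x\<in>T. \<forall>y\<in>T. Q x \<longrightarrow> Q y)" by blast
  qed auto
  moreover have "lift (\<beta> 1) = lift \<gamma>"
  proof -
    have "\<beta> 1 = linepath (pathstart \<gamma>) (pathstart \<gamma>) +++ \<gamma>" by (simp add: \<beta>_def origin_def start)
    then have "homotopic_paths X (\<beta> 1) \<gamma>" using \<gamma> by (simp only: homotopic_paths_lid)
    then show ?thesis using homotopy_invariantD[OF lift_invariant \<beta>(1)[of 1]] by simp
  qed
  ultimately show "lift (phi \<circ> p) = p 1" by (simp add: Q_def \<gamma>_def)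
qed

text \<open>Both sides are lifts of the same path to \<open>Y\<close> which agree at the start.\<close>

theorem lift_loop:
  assumes g: "\<gamma> \<in> paths" "pathfinish \<gamma> = z0" and s: "\<sigma> \<in> affine_maps W0" "lift \<gamma> = affine_ext \<alpha> \<sigma> (lift origin)"
    and d: "\<delta> \<in> paths"
  shows "lift (\<gamma> +++ \<delta>) = affine_ext \<alpha> \<sigma> (lift \<delta>)"
proof -
  note G = ucover_pathsD[OF g(1)]
  let ?L = "\<lambda>\<delta>. lift (\<gamma> +++ \<delta>)" and ?S = "affine_ext \<alpha> \<sigma>"
  have join: "\<gamma> +++ \<delta> \<in> paths" if "\<delta> \<in> paths" for \<delta>
    using ucover_pathsD[OF that] g(2) by (intro ucover_paths_join[OF g(1)]) simp_all
  have L_inv: "homotopy_invariant X z0 ?L"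
  proof -
    have "?L \<delta> = ?L \<delta>'" if "\<delta> \<in> paths" "homotopic_paths X \<delta> \<delta>'" for \<delta> \<delta>'
    proof -
      have "homotopic_paths X (\<gamma> +++ \<delta>) (\<gamma> +++ \<delta>')"
        using G that(2) ucover_pathsD[OF that(1)] g(2) by (intro homotopic_paths_join) simp_all
      then show ?thesis by (rule homotopy_invariantD[OF lift_invariant join[OF that(1)]])
    qed
    then show ?thesis unfolding homotopy_invariant_def by blast
  qed
  \<comment> \<open>By associativity up to homotopy, a branch of the shifted function at \<delta> is
    a branch of \<open>lift\<close> at \<open>\<gamma> +++ \<delta>\<close>, whose holomorphy is
    known.\<close>
  have L_branch: "vbranch ?L \<delta> w = vbranch lift (\<gamma> +++ \<delta>) w"
    if "\<delta> \<in> paths" "ball (pathfinish \<delta>) e \<subseteq> X" "w \<in> ball (pathfinish \<delta>) e" for \<delta> e w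
  proof -
    let ?l = "linepath (pathfinish \<delta>) w"
    have c: "pathfinish \<delta> \<in> ball (pathfinish \<delta>) e" using that(3) by (auto intro: le_less_trans[OF zero_le_dist])
    have l: "path_image ?l \<subseteq> X" using linepath_in_convex[OF convex_ball c that(3)] that(2) by blast
    have "homotopic_paths X (\<gamma> +++ (\<delta> +++ ?l)) ((\<gamma> +++ \<delta>) +++ ?l)"
      using G ucover_pathsD[OF that(1)] g(2) l by (intro homotopic_paths_assoc) simp_all
    moreover have "\<gamma> +++ (\<delta> +++ ?l) \<in> paths" using l by (intro join ucover_paths_join[OF that(1)]) simp_all
    ultimately show ?thesis unfolding vbranch_def using homotopy_invariantD[OF lift_invariant] by simp
  qed
  have "?L \<delta> $ k - ?S (lift \<delta>) $ k = 0" for k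
  proof -
    let ?F = "\<lambda>\<delta>. ?L \<delta> $ k - ?S (lift \<delta>) $ k"
    have br: "vbranch ?F \<delta> = (\<lambda>q. vbranch ?L \<delta> q $ k - ?S (vbranch lift \<delta> q) $ k)" for \<delta>
      by (simp add: vbranch_def fun_eq_iff)
    have "ucover_holomorphic X z0 ?F"
    proof (rule ucover_holomorphicI)
      show "homotopy_invariant X z0 ?F"
        using L_inv lift_invariant unfolding homotopy_invariant_def by (metis (no_types, lifting))
      fix \<delta> assume d: "\<delta> \<in> paths"
      obtain e where e: "e > 0" "ball (pathfinish \<delta>) e \<subseteq> X"
        "\<And>w a. w \<in> ball (pathfinish \<delta>) e \<Longrightarrow> holo_at (\<lambda>q. vbranch lift \<delta> q $ a) w" using lift_holo_near[OF d] by blast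
      obtain e' where e': "e' > 0" "\<And>w a. w \<in> ball (pathfinish \<delta>) e' \<Longrightarrow> holo_at (\<lambda>q. vbranch lift (\<gamma> +++ \<delta>) q $ a) w"
        using lift_holo_near[OF join[OF d]] by auto
      let ?B = "ball (pathfinish \<delta>) (min e e')"
      have BX: "?B \<subseteq> X" using e(2) by auto
      have "holo_at (vbranch ?F \<delta>) w" if w: "w \<in> ?B" for w
      proof -
        have "holo_at (\<lambda>q. vbranch lift (\<gamma> +++ \<delta>) q $ k - ?S (vbranch lift \<delta> q) $ k) w"
          using w by (intro holo_at_diff holo_at_affine_ext e(3) e'(2)) simp_all
        then show ?thesis
          by (rule holo_at_cong[OF open_ball w, rotated]) (simp only: br L_branch[OF d BX])
      qed
      then show "\<exists>e>0. ball (pathfinish \<delta>) e \<subseteq> X \<and> (\<forall>w\<in>ball (pathfinish \<delta>) e. holo_at (vbranch ?F \<delta>) w)"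
        using e(1) e'(1) BX by (intro exI[of _ "min e e'"]) simp
    qed
    \<comment> \<open>Near \<open>z0\<close> both branches are preimages of \<open>q\<close> under
      \<open>phi\<close> close to the same point \<open>y\<close>, where \<open>phi\<close> is
      injective.\<close>
    moreover have "\<exists>r>0. \<forall>q\<in>ball (pathfinish origin) r. vbranch ?F origin q = 0"
    proof -
      define y where "y = ?S (lift origin)"
      have "phi y = z0" using phi_invariant[OF s(1)] phi_lift[OF origin_path] by (simp add: y_def origin_finish)
      then have "y \<in> Y" using z0 by (simp add: Y_def)
      then obtain \<epsilon> where \<epsilon>: "\<epsilon> > 0" "inj_on phi (ball y \<epsilon>)" using phi_locally_injective by blast
      obtain e where e: "e > 0" "ball z0 e \<subseteq> X"
        "\<And>w a. w \<in> ball z0 e \<Longrightarrow> holo_at (\<lambda>q. vbranch lift origin q $ a) w"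
        using lift_holo_near[OF origin_path] unfolding origin_finish by blast
      obtain e' where e': "e' > 0" "\<And>w a. w \<in> ball z0 e' \<Longrightarrow> holo_at (\<lambda>q. vbranch lift (\<gamma> +++ origin) q $ a) w"
        using lift_holo_near[OF join[OF origin_path]] by (auto simp: origin_finish)
      have a0: "vbranch lift (\<gamma> +++ origin) z0 = y"
      proof -
        have "homotopic_paths X (\<gamma> +++ origin) \<gamma>"
          using homotopic_paths_rid[OF G(1,2)] by (simp add: origin_def g(2))
        then have "lift (\<gamma> +++ origin) = y"
          using homotopy_invariantD[OF lift_invariant join[OF origin_path]] s(2) by (simp add: y_def)
        then show ?thesis using vbranch_pathfinish[OF lift_invariant join[OF origin_path]] by (simp add: origin_finish)
      qed
      have b0: "?S (vbranch lift origin z0) = y"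
        using vbranch_pathfinish[OF lift_invariant origin_path] by (simp add: y_def origin_finish)
      have "isCont (vbranch lift (\<gamma> +++ origin)) z0" "isCont (\<lambda>q. ?S (vbranch lift origin q)) z0"
        using e(1) e'(1) by (intro isCont_componentwise holo_at_continuous e'(2) holo_at_affine_ext e(3); simp)+
      then obtain d1 d2 where d: "d1 > 0" "\<And>q. dist q z0 < d1 \<Longrightarrow> dist (vbranch lift (\<gamma> +++ origin) q) y < \<epsilon>"
        "d2 > 0" "\<And>q. dist q z0 < d2 \<Longrightarrow> dist (?S (vbranch lift origin q)) y < \<epsilon>"
        using \<epsilon>(1) unfolding continuous_at_eps_delta a0 b0 by metis
      have "vbranch ?F origin q = 0" if q: "q \<in> ball z0 (min e (min d1 d2))" for q
      proof -
        have qe: "q \<in> ball z0 e" using q by simp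
        have "phi (vbranch lift (\<gamma> +++ origin) q) = q"
          using e(2) qe by (intro phi_vbranch_lift[OF join[OF origin_path], of e]) (simp_all add: origin_finish)
        moreover have "phi (?S (vbranch lift origin q)) = q"
          unfolding phi_invariant[OF s(1)]
          using e(2) qe by (intro phi_vbranch_lift[OF origin_path, of e]) (simp_all add: origin_finish)
        ultimately have phi_eq: "phi (vbranch lift (\<gamma> +++ origin) q) = phi (?S (vbranch lift origin q))" by (simp only:)
        have "vbranch lift (\<gamma> +++ origin) q = ?S (vbranch lift origin q)"
        proof (rule inj_onD[OF \<epsilon>(2) phi_eq])
          have "dist q z0 < d1" "dist q z0 < d2" using q by (simp_all add: dist_commute)
          then have "dist (vbranch lift (\<gamma> +++ origin) q) y < \<epsilon>" "dist (?S (vbranch lift origin q)) y < \<epsilon>"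
            using d(2,4) by blast+
          then show "vbranch lift (\<gamma> +++ origin) q \<in> ball y \<epsilon>" "?S (vbranch lift origin q) \<in> ball y \<epsilon>"
            by (simp_all only: mem_ball dist_commute)
        qed
        moreover have "vbranch ?L origin q = vbranch lift (\<gamma> +++ origin) q"
          using e(2) qe by (intro L_branch[OF origin_path, of e]) (simp_all add: origin_finish)
        ultimately show ?thesis by (simp add: br)
      qed
      then show ?thesis using e(1) d(1,3) by (intro exI[of _ "min e (min d1 d2)"]) (simp add: origin_finish)
    qed
    ultimately show ?thesis using ucover_holomorphic_identity[OF _ origin_path _ _ d] by blast
  qed
  then show ?thesis by (simp add: vec_eq_iff)
qed

text \<open>The affine map \<sigma> written in the flat coordinates \<open>v\<close> instead of
  \<open>x\<close>.\<close>

definition conj_map :: "('a \<Rightarrow> 'a) \<Rightarrow> complex^'b \<Rightarrow> complex^'b" where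
  "conj_map \<sigma> w = M *v affine_ext \<alpha> \<sigma> (matrix_inv M *v (w - B)) + B"

lemma conj_map_affine: "\<exists>A b. conj_map \<sigma> = (\<lambda>w. A *v w + b)"
proof -
  define K where "K = (\<chi> k r. coords \<alpha> (\<sigma> (coroot (\<alpha> r)) - \<sigma> 0) $ k)"
  define c where "c = coords \<alpha> (\<sigma> 0)"
  have K: "affine_ext \<alpha> \<sigma> x = K *v x + c" for x unfolding K_def c_def by (rule affine_ext_matrix)
  have "conj_map \<sigma> w = (M ** K ** matrix_inv M) *v w + (M *v c - (M ** K ** matrix_inv M) *v B + B)" for w
    unfolding conj_map_def K
    by (simp add: matrix_vector_right_distrib matrix_vector_mult_diff_distrib matrix_vector_mul_assoc matrix_mul_assoc algebra_simps)
  then show ?thesis by (intro exI ext)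
qed

lemma conj_map_v: "conj_map \<sigma> (v \<delta>) = M *v affine_ext \<alpha> \<sigma> (lift \<delta>) + B"
  by (simp add: conj_map_def lift_def)

text \<open>A loop moves the lift of the base point within its fibre, so \<open>phi_fibre\<close>
  names the \<sigma> that \<open>lift_loop\<close> propagates. Conversely a path in \<open>Y\<close>
  from that lift to its image under \<sigma> projects to a loop.\<close>

theorem monodromy_eq: "monodromy X z0 v = conj_map ` affine_maps W0"
proof (intro equalityI subsetI)
  fix f assume "f \<in> monodromy X z0 v"
  then obtain A b \<gamma> where f: "f = (\<lambda>w. A *v w + b)" and g: "\<gamma> \<in> paths" "pathfinish \<gamma> = z0"
    and v: "\<And>\<delta>. \<delta> \<in> paths \<Longrightarrow> v (\<gamma> +++ \<delta>) = A *v v \<delta> + b" unfolding monodromy_def by blast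
  have "phi (lift origin) = phi (lift \<gamma>)" using phi_lift[OF origin_path] phi_lift[OF g(1)] g(2) by (simp add: origin_finish)
  then obtain \<sigma> where s: "\<sigma> \<in> affine_maps W0" "lift \<gamma> = affine_ext \<alpha> \<sigma> (lift origin)" using phi_fibre by blast
  obtain A' b' where f': "conj_map \<sigma> = (\<lambda>w. A' *v w + b')" using conj_map_affine by blast
  have eq: "A *v v \<delta> + b = A' *v v \<delta> + b'" if "\<delta> \<in> paths" for \<delta>
    using v[OF that] lift_loop[OF g s that] v_lift[of "\<gamma> +++ \<delta>"] conj_map_v[of \<sigma> \<delta>] unfolding f' by simp
  obtain e where e: "e > 0" "ball (pathfinish \<delta>1) e \<subseteq> X" using v_holo_near[OF \<delta>1(1)] by blast
  have "open (phi -` ball (pathfinish \<delta>1) e)" by (rule open_vimage[OF open_ball continuous_phi])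
  moreover have "y1 \<in> phi -` ball (pathfinish \<delta>1) e" using \<delta>1(2) e(1) by simp
  ultimately obtain r where r: "r > 0" "ball y1 r \<subseteq> phi -` ball (pathfinish \<delta>1) e" using openE by blast
  \<comment> \<open>The affine map of a loop is constrained only on values of \<open>v\<close>.
    These fill an open set, which determines it.\<close>
  have near: "(A ** M) *v x + (A *v B + b) = (A' ** M) *v x + (A' *v B + b')" if x: "x \<in> ball y1 (min r e1)" for x
  proof -
    have w: "phi x \<in> ball (pathfinish \<delta>1) e" using x r(2) by auto
    have c: "pathfinish \<delta>1 \<in> ball (pathfinish \<delta>1) e" using e(1) by simp
    have "\<delta>1 +++ linepath (pathfinish \<delta>1) (phi x) \<in> paths"
      using linepath_in_convex[OF convex_ball c w] e(2) by (intro ucover_paths_join[OF \<delta>1(1)]) auto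
    from eq[OF this] have "A *v (M *v x + B) + b = A' *v (M *v x + B) + b'"
      using germ(2)[of x] x by (simp add: vbranch_def)
    then show ?thesis by (simp add: matrix_vector_right_distrib matrix_vector_mul_assoc add.assoc)
  qed
  have all: "(A ** M) *v x + (A *v B + b) = (A' ** M) *v x + (A' *v B + b')" for x
    by (rule affine_eq_on_ball[of "min r e1" y1, OF _ near]) (use r(1) germ(1) in simp_all)
  have "A *v w + b = A' *v w + b'" for w
  proof -
    have w: "w = M *v (matrix_inv M *v (w - B)) + B" by (simp add: M_inverse)
    show ?thesis
      using all[of "matrix_inv M *v (w - B)"] unfolding matrix_vector_mul_assoc[symmetric] M_inverse
      by (simp add: matrix_vector_mult_diff_distrib)
  qed
  then have "f = conj_map \<sigma>" unfolding f f' by (intro ext)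
  then show "f \<in> conj_map ` affine_maps W0" using s(1) by blast
next
  fix f assume "f \<in> conj_map ` affine_maps W0"
  then obtain \<sigma> where s: "\<sigma> \<in> affine_maps W0" "f = conj_map \<sigma>" by blast
  have phi0: "phi (lift origin) = z0" using phi_lift[OF origin_path] by (simp add: origin_finish)
  then have "lift origin \<in> Y" "affine_ext \<alpha> \<sigma> (lift origin) \<in> Y"
    using z0 phi_invariant[OF s(1)] by (simp_all add: Y_def)
  \<comment> \<open>Both ends lie over \<open>z0\<close>, so the projection of \<open>p\<close> is a
    loop whose lift ends at the image under \<sigma>.\<close>
  then obtain p where p: "path p" "path_image p \<subseteq> Y" "pathstart p = lift origin" "pathfinish p = affine_ext \<alpha> \<sigma> (lift origin)"
    using path_connected_Y unfolding path_connected_def by blast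
  have g: "phi \<circ> p \<in> paths" "lift (phi \<circ> p) = affine_ext \<alpha> \<sigma> (lift origin)"
    using lift_path[OF p(1,2)] p(3,4) by (simp_all add: pathstart_def pathfinish_def)
  have end_eq: "pathfinish (phi \<circ> p) = z0"
    using p(4) phi_invariant[OF s(1)] phi0 by (simp add: pathfinish_compose)
  have "v ((phi \<circ> p) +++ \<delta>) = conj_map \<sigma> (v \<delta>)" if "\<delta> \<in> paths" for \<delta>
    using lift_loop[OF g(1) end_eq s(1) g(2) that] v_lift[of "(phi \<circ> p) +++ \<delta>"] conj_map_v[of \<sigma> \<delta>] by simp
  moreover obtain A b where "conj_map \<sigma> = (\<lambda>w. A *v w + b)" using conj_map_affine by blast
  ultimately show "f \<in> monodromy X z0 v" unfolding monodromy_def s(2) using g(1) end_eq by auto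
qed

lemma affine_maps_W0: "\<sigma> \<in> affine_maps W0 \<Longrightarrow> \<sigma> \<in> affine_maps (weyl R)"
  using W0_weyl unfolding affine_maps_def by blast

lemmas subgroup_W0 = subgroup_affine_maps[OF subgroup_stab_weyl stab_weyl_subset, of "omega \<alpha> m"]

lemma conj_map_comp:
  assumes "\<sigma> \<in> affine_maps W0" "\<tau> \<in> affine_maps W0"
  shows "conj_map (\<sigma> \<circ> \<tau>) = conj_map \<sigma> \<circ> conj_map \<tau>"
  by (rule ext) (simp add: conj_map_def M_inverse affine_ext_comp[OF assms[THEN affine_maps_W0]])

lemma bij_conj_map:
  assumes s: "\<sigma> \<in> affine_maps W0" shows "bij (conj_map \<sigma>)"
proof (rule o_bij)
  note b = subgroup_BijGroup_UNIV_D[OF subgroup_W0]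
  have id: "conj_map id = id" by (rule ext) (simp add: conj_map_def affine_ext_id M_inverse)
  have "fun_inv \<sigma> \<circ> \<sigma> = id" "\<sigma> \<circ> fun_inv \<sigma> = id"
    using inv_o_cancel[OF bij_is_inj[OF b(2)[OF s]]] bij_is_surj[OF b(2)[OF s]] unfolding surj_iff by blast+
  then show "conj_map (fun_inv \<sigma>) \<circ> conj_map \<sigma> = id" "conj_map \<sigma> \<circ> conj_map (fun_inv \<sigma>) = id"
    using conj_map_comp[OF b(4)[OF s] s] conj_map_comp[OF s b(4)[OF s]] id by simp_all
qed

theorem monodromy_group_iso: "monodromy_group X z0 v \<cong> transformation_group (affine_maps W0)"
proof -
  note b = subgroup_BijGroup_UNIV_D[OF subgroup_W0]
  have "conj_map \<in> iso (transformation_group (affine_maps W0)) (monodromy_group X z0 v)"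
  proof (rule isoI)
    show "conj_map \<in> hom (transformation_group (affine_maps W0)) (monodromy_group X z0 v)"
    proof (rule homI)
      fix \<sigma> \<tau> assume "\<sigma> \<in> carrier (transformation_group (affine_maps W0))" "\<tau> \<in> carrier (transformation_group (affine_maps W0))"
      then have st: "\<sigma> \<in> affine_maps W0" "\<tau> \<in> affine_maps W0" by simp_all
      show "conj_map (\<sigma> \<otimes>\<^bsub>transformation_group (affine_maps W0)\<^esub> \<tau>) =
          conj_map \<sigma> \<otimes>\<^bsub>monodromy_group X z0 v\<^esub> conj_map \<tau>"
        unfolding monodromy_group_def mult_transformation_group
          BijGroup_UNIV_mult[OF b(2)[OF st(1)] b(2)[OF st(2)]]
          BijGroup_UNIV_mult[OF bij_conj_map[OF st(1)] bij_conj_map[OF st(2)]]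
        by (rule conj_map_comp[OF st])
    qed (simp add: monodromy_group_def monodromy_eq)
    have "inj_on conj_map (affine_maps W0)"
    proof (rule inj_onI)
      fix \<sigma> \<tau> assume st: "\<sigma> \<in> affine_maps W0" "\<tau> \<in> affine_maps W0" and eq: "conj_map \<sigma> = conj_map \<tau>"
      have "affine_ext \<alpha> \<sigma> x = affine_ext \<alpha> \<tau> x" for x
      proof -
        have "M *v affine_ext \<alpha> \<sigma> x = M *v affine_ext \<alpha> \<tau> x"
          using fun_cong[OF eq, of "M *v x + B"] by (simp add: conj_map_def M_inverse)
        then show ?thesis by (metis M_inverse(1))
      qed
      then show "\<sigma> = \<tau>" using affine_ext_inj[OF affine_maps_W0[OF st(1)] affine_maps_W0[OF st(2)]] by blast
    qed
    then show "bij_betw conj_map (carrier (transformation_group (affine_maps W0))) (carrier (monodromy_group X z0 v))"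
      by (simp add: bij_betw_def monodromy_group_def monodromy_eq)
  qed
  then have "transformation_group (affine_maps W0) \<cong> monodromy_group X z0 v" unfolding is_iso_def by blast
  \<comment> \<open>Reversing the isomorphism requires the group axioms at its source, where
    \<open>subgroup_W0\<close> provides them.\<close>
  then show ?thesis by (rule group.iso_sym[OF group_transformation_group[OF subgroup_W0]])
qed

end

text \<open>Any point of \<open>Y\<close>, with a path from \<open>z0\<close> to its image, supplies
  the germ that \<open>developed_pencil\<close> asks for.\<close>

theorem (in flat_pencil) monodromy_group_isomorphic:
  "monodromy_group X z0 v \<cong> transformation_group (affine_maps W0)"
proof -
  obtain y1 where y1: "y1 \<in> Y" using Y_nonempty by blast
  then have "phi y1 \<in> X" by (simp add: Y_def)
  then obtain \<delta>1 where d: "path \<delta>1" "path_image \<delta>1 \<subseteq> X" "pathstart \<delta>1 = z0" "pathfinish \<delta>1 = phi y1"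
    using path_connected_X z0 unfolding path_connected_def by blast
  then have d1: "\<delta>1 \<in> paths" by (intro ucover_pathsI)
  obtain e1 M B where e: "e1 > 0" "det M \<noteq> 0" "\<forall>x\<in>ball y1 e1. vbranch v \<delta>1 (phi x) = M *v x + B"
    using v_affine_near[OF d1 d(4)[symmetric]] by blast
  interpret developed_pencil R \<alpha> m z g \<eta> z0 v M B \<delta>1 y1 e1
    by unfold_locales (use e d1 d(4) in auto)
  show ?thesis by (rule monodromy_group_iso)
qed

theorem theorem4p11:
  fixes R :: "'v::euclidean_space set"
    and \<alpha> :: "'n::finite \<Rightarrow> 'v"
    and m :: "'n \<Rightarrow> nat"
    and z :: "'n \<Rightarrow> complex \<Rightarrow> complex^'n \<Rightarrow> complex"
    and g \<eta> :: "complex^'n \<Rightarrow> complex^'n^'n"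
    and b z0 :: "complex^'n"
    and v :: "(real \<Rightarrow> complex^'n) \<Rightarrow> complex^'n"
  assumes "reduced_root_system R" and "irreducible_root_system R"
    and "\<forall>a\<in>R. a \<bullet> a \<in> \<rat>"
    and "simple_roots R \<alpha>"
    and "omega \<alpha> m \<noteq> 0"
    and "pencil_generators R \<alpha> m z g \<eta>"
    and "b \<in> - D_eta \<eta>" and "E_diagonalizable \<alpha> m \<eta> b"
    and "z0 \<in> M_D m \<eta> - Sigma_D m g \<eta>"
    and "flat_coordinates (M_D m \<eta> - Sigma_D m g \<eta>) z0 g v"
  shows "affine_weyl_group R \<alpha> \<cong> semidirect (weyl R) (coroot_lattice \<alpha>) \<and>
    (\<exists>H. subgroup H (affine_weyl_group R \<alpha>) \<and>
       monodromy_group (M_D m \<eta> - Sigma_D m g \<eta>) z0 v \<cong> (affine_weyl_group R \<alpha>)\<lparr>carrier := H\<rparr>) \<and>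
    monodromy_group (M_D m \<eta> - Sigma_D m g \<eta>) z0 v \<cong>
      semidirect (stab_weyl R (omega \<alpha> m)) (coroot_lattice \<alpha>)"
proof -
  interpret based_root_system R \<alpha> by unfold_locales fact+
  interpret weighted_root_system R \<alpha> m by unfold_locales fact+
  interpret flat_pencil R \<alpha> m z g \<eta> z0 v by unfold_locales fact+
  let ?H = "affine_maps W0"
  have H: "(affine_weyl_group R \<alpha>)\<lparr>carrier := ?H\<rparr> = transformation_group ?H"
    by (simp add: affine_weyl_group_def)
  have "subgroup ?H (affine_weyl_group R \<alpha>)"
    by (rule subgroup_affine_weyl_group[OF subgroup_stab_weyl stab_weyl_subset])
  moreover have "transformation_group ?H \<cong> semidirect W0 (coroot_lattice \<alpha>)"
    by (rule affine_maps_iso_semidirect[OF subgroup_stab_weyl stab_weyl_subset])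
  ultimately show ?thesis
    using affine_weyl_group_iso monodromy_group_isomorphic iso_trans[OF monodromy_group_isomorphic]
    unfolding H[symmetric] by blast
qed

end
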